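(* Let $X$ be a locally compact second countable space and $\alpha\in(0,1]$. A point process $\Phi$ on $X$ is discrete $\alpha$-stable if and only if it is (in distribution) a Cox process $\Pi_\zeta$ whose random intensity measure $\zeta$ is a strictly $\alpha$-stable random measure on $X$.
   Context: $X$ is a locally compact second countable (Hausdorff) space with its Borel $\sigma$-algebra. A random measure on $X$ is a random element in the space of (non-negative) Radon measures on $X$ (measures finite on relatively compact Borel sets), with the $\sigma$-algebra generated by evaluations on Borel sets. A point process is a random measure whose realisations are locally finite counting measures $\phi=\sum_i\delta_{x_i}$ (multiple points allowed). Strict $\alpha$-stability of a random measure $\zeta$: $t^{1/\alpha}\zeta'+(1-t)^{1/\alpha}\zeta''\overset{\mathcal D}{=}\zeta$ for all $t\in[0,1]$, where $\zeta',\zeta''$ are independent copies of $\zeta$. Thinning: for $t\in[0,1]$ and a point process $\Phi$, $t\circ\Phi$ is the point process obtained by retaining each unit mass $\delta_{x_i}$ of $\Phi=\sum_i\delta_{x_i}$ with probability $t$ and removing it with probability $1-t$, independently of the other masses. Discrete $\alpha$-stability of a point process $\Phi$: $t^{1/\alpha}\circ\Phi'+(1-t)^{1/\alpha}\circ\Phi''\overset{\mathcal D}{=}\Phi$ for all $t\in[0,1]$, where $\Phi',\Phi''$ are independent copies of $\Phi$ (and the two thinnings are independent). Poisson process $\Pi_\mu$ with (Radon) intensity measure $\mu$: the numbers of points in disjoint relatively compact Borel sets are independent Poisson variables with means given by $\mu$. Cox process $\Pi_\zeta$: conditionally on the random measure $\zeta$, it is a Poisson process with intensity measure $\zeta$.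 *)

theory Defs
  imports "HOL-Probability.Probability"
begin

section \<open>Random measures and point processes\<close>

definition relatively_compact :: "'a::topological_space set \<Rightarrow> bool" where
  "relatively_compact B \<longleftrightarrow> compact (closure B)"

definition radon_measures :: "'a::topological_space measure set" where
  "radon_measures = {\<mu>. sets \<mu> = sets borel \<and>
     (\<forall>B\<in>sets borel. relatively_compact B \<longrightarrow> emeasure \<mu> B < \<infinity>)}"

text \<open>The \<open>\<sigma>\<close>-algebra generated by the evaluations on Borel sets, set up as in
  \<^const>\<open>subprob_algebra\<close>; only the space and the \<open>\<sigma>\<close>-algebra matter.\<close>

definition radon_algebra :: "'a::topological_space measure measure" where
  "radon_algebra = (SUP A\<in>sets borel. vimage_algebra radon_measures (\<lambda>\<mu>. emeasure \<mu> A) borel)"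

text \<open>\<open>atoms I x\<close> is the measure \<open>\<Sum>i\<in>I. \<delta>\<^bsub>x i\<^esub>\<close>: it maps a Borel set \<open>B\<close> to the number of
  indices \<open>i \<in> I\<close> with \<open>x i \<in> B\<close>.\<close>

definition atoms :: "nat set \<Rightarrow> (nat \<Rightarrow> 'a) \<Rightarrow> 'a::topological_space measure" where
  "atoms I x = distr (count_space I) borel x"

text \<open>Countable index sets suffice, because a locally finite sum of unit masses on a locally
  compact second countable space has countably many terms.\<close>

definition counting_measures :: "'a::topological_space measure set" where
  "counting_measures = {\<phi>\<in>radon_measures. \<exists>I x. \<phi> = atoms I x}"

definition counting_algebra :: "'a::topological_space measure measure" where
  "counting_algebra = restrict_space radon_algebra counting_measures"

definition random_measure :: "'w measure \<Rightarrow> ('w \<Rightarrow> 'a::topological_space measure) \<Rightarrow> bool" where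
  "random_measure M \<zeta> \<longleftrightarrow> prob_space M \<and> \<zeta> \<in> M \<rightarrow>\<^sub>M radon_algebra"

definition point_process :: "'w measure \<Rightarrow> ('w \<Rightarrow> 'a::topological_space measure) \<Rightarrow> bool" where
  "point_process M \<Phi> \<longleftrightarrow> random_measure M \<Phi> \<and> (\<forall>\<omega>\<in>space M. \<Phi> \<omega> \<in> counting_measures)"


section \<open>Stability\<close>

definition add_measure :: "'a measure \<Rightarrow> 'a measure \<Rightarrow> 'a measure" where
  "add_measure \<mu> \<nu> = measure_of (space \<mu>) (sets \<mu>) (\<lambda>A. emeasure \<mu> A + emeasure \<nu> A)"

text \<open>The two coordinates of \<open>M \<Otimes>\<^sub>M M\<close> carry the independent copies of \<open>\<zeta>\<close>.
  As \<^prop>\<open>0 powr a = (0::real)\<close>, the values \<open>t = 0\<close> and \<open>t = 1\<close> need no separate treatment.\<close>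

definition strictly_stable :: "real \<Rightarrow> 'w measure \<Rightarrow> ('w \<Rightarrow> 'a::topological_space measure) \<Rightarrow> bool" where
  "strictly_stable \<alpha> M \<zeta> \<longleftrightarrow> random_measure M \<zeta> \<and>
     (\<forall>t\<in>{0..1}.
        distr (M \<Otimes>\<^sub>M M) radon_algebra
          (\<lambda>(\<omega>', \<omega>''). add_measure
             (scale_measure (ennreal (t powr (1 / \<alpha>))) (\<zeta> \<omega>'))
             (scale_measure (ennreal ((1 - t) powr (1 / \<alpha>))) (\<zeta> \<omega>'')))
        = distr M radon_algebra \<zeta>)"

text \<open>\<open>thin_law p \<phi>\<close> is the law of the \<open>p\<close>-thinning of the fixed counting measure \<open>\<phi>\<close>: write
  \<open>\<phi> = \<Sum>i\<in>I. \<delta>\<^bsub>x i\<^esub>\<close> and keep the indices \<open>i\<close> with \<open>b i\<close>, where the \<open>b i\<close> are independent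
  Bernoulli variables with parameter \<open>p\<close>. The law does not depend on the enumeration chosen.\<close>

definition enumeration :: "'a::topological_space measure \<Rightarrow> nat set \<times> (nat \<Rightarrow> 'a)" where
  "enumeration \<phi> = (SOME (I, x). \<phi> = atoms I x)"

definition thin_law :: "real \<Rightarrow> 'a::topological_space measure \<Rightarrow> 'a measure measure" where
  "thin_law p \<phi> = (case enumeration \<phi> of (I, x) \<Rightarrow>
     distr (\<Pi>\<^sub>M i\<in>I. measure_pmf (bernoulli_pmf p)) counting_algebra (\<lambda>b. atoms {i\<in>I. b i} x))"

text \<open>The law of \<open>p \<circ> \<Phi>\<close>: the marks are drawn independently of \<open>\<Phi>\<close>.\<close>

definition thinned_law ::
    "real \<Rightarrow> 'w measure \<Rightarrow> ('w \<Rightarrow> 'a::topological_space measure) \<Rightarrow> 'a measure measure" where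
  "thinned_law p M \<Phi> = distr M counting_algebra \<Phi> \<bind> thin_law p"

definition discrete_stable :: "real \<Rightarrow> 'w measure \<Rightarrow> ('w \<Rightarrow> 'a::topological_space measure) \<Rightarrow> bool" where
  "discrete_stable \<alpha> M \<Phi> \<longleftrightarrow> point_process M \<Phi> \<and>
     (\<forall>t\<in>{0..1}.
        distr (thinned_law (t powr (1 / \<alpha>)) M \<Phi> \<Otimes>\<^sub>M thinned_law ((1 - t) powr (1 / \<alpha>)) M \<Phi>)
          counting_algebra (\<lambda>(\<phi>', \<phi>''). add_measure \<phi>' \<phi>'')
        = distr M counting_algebra \<Phi>)"


section \<open>Poisson and Cox processes\<close>

text \<open>The Poisson weights are written out because \<^const>\<open>poisson_pmf\<close> excludes the mean \<open>0\<close>,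
  where the formula below gives the point mass at \<open>0\<close>.\<close>

definition poisson_process ::
    "'a::topological_space measure \<Rightarrow> 'w measure \<Rightarrow> ('w \<Rightarrow> 'a measure) \<Rightarrow> bool" where
  "poisson_process \<mu> M \<Phi> \<longleftrightarrow> point_process M \<Phi> \<and>
     (\<forall>\<B>. finite \<B> \<and> disjoint \<B> \<and> (\<forall>B\<in>\<B>. B \<in> sets borel \<and> relatively_compact B) \<longrightarrow>
        prob_space.indep_vars M (\<lambda>_. borel) (\<lambda>B \<omega>. emeasure (\<Phi> \<omega>) B) \<B>) \<and>
     (\<forall>B\<in>sets borel. relatively_compact B \<longrightarrow>
        (\<forall>k. measure M {\<omega>\<in>space M. emeasure (\<Phi> \<omega>) B = of_nat k}
           = measure \<mu> B ^ k / fact k * exp (- measure \<mu> B)))"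

text \<open>\<open>K\<close> is a regular conditional distribution of \<open>\<Phi>\<close> given \<open>\<zeta>\<close>, and \<open>K \<mu>\<close> is the law of a
  Poisson process with intensity measure \<open>\<mu>\<close>.\<close>

definition cox_process ::
    "'w measure \<Rightarrow> ('w \<Rightarrow> 'a::topological_space measure) \<Rightarrow> ('w \<Rightarrow> 'a measure) \<Rightarrow> bool" where
  "cox_process M \<zeta> \<Phi> \<longleftrightarrow> random_measure M \<zeta> \<and> point_process M \<Phi> \<and>
     (\<exists>K \<in> radon_algebra \<rightarrow>\<^sub>M prob_algebra counting_algebra.
        (\<forall>\<mu>\<in>radon_measures. poisson_process \<mu> (K \<mu>) (\<lambda>\<phi>. \<phi>)) \<and>
        (\<forall>C\<in>sets radon_algebra. \<forall>A\<in>sets counting_algebra.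
           emeasure M {\<omega>\<in>space M. \<zeta> \<omega> \<in> C \<and> \<Phi> \<omega> \<in> A}
           = (\<integral>\<^sup>+\<omega>. indicator C (\<zeta> \<omega>) * emeasure (K (\<zeta> \<omega>)) A \<partial>M)))"


section \<open>Basic facts\<close>

lemma space_radon_algebra: "space radon_algebra = radon_measures"
  unfolding radon_algebra_def by (subst space_Sup_eq_UN) auto

lemma space_counting_algebra: "space counting_algebra = counting_measures"
  by (auto simp: counting_algebra_def space_restrict_space space_radon_algebra counting_measures_def)

lemma measurable_emeasure_radon:
  "B \<in> sets borel \<Longrightarrow> (\<lambda>\<mu>. emeasure \<mu> B) \<in> borel_measurable radon_algebra"
  unfolding radon_algebra_def
  by (auto intro!: measurable_Sup1[OF imageI] measurable_vimage_algebra1)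

lemma measurable_radon_algebraI:
  assumes "\<And>\<omega>. \<omega> \<in> space M \<Longrightarrow> f \<omega> \<in> radon_measures"
    and "\<And>B. B \<in> sets borel \<Longrightarrow> (\<lambda>\<omega>. emeasure (f \<omega>) B) \<in> borel_measurable M"
  shows "f \<in> M \<rightarrow>\<^sub>M radon_algebra"
  unfolding radon_algebra_def
  by (auto intro!: measurable_Sup2 measurable_vimage_algebra2 assms)

lemma emeasure_atoms:
  "B \<in> sets borel \<Longrightarrow> emeasure (atoms I x) B = emeasure (count_space I) {i\<in>I. x i \<in> B}"
  unfolding atoms_def
  by (subst emeasure_distr) (auto intro!: arg_cong[where f = "emeasure _"])

lemma space_add_measure [simp]: "space (add_measure \<mu> \<nu>) = space \<mu>"
  and sets_add_measure [simp]: "sets (add_measure \<mu> \<nu>) = sets \<mu>"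
  by (simp_all add: add_measure_def)

lemma emeasure_add_measure:
  assumes "sets \<nu> = sets \<mu>"
  shows "emeasure (add_measure \<mu> \<nu>) A = emeasure \<mu> A + emeasure \<nu> A"
proof (cases "A \<in> sets \<mu>")
  case True
  show ?thesis unfolding add_measure_def
  proof (rule emeasure_measure_of_sigma)
    show "sigma_algebra (space \<mu>) (sets \<mu>)" ..
    show "positive (sets \<mu>) (\<lambda>A. emeasure \<mu> A + emeasure \<nu> A)" by (simp add: positive_def)
    show "countably_additive (sets \<mu>) (\<lambda>A. emeasure \<mu> A + emeasure \<nu> A)"
      using assms by (auto simp: countably_additive_def suminf_add[symmetric] suminf_emeasure)
  qed (fact True)
next
  case False
  then show ?thesis using assms by (simp add: emeasure_notin_sets)
qed

text \<open>Every Cox process driven by a strictly stable random measure, on whatever sample space, can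
  be realised on pairs of measures with the same laws. Existential statements about such processes
  therefore lose nothing by fixing that type of sample space.\<close>

lemma measurable_stable_combination:
  assumes "0 \<le> a" "0 \<le> b"
  shows "(\<lambda>(\<mu>, \<nu>). add_measure (scale_measure (ennreal a) \<mu>) (scale_measure (ennreal b) \<nu>))
    \<in> radon_algebra \<Otimes>\<^sub>M radon_algebra \<rightarrow>\<^sub>M radon_algebra"
proof (rule measurable_radon_algebraI)
  fix p :: "'a measure \<times> 'a measure" assume "p \<in> space (radon_algebra \<Otimes>\<^sub>M radon_algebra)"
  then show "(case p of (\<mu>, \<nu>) \<Rightarrow>
      add_measure (scale_measure (ennreal a) \<mu>) (scale_measure (ennreal b) \<nu>)) \<in> radon_measures"
    by (auto simp: space_pair_measure space_radon_algebra radon_measures_def emeasure_add_measure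
        ennreal_mult_less_top less_top)
next
  fix B :: "'a set" assume B: "B \<in> sets borel"
  note [measurable] = measurable_emeasure_radon[OF B]
  have "(\<lambda>p. ennreal a * emeasure (fst p) B + ennreal b * emeasure (snd p) B)
      \<in> borel_measurable (radon_algebra \<Otimes>\<^sub>M radon_algebra)"
    by measurable
  then show "(\<lambda>p. emeasure (case p of (\<mu>, \<nu>) \<Rightarrow>
      add_measure (scale_measure (ennreal a) \<mu>) (scale_measure (ennreal b) \<nu>)) B)
      \<in> borel_measurable (radon_algebra \<Otimes>\<^sub>M radon_algebra)"
    by (rule measurable_cong[THEN iffD1, rotated])
      (auto simp: space_pair_measure space_radon_algebra radon_measures_def emeasure_add_measure)
qed

lemma canonical_sample_space:
  fixes \<zeta> \<Phi> :: "'w \<Rightarrow> 'a::topological_space measure"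
  assumes stable: "strictly_stable \<alpha> M \<zeta>" and cox: "cox_process M \<zeta> \<Phi>"
  shows "\<exists>(N :: ('a measure \<times> 'a measure) measure) \<zeta>' \<Phi>'.
    strictly_stable \<alpha> N \<zeta>' \<and> cox_process N \<zeta>' \<Phi>' \<and>
    distr N counting_algebra \<Phi>' = distr M counting_algebra \<Phi>"
proof -
  interpret prob_space M using stable by (simp add: strictly_stable_def random_measure_def)
  have \<zeta>[measurable]: "\<zeta> \<in> M \<rightarrow>\<^sub>M radon_algebra"
    using stable by (simp add: strictly_stable_def random_measure_def)
  have \<Phi>[measurable]: "\<Phi> \<in> M \<rightarrow>\<^sub>M counting_algebra"
    using cox unfolding cox_process_def point_process_def random_measure_def counting_algebra_def
    by (auto intro!: measurable_restrict_space2)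
  define f where "f = (\<lambda>\<omega>. (\<zeta> \<omega>, \<Phi> \<omega>))"
  define N where "N = distr M (radon_algebra \<Otimes>\<^sub>M counting_algebra) f"
  have f[measurable]: "f \<in> M \<rightarrow>\<^sub>M radon_algebra \<Otimes>\<^sub>M counting_algebra" unfolding f_def by measurable
  interpret N: prob_space N unfolding N_def by (rule prob_space_distr) (rule f)
  have spN: "space N = radon_measures \<times> counting_measures"
    by (simp add: N_def space_pair_measure space_radon_algebra space_counting_algebra)
  have m1: "fst \<in> N \<rightarrow>\<^sub>M radon_algebra" and m2: "snd \<in> N \<rightarrow>\<^sub>M counting_algebra"
    unfolding N_def by simp_all
  have m2': "snd \<in> N \<rightarrow>\<^sub>M radon_algebra"
    using m2 by (auto simp: counting_algebra_def intro: measurable_restrict_space2_iff[THEN iffD1, THEN conjunct1])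
  have d1: "distr N radon_algebra fst = distr M radon_algebra \<zeta>"
    unfolding N_def by (subst distr_distr) (auto simp: f_def comp_def)
  have d2: "distr N counting_algebra snd = distr M counting_algebra \<Phi>"
    unfolding N_def by (subst distr_distr) (auto simp: f_def comp_def)
  have rm: "random_measure N fst" and pp: "point_process N snd"
    using m1 m2' N.prob_space_axioms by (auto simp: random_measure_def point_process_def spN)
  have st: "strictly_stable \<alpha> N fst"
    unfolding strictly_stable_def
  proof (intro conjI rm ballI)
    fix t :: real assume t: "t \<in> {0..1}"
    define h where "h = (\<lambda>(\<mu>, \<nu>). add_measure (scale_measure (ennreal (t powr (1 / \<alpha>))) (\<mu>::'a measure))
       (scale_measure (ennreal ((1 - t) powr (1 / \<alpha>))) \<nu>))"
    have h[measurable]: "h \<in> radon_algebra \<Otimes>\<^sub>M radon_algebra \<rightarrow>\<^sub>M radon_algebra"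
      unfolding h_def by (rule measurable_stable_combination) auto
    have gen: "distr (P \<Otimes>\<^sub>M P) radon_algebra (\<lambda>(\<omega>', \<omega>''). h (g \<omega>', g \<omega>''))
        = distr (distr P radon_algebra g \<Otimes>\<^sub>M distr P radon_algebra g) radon_algebra h"
      if P: "prob_space P" and g[measurable]: "g \<in> P \<rightarrow>\<^sub>M radon_algebra"
      for P :: "'v measure" and g
    proof -
      interpret D: prob_space "distr P radon_algebra g"
        using P g by (rule prob_space.prob_space_distr)
      have sf: "sigma_finite_measure (distr P radon_algebra g)" ..
      show ?thesis
        by (subst pair_measure_distr[OF g g sf], subst distr_distr)
          (auto simp: comp_def split_beta' intro!: distr_cong)
    qed
    have "distr (N \<Otimes>\<^sub>M N) radon_algebra (\<lambda>(\<omega>', \<omega>''). h (fst \<omega>', fst \<omega>''))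
        = distr (M \<Otimes>\<^sub>M M) radon_algebra (\<lambda>(\<omega>', \<omega>''). h (\<zeta> \<omega>', \<zeta> \<omega>''))"
      using gen[OF N.prob_space_axioms m1] gen[OF prob_space_axioms \<zeta>] d1 by simp
    also have "\<dots> = distr M radon_algebra \<zeta>"
      using stable t by (simp add: strictly_stable_def h_def)
    finally show "distr (N \<Otimes>\<^sub>M N) radon_algebra
          (\<lambda>(\<omega>', \<omega>''). add_measure
             (scale_measure (ennreal (t powr (1 / \<alpha>))) (fst \<omega>'))
             (scale_measure (ennreal ((1 - t) powr (1 / \<alpha>))) (fst \<omega>'')))
        = distr N radon_algebra fst"
      by (simp add: h_def d1)
  qed
  obtain K where K[measurable]: "K \<in> radon_algebra \<rightarrow>\<^sub>M prob_algebra counting_algebra"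
    and KP: "\<And>\<mu>. \<mu> \<in> radon_measures \<Longrightarrow> poisson_process \<mu> (K \<mu>) (\<lambda>\<phi>. \<phi>)"
    and KC: "\<And>C A. C \<in> sets radon_algebra \<Longrightarrow> A \<in> sets counting_algebra \<Longrightarrow>
      emeasure M {\<omega>\<in>space M. \<zeta> \<omega> \<in> C \<and> \<Phi> \<omega> \<in> A}
      = (\<integral>\<^sup>+\<omega>. indicator C (\<zeta> \<omega>) * emeasure (K (\<zeta> \<omega>)) A \<partial>M)"
    using cox unfolding cox_process_def by blast
  have "cox_process N fst snd"
    unfolding cox_process_def
  proof (intro conjI rm pp bexI[OF _ K] ballI KP)
    fix C :: "'a measure set" and A :: "'a measure set"
    assume C[measurable]: "C \<in> sets radon_algebra" and A[measurable]: "A \<in> sets counting_algebra"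
    have KA[measurable]: "(\<lambda>\<mu>. emeasure (K \<mu>) A) \<in> borel_measurable radon_algebra"
      by (rule measurable_emeasure_kernel[OF measurable_prob_algebraD[OF K] A])
    have eq: "{\<omega>\<in>space N. fst \<omega> \<in> C \<and> snd \<omega> \<in> A} = C \<times> A"
      using sets.sets_into_space[OF C] sets.sets_into_space[OF A]
      by (auto simp: spN space_radon_algebra space_counting_algebra)
    have "emeasure N (C \<times> A) = emeasure M {\<omega>\<in>space M. \<zeta> \<omega> \<in> C \<and> \<Phi> \<omega> \<in> A}"
      unfolding N_def by (subst emeasure_distr)
        (auto simp: f_def intro!: arg_cong[where f = "emeasure M"])
    also have "\<dots> = (\<integral>\<^sup>+\<omega>. indicator C (\<zeta> \<omega>) * emeasure (K (\<zeta> \<omega>)) A \<partial>M)"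
      by (rule KC) fact+
    also have "\<dots> = (\<integral>\<^sup>+\<omega>. indicator C (fst \<omega>) * emeasure (K (fst \<omega>)) A \<partial>N)"
      unfolding N_def by (subst nn_integral_distr) (auto simp: f_def)
    finally show "emeasure N {\<omega>\<in>space N. fst \<omega> \<in> C \<and> snd \<omega> \<in> A}
      = (\<integral>\<^sup>+\<omega>. indicator C (fst \<omega>) * emeasure (K (fst \<omega>)) A \<partial>N)" by (simp add: eq)
  qed
  with st d2 show ?thesis by blast
qed

end

theory Submission
  imports Defs
begin

text \<open>
  Write \<open>G h\<close> for the expectation of \<open>\<Prod>(1 - h (x\<^sub>i))\<close> over the points of \<open>\<Phi>\<close>. Thinning by \<open>p\<close> replaces
  \<open>h\<close> by \<open>p h\<close>, and a Cox process driven by \<open>\<zeta>\<close> has \<open>G h = E exp (-\<integral>h d\<zeta>)\<close>; since laws are determined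
  by \<open>G\<close> and by Laplace functionals, strict stability of \<open>\<zeta>\<close> and discrete stability of its Cox process
  are the same functional equation. Conversely, if \<open>\<Phi>\<close> is discrete stable then
  \<open>G h = G (n\<^bsup>-1/\<alpha>\<^esup> h)\<^bsup>n\<^esup>\<close>, so \<open>G\<close> extends to a functional \<open>L f = G (n\<^bsup>-1/\<alpha>\<^esup> f)\<^bsup>n\<^esup>\<close>, and \<open>L\<close> is the limit of
  the Laplace functionals of \<open>n\<^bsup>-1/\<alpha>\<^esup> (\<Phi>\<^sub>1 + \<dots> + \<Phi>\<^sub>n)\<close> for independent copies \<open>\<Phi>\<^sub>i\<close> of \<open>\<Phi>\<close>. A random measure
  with Laplace functional \<open>L\<close> is obtained as a weak limit: a point of the space is coded by the set of
  those members of a countable base that contain it, so that a measure becomes a consistent system of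
  weights on finite binary prefixes.
\<close>

section \<open>Measures determined by multiplicative families\<close>

text \<open>The functional \<open>L\<close> is easy to write down; the obstacle is to see that it
  belongs to a random measure. A weak limit only yields random values on cylinders, a finitely
  additive object which might be infinite on a bounded set or charge sets of indices that are the
  code of no point. Both defects are excluded by one property: \<open>L\<close> tends to 1 along
  tests that tend to 0 pointwise below a fixed test. It follows from dominated convergence, because
  below a fixed test \<open>L\<close> is a fixed power of \<open>G\<close>, and \<open>G\<close> is
  an expectation over genuine measures. The rescaled sums converge to \<open>L\<close> because 1 -
  exp (- c f) is c f to first order: the Laplace functional of such a sum at \<open>f\<close> is
  exactly \<open>L\<close> at a test slightly below \<open>f\<close>. Tests are Borel functions of
  finitely many digits of the code. They take finitely many values, are closed under nonlinear maps
  such as 1 - exp (- f), and turn each Laplace functional into a finite product of exponentials of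
  cylinder masses.\<close>

text \<open>\<open>F\<close> is closed under products only, so polynomials in its members must be
  made available. \<open>V\<close> consists of the bounded multipliers of \<open>F\<close> into
  \<open>H\<close>, and \<open>W\<close> of the bounded multipliers of \<open>V\<close> into itself.
  \<open>W\<close> is an algebra closed under bounded limits, it contains \<open>F\<close>, and it
  lies in \<open>V\<close> because 1 does; multiplying by 1 leads from \<open>V\<close> back to
  \<open>H\<close>. Uniform approximation then reaches indicators of level sets, and an algebra is
  stable under the set operations.\<close>

lemma functional_monotone_class:
  fixes H :: "('b \<Rightarrow> real) set" and F :: "('b \<Rightarrow> real) set"
  assumes lin: "\<And>f g a b. f \<in> H \<Longrightarrow> g \<in> H \<Longrightarrow> (\<lambda>x. a * f x + b * g x) \<in> H"
    and lim: "\<And>f g C. (\<And>n. f n \<in> H) \<Longrightarrow> (\<And>n x. x \<in> \<Omega> \<Longrightarrow> \<bar>f n x\<bar> \<le> C) \<Longrightarrow>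
      (\<And>x. x \<in> \<Omega> \<Longrightarrow> (\<lambda>n. f n x) \<longlonglongrightarrow> g x) \<Longrightarrow> g \<in> H"
    and sub: "F \<subseteq> H"
    and mult: "\<And>f g. f \<in> F \<Longrightarrow> g \<in> F \<Longrightarrow> (\<lambda>x. f x * g x) \<in> F"
    and one: "(\<lambda>_. 1) \<in> F"
    and range: "\<And>f x. f \<in> F \<Longrightarrow> x \<in> \<Omega> \<Longrightarrow> f x \<in> {0..1}"
    and A: "A \<in> sigma_sets \<Omega> {{x\<in>\<Omega>. f x > a} |f a. f \<in> F}"
  shows "indicator A \<in> H"
proof -
  define bd where "bd h \<longleftrightarrow> (\<exists>C. \<forall>x\<in>\<Omega>. \<bar>h x\<bar> \<le> C)" for h :: "'b \<Rightarrow> real"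
  define V where "V = {h. bd h \<and> (\<forall>f\<in>F. (\<lambda>x. h x * f x) \<in> H)}"
  define W where "W = {h. bd h \<and> (\<forall>g\<in>V. (\<lambda>x. h x * g x) \<in> V)}"
  have bdI: "bd h" if "\<And>x. x \<in> \<Omega> \<Longrightarrow> \<bar>h x\<bar> \<le> C" for h C
    using that by (auto simp: bd_def)
  have bd_mult: "bd (\<lambda>x. h x * k x)" if "bd h" "bd k" for h k
  proof -
    from that obtain C D where "\<forall>x\<in>\<Omega>. \<bar>h x\<bar> \<le> C" "\<forall>x\<in>\<Omega>. \<bar>k x\<bar> \<le> D" by (auto simp: bd_def)
    then show ?thesis by (intro bdI[of _ "\<bar>C\<bar> * \<bar>D\<bar>"]) (auto simp: abs_mult intro!: mult_mono; force)
  qed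
  have bd_lin: "bd (\<lambda>x. a * h x + b * k x)" if "bd h" "bd k" for h k a b
  proof -
    from that obtain C D where C: "\<forall>x\<in>\<Omega>. \<bar>h x\<bar> \<le> C" and D: "\<forall>x\<in>\<Omega>. \<bar>k x\<bar> \<le> D" by (auto simp: bd_def)
    have "\<bar>a * h x + b * k x\<bar> \<le> \<bar>a\<bar> * C + \<bar>b\<bar> * D" if "x \<in> \<Omega>" for x
      using C D that by (auto simp: abs_mult intro!: order.trans[OF abs_triangle_ineq] add_mono mult_left_mono)
    then show ?thesis by (rule bdI)
  qed
  have F_V: "f \<in> V" if "f \<in> F" for f
    using range[OF that] mult[OF that] sub by (force simp: V_def bd_def intro: exI[of _ 1])
  have lin_V: "(\<lambda>x. a * h x + b * k x) \<in> V" if "h \<in> V" "k \<in> V" for h k a b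
  proof -
    have "(\<lambda>x. (a * h x + b * k x) * f x) \<in> H" if "f \<in> F" for f
      using lin[of "\<lambda>x. h x * f x" "\<lambda>x. k x * f x" a b] \<open>h \<in> V\<close> \<open>k \<in> V\<close> that
      by (simp add: V_def algebra_simps)
    then show ?thesis using that bd_lin by (simp add: V_def)
  qed
  have lim_V: "g \<in> V" if f: "\<And>n. f n \<in> V" and C: "\<And>n x. x \<in> \<Omega> \<Longrightarrow> \<bar>f n x\<bar> \<le> C"
    and g: "\<And>x. x \<in> \<Omega> \<Longrightarrow> (\<lambda>n. f n x) \<longlonglongrightarrow> g x" for f g C
  proof -
    have "\<bar>g x\<bar> \<le> C" if "x \<in> \<Omega>" for x
      using C that by (intro LIMSEQ_le_const2[OF tendsto_rabs[OF g[OF that]]]) auto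
    then have "bd g" by (rule bdI)
    moreover have "(\<lambda>x. g x * h x) \<in> H" if "h \<in> F" for h
    proof (rule lim[of "\<lambda>n x. f n x * h x" "C * 1"])
      show "(\<lambda>x. f n x * h x) \<in> H" for n using f that by (simp add: V_def)
      fix n x assume x: "x \<in> \<Omega>"
      show "\<bar>f n x * h x\<bar> \<le> C * 1" unfolding abs_mult
        using C[OF x, of n] range[OF that x] by (intro mult_mono) auto
    qed (intro tendsto_mult g tendsto_const)
    ultimately show ?thesis by (simp add: V_def)
  qed
  have F_W: "f \<in> W" if f: "f \<in> F" for f
  proof -
    have "(\<lambda>x. f x * g x) \<in> V" if g: "g \<in> V" for g
    proof -
      have "(\<lambda>x. f x * g x * h x) \<in> H" if "h \<in> F" for h
        using g mult[OF f that] by (auto simp: V_def ac_simps)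
      then show ?thesis using g F_V[OF f] bd_mult by (simp add: V_def)
    qed
    then show ?thesis using F_V[OF f] by (simp add: W_def V_def)
  qed
  have W_V: "h \<in> V" if "h \<in> W" for h
    using that F_V[OF one] by (force simp: W_def)
  have mult_W: "(\<lambda>x. h x * k x) \<in> W" if "h \<in> W" "k \<in> W" for h k
    using that bd_mult by (auto simp: W_def mult.assoc)
  have lin_W: "(\<lambda>x. a * h x + b * k x) \<in> W" if "h \<in> W" "k \<in> W" for h k a b
  proof -
    have "(\<lambda>x. (a * h x + b * k x) * f x) \<in> V" if "f \<in> V" for f
      using lin_V[of "\<lambda>x. h x * f x" "\<lambda>x. k x * f x" a b] \<open>h \<in> W\<close> \<open>k \<in> W\<close> that
      by (simp add: W_def algebra_simps)
    then show ?thesis using that bd_lin by (simp add: W_def)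
  qed
  have lim_W: "g \<in> W" if f: "\<And>n. f n \<in> W" and C: "\<And>n x. x \<in> \<Omega> \<Longrightarrow> \<bar>f n x\<bar> \<le> C"
    and g: "\<And>x. x \<in> \<Omega> \<Longrightarrow> (\<lambda>n. f n x) \<longlonglongrightarrow> g x" for f g C
  proof -
    have "g \<in> V" using lim_V[of f C g] W_V f C g by blast
    then have "bd g" by (simp add: V_def)
    moreover have "(\<lambda>x. g x * h x) \<in> V" if "h \<in> V" for h
    proof -
      from that obtain D where D: "\<forall>x\<in>\<Omega>. \<bar>h x\<bar> \<le> D" by (auto simp: V_def bd_def)
      show ?thesis
      proof (rule lim_V[of "\<lambda>n x. f n x * h x" "\<bar>C\<bar> * \<bar>D\<bar>"])
        show "(\<lambda>x. f n x * h x) \<in> V" for n using f that by (simp add: W_def)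
        fix n x assume x: "x \<in> \<Omega>"
        show "\<bar>f n x * h x\<bar> \<le> \<bar>C\<bar> * \<bar>D\<bar>" unfolding abs_mult
          using C[OF x, of n] D[rule_format, OF x] by (intro mult_mono) auto
      qed (intro tendsto_mult g tendsto_const)
    qed
    ultimately show ?thesis by (simp add: W_def)
  qed
  have one_W: "(\<lambda>_. 1) \<in> W" by (rule F_W[OF one])
  have cmult_W: "(\<lambda>x. c * h x) \<in> W" if "h \<in> W" for h c
    using lin_W[OF that that, of c 0] by simp
  have pow_W: "(\<lambda>x. h x ^ k) \<in> W" if "h \<in> W" for h k
    by (induction k) (use that mult_W one_W in auto)
  have sum_W: "(\<lambda>x. \<Sum>i\<in>I. h i x) \<in> W" if "finite I" "\<And>i. i \<in> I \<Longrightarrow> h i \<in> W" for h and I :: "nat set"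
    using that
  proof (induction I rule: finite_induct)
    case empty
    show ?case using cmult_W[OF one_W, of 0] by simp
  next
    case (insert i I)
    then show ?case using lin_W[of "h i" "\<lambda>x. \<Sum>i\<in>I. h i x" 1 1] by simp
  qed
  have minus_W: "(\<lambda>x. 1 - h x) \<in> W" if "h \<in> W" for h
    using lin_W[OF one_W that, of 1 "-1"] by simp
  \<comment> \<open>Bernstein polynomials of \<open>\<phi>\<close> evaluated at \<open>f x\<close>
    belong to the algebra \<open>W\<close>. They converge uniformly with error at most 1, whence the
    common bound \<open>C + 1\<close>.\<close>
  have cont_W: "(\<lambda>x. \<phi> (f x)) \<in> W" if f: "f \<in> F" and \<phi>: "continuous_on {0..1} \<phi>" for f \<phi>
  proof -
    have "\<exists>N. \<forall>x\<in>{0..1}. \<bar>\<phi> x - (\<Sum>k\<le>N. \<phi> (k/N) * Bernstein N k x)\<bar> < inverse (Suc n)" for n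
    proof -
      have "0 < inverse (real (Suc n))" by simp
      from Bernstein_Weierstrass[OF \<phi> this] obtain N where
        "\<forall>n' x. N \<le> n' \<and> x \<in> {0..1} \<longrightarrow> \<bar>\<phi> x - (\<Sum>k\<le>n'. \<phi> (k/n') * Bernstein n' k x)\<bar> < inverse (Suc n)" ..
      then show ?thesis by (intro exI[of _ N]) simp
    qed
    then obtain N where N: "\<And>n x. x\<in>{0..1} \<Longrightarrow>
        \<bar>\<phi> x - (\<Sum>k\<le>N n. \<phi> (k/N n) * Bernstein (N n) k x)\<bar> < inverse (Suc n)" by metis
    define p where "p n x = (\<Sum>k\<le>N n. \<phi> (k/N n) * Bernstein (N n) k x)" for n x
    have "bounded (\<phi> ` {0..1})" using \<phi> by (intro compact_imp_bounded compact_continuous_image) auto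
    then obtain C where C: "\<And>x. x\<in>{0..1} \<Longrightarrow> \<bar>\<phi> x\<bar> \<le> C" unfolding bounded_iff by force
    show ?thesis
    proof (rule lim_W[of "\<lambda>n x. p n (f x)" "C + 1"])
      show "(\<lambda>x. p n (f x)) \<in> W" for n unfolding p_def Bernstein_def
        by (intro sum_W cmult_W mult_W pow_W minus_W F_W f) auto
      have le1: "inverse (real (Suc n)) \<le> 1" for n by (simp add: divide_simps)
      fix x assume "x \<in> \<Omega>"
      then have fx: "f x \<in> {0..1}" using range[OF f] by auto
      show "\<bar>p n (f x)\<bar> \<le> C + 1" for n
        using N[OF fx, of n] C[OF fx] le1[of n] unfolding p_def by linarith
      show "(\<lambda>n. p n (f x)) \<longlonglongrightarrow> \<phi> (f x)"
      proof (rule LIMSEQ_I)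
        fix r :: real assume "0 < r"
        then obtain n0 where n0: "inverse (real (Suc n0)) < r" using reals_Archimedean by blast
        have "norm (p n (f x) - \<phi> (f x)) < r" if "n \<ge> n0" for n
        proof -
          have "inverse (real (Suc n)) \<le> inverse (real (Suc n0))" using that by (simp add: field_simps)
          then show ?thesis using N[OF fx, of n] n0 unfolding p_def real_norm_def by linarith
        qed
        then show "\<exists>no. \<forall>n\<ge>no. norm (p n (f x) - \<phi> (f x)) < r" by blast
      qed
    qed
  qed
  have "\<exists>D. A \<subseteq> \<Omega> \<and> indicator A \<in> W" using A
  proof (induction rule: sigma_sets.induct)
    case (Basic a)
    then obtain f c where f: "f \<in> F" and a: "a = {x\<in>\<Omega>. f x > c}" by auto
    \<comment> \<open>Ever steeper ramps that vanish up to \<open>c\<close>, including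
      \<open>c\<close> itself; they tend to the indicator of the open half-line above
      \<open>c\<close>.\<close>
    define \<phi> where "\<phi> n t = min 1 (real n * max 0 (t - c))" for n and t :: real
    have "indicator a \<in> W"
    proof (rule lim_W[of "\<lambda>n x. \<phi> n (f x)" 1])
      show "(\<lambda>x. \<phi> n (f x)) \<in> W" for n
        by (rule cont_W[OF f]) (auto simp: \<phi>_def intro!: continuous_intros)
      show "\<bar>\<phi> n (f x)\<bar> \<le> 1" for n x by (simp add: \<phi>_def)
      fix x assume x: "x \<in> \<Omega>"
      show "(\<lambda>n. \<phi> n (f x)) \<longlonglongrightarrow> indicator a x"
      proof (cases "f x > c")
        case True
        obtain n where n: "1 < real n * (f x - c)" using True reals_Archimedean3[of "f x - c"] by auto
        have "\<phi> m (f x) = 1" if "m \<ge> n" for m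
        proof -
          have "real n * (f x - c) \<le> real m * (f x - c)" using that True by (intro mult_right_mono) auto
          then have "1 \<le> real m * (f x - c)" using n by linarith
          then show ?thesis using True by (simp add: \<phi>_def)
        qed
        then have "eventually (\<lambda>m. \<phi> m (f x) = 1) sequentially" by (auto simp: eventually_sequentially)
        then show ?thesis using True x by (simp add: a tendsto_eventually)
      qed (use x in \<open>simp add: \<phi>_def a\<close>)
    qed
    then show ?case using a by auto
  next
    case Empty
    then show ?case using cmult_W[OF one_W, of 0] by (simp add: indicator_def[abs_def])
  next
    case (Compl a)
    \<comment> \<open>\<open>1 - indicator a\<close> and \<open>indicator (\<Omega> - a)\<close>
      agree only on \<open>\<Omega>\<close>. Since limits are required only there, a constant
      sequence leads from one to the other.\<close>
    have "indicator (\<Omega> - a) \<in> W"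
      by (rule lim_W[of "\<lambda>_ x. 1 - indicator a x" 1]) (use Compl minus_W in \<open>auto simp: indicator_def\<close>)
    then show ?case by auto
  next
    case (Union a)
    \<comment> \<open>Products of complements stay in the algebra; 1 minus such a product is the
      indicator of a finite union, and these tend to the indicator of the whole union.\<close>
    have P: "(\<lambda>x. \<Prod>i<n. 1 - indicator (a i) x) \<in> W" for n :: nat
      by (induction n) (use one_W mult_W minus_W Union in auto)
    have "indicator (\<Union>i. a i) \<in> W"
    proof (rule lim_W[of "\<lambda>n x. 1 - (\<Prod>i<n. 1 - indicator (a i) x)" 1])
      show "(\<lambda>x. 1 - (\<Prod>i<n. 1 - indicator (a i) x)) \<in> W" for n :: nat
        by (rule minus_W[OF P])
      have in01: "(\<Prod>i<n. 1 - indicator (a i) x :: real) \<in> {0..1}" for n :: nat and x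
        by (auto intro!: prod_nonneg prod_le_1 simp: indicator_def)
      show "\<bar>1 - (\<Prod>i<n. 1 - indicator (a i) x :: real)\<bar> \<le> 1" for n :: nat and x
        using in01[of x n] by auto
      fix x
      show "(\<lambda>n. 1 - (\<Prod>i<n. 1 - indicator (a i) x :: real)) \<longlonglongrightarrow> indicator (\<Union>i. a i) x"
      proof (cases "\<exists>i. x \<in> a i")
        case True
        then obtain i where i: "x \<in> a i" by auto
        have "1 - (\<Prod>i<n. 1 - indicator (a i) x :: real) = 1" if "n > i" for n
          using that i by (auto intro!: prod_zero bexI[of _ i])
        then have "eventually (\<lambda>n. 1 - (\<Prod>i<n. 1 - indicator (a i) x :: real) = 1) sequentially"
          by (auto simp: eventually_sequentially intro!: exI[of _ "Suc i"])
        then show ?thesis using True by (simp add: tendsto_eventually)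
      qed auto
    qed
    then show ?case using Union by auto
  qed
  then have "indicator A \<in> V" using W_V by auto
  then show ?thesis using one by (auto simp: V_def)
qed

text \<open>The bounded measurable functions with equal integrals under \<open>P\<close> and
  \<open>Q\<close> form a class for \<open>functional_monotone_class\<close>, dominated convergence
  covering the limits. It does for functions what a \<pi>-system argument does for sets.\<close>

lemma measure_eqI_multiplicative:
  fixes F :: "('b \<Rightarrow> real) set"
  assumes PQ: "prob_space P" "prob_space Q" "sets P = sets Q"
    and meas: "\<And>f. f \<in> F \<Longrightarrow> f \<in> borel_measurable Q"
    and mult: "\<And>f g. f \<in> F \<Longrightarrow> g \<in> F \<Longrightarrow> (\<lambda>x. f x * g x) \<in> F"
    and one: "(\<lambda>_. 1) \<in> F"
    and range: "\<And>f x. f \<in> F \<Longrightarrow> x \<in> space Q \<Longrightarrow> f x \<in> {0..1}"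
    and gen: "sets Q \<subseteq> sigma_sets (space Q) {{x\<in>space Q. f x > a} |f a. f \<in> F}"
    and eq: "\<And>f. f \<in> F \<Longrightarrow> (\<integral>x. f x \<partial>P) = (\<integral>x. f x \<partial>Q)"
  shows "P = Q"
proof (rule measure_eqI[OF PQ(3)])
  interpret P: prob_space P by fact
  interpret Q: prob_space Q by fact
  have sp: "space P = space Q" by (rule sets_eq_imp_space_eq[OF PQ(3)])
  have [measurable_cong]: "sets P = sets Q" by (rule PQ)
  define H where "H = {h :: 'b \<Rightarrow> real. h \<in> borel_measurable Q \<and> (\<exists>C. \<forall>x\<in>space Q. \<bar>h x\<bar> \<le> C) \<and> (\<integral>x. h x \<partial>P) = (\<integral>x. h x \<partial>Q)}"
  have H_int: "integrable P h" "integrable Q h" if "h \<in> H" for h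
  proof -
    from that obtain C where [measurable]: "h \<in> borel_measurable Q" and C: "\<forall>x\<in>space Q. \<bar>h x\<bar> \<le> C" by (auto simp: H_def)
    show "integrable P h" using C by (intro P.integrable_const_bound[where B=C] AE_I2) (auto simp: sp)
    show "integrable Q h" using C by (intro Q.integrable_const_bound[where B=C] AE_I2) auto
  qed
  fix A assume A: "A \<in> sets P"
  have "indicator A \<in> H"
  proof (rule functional_monotone_class[of H "space Q" F])
    show "A \<in> sigma_sets (space Q) {{x\<in>space Q. f x > a} |f a. f \<in> F}" using A gen PQ(3) by blast
    show "F \<subseteq> H"
    proof
      fix f assume f: "f \<in> F"
      have "\<bar>f x\<bar> \<le> 1" if "x \<in> space Q" for x using range[OF f that] by auto
      then show "f \<in> H" using meas[OF f] eq[OF f] unfolding H_def by auto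
    qed
    show "(\<lambda>x. f x * g x) \<in> F" if "f \<in> F" "g \<in> F" for f g using that by (rule mult)
    show "f x \<in> {0..1}" if "f \<in> F" "x \<in> space Q" for f x using that by (rule range)
    show "(\<lambda>x. a * f x + b * g x) \<in> H" if "f \<in> H" "g \<in> H" for f g a b
    proof -
      from that obtain C D where [measurable]: "f \<in> borel_measurable Q" "g \<in> borel_measurable Q"
        and C: "\<forall>x\<in>space Q. \<bar>f x\<bar> \<le> C" and D: "\<forall>x\<in>space Q. \<bar>g x\<bar> \<le> D" by (auto simp: H_def)
      have "\<bar>a * f x + b * g x\<bar> \<le> \<bar>a\<bar> * C + \<bar>b\<bar> * D" if "x \<in> space Q" for x
        using C[rule_format, OF that] D[rule_format, OF that]
        by (intro order.trans[OF abs_triangle_ineq] add_mono) (auto simp: abs_mult intro!: mult_left_mono)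
      moreover have "(\<integral>x. a * f x + b * g x \<partial>P) = (\<integral>x. a * f x + b * g x \<partial>Q)"
        using that H_int[OF that(1)] H_int[OF that(2)] by (simp add: H_def)
      ultimately show ?thesis unfolding H_def by auto
    qed
    fix f g and C :: real assume f: "\<And>n. f n \<in> H" and C: "\<And>n x. x \<in> space Q \<Longrightarrow> \<bar>f n x\<bar> \<le> C"
      and g: "\<And>x. x \<in> space Q \<Longrightarrow> (\<lambda>n. f n x) \<longlonglongrightarrow> g x"
    have fm [measurable]: "f n \<in> borel_measurable Q" for n using f by (auto simp: H_def)
    have gm [measurable]: "g \<in> borel_measurable Q"
      by (rule borel_measurable_LIMSEQ_real[where u=f, OF _ fm]) (simp add: g)
    have "(\<lambda>n. \<integral>x. f n x \<partial>P) \<longlonglongrightarrow> (\<integral>x. g x \<partial>P)"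
      using g C by (intro integral_dominated_convergence[where w="\<lambda>_. C"] AE_I2) (auto simp: sp)
    moreover have "(\<lambda>n. \<integral>x. f n x \<partial>Q) \<longlonglongrightarrow> (\<integral>x. g x \<partial>Q)"
      using g C by (intro integral_dominated_convergence[where w="\<lambda>_. C"] AE_I2) auto
    moreover have "(\<integral>x. f n x \<partial>P) = (\<integral>x. f n x \<partial>Q)" for n using f by (auto simp: H_def)
    ultimately have "(\<integral>x. g x \<partial>P) = (\<integral>x. g x \<partial>Q)" using LIMSEQ_unique by auto
    moreover have "\<bar>g x\<bar> \<le> C" if "x \<in> space Q" for x
      using C that by (intro LIMSEQ_le_const2[OF tendsto_rabs[OF g[OF that]]]) auto
    ultimately show "g \<in> H" using gm unfolding H_def by auto
  qed (rule one)
  then have "(\<integral>x. indicator A x \<partial>P) = (\<integral>x. indicator A x \<partial>Q :: real)" unfolding H_def by simp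
  then show "emeasure P A = emeasure Q A"
    using A sets.sets_into_space[OF A] sp by (simp add: P.emeasure_eq_measure Q.emeasure_eq_measure Int_absorb2)
qed

text \<open>\<open>I\<close> may be infinite, but the integrand sees only the coordinates in
  \<open>J\<close>, so restriction moves the integral to a finite product. The bound
  \<open>C\<close> makes the factors integrable.\<close>

lemma integral_PiM_prod:
  fixes g :: "'i \<Rightarrow> 'b \<Rightarrow> real"
  assumes M: "\<And>i. prob_space (M i)" and J: "finite J" "J \<subseteq> I"
    and g: "\<And>j. j \<in> J \<Longrightarrow> g j \<in> borel_measurable (M j)"
    and bounded: "\<And>j x. j \<in> J \<Longrightarrow> x \<in> space (M j) \<Longrightarrow> \<bar>g j x\<bar> \<le> C"
  shows "(\<integral>\<omega>. (\<Prod>j\<in>J. g j (\<omega> j)) \<partial>PiM I M) = (\<Prod>j\<in>J. \<integral>x. g j x \<partial>M j)"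
proof -
  interpret product_prob_space M I
    using M by (simp add: product_prob_space_def product_prob_space_axioms_def product_sigma_finite_def
        prob_space_imp_sigma_finite)
  note [measurable] = g
  have "(\<integral>\<omega>. (\<Prod>j\<in>J. g j (\<omega> j)) \<partial>PiM I M)
      = (\<integral>\<omega>. (\<Prod>j\<in>J. g j (restrict \<omega> J j)) \<partial>PiM I M)"
    by (simp cong: prod.cong)
  also have "\<dots> = (\<integral>\<omega>. (\<Prod>j\<in>J. g j (\<omega> j)) \<partial>distr (PiM I M) (PiM J M) (\<lambda>\<omega>. restrict \<omega> J))"
    by (subst integral_distr) (auto intro!: measurable_restrict_subset J)
  also have "\<dots> = (\<integral>\<omega>. (\<Prod>j\<in>J. g j (\<omega> j)) \<partial>PiM J M)"
    by (simp add: distr_PiM_restrict_finite J)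
  also have "\<dots> = (\<Prod>j\<in>J. \<integral>x. g j x \<partial>M j)"
  proof (rule product_integral_prod[OF J(1)])
    fix i assume i: "i \<in> J"
    show "integrable (M i) (g i)"
    proof (rule finite_measure.integrable_const_bound[OF prob_space.finite_measure[OF M]])
      show "AE x in M i. norm (g i x) \<le> C"
        by (rule AE_I2) (simp add: bounded[OF i])
    qed (rule g[OF i])
  qed
  finally show ?thesis .
qed

section \<open>The Cantor space of codes and measures on it\<close>

text \<open>Cantor space with its product \<sigma>-algebra, a binary sequence being written as the
  set of positions of its ones. The prefix of length \<open>n\<close> is
  \<open>c \<inter> {..<n}\<close>.\<close>

definition code_algebra :: "nat set measure" where
  "code_algebra = sigma UNIV (range (\<lambda>i. {c. i \<in> c}))"

lemma space_code_algebra [simp]: "space code_algebra = UNIV"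
  by (simp add: code_algebra_def)

lemma mem_code_algebra [measurable]: "Measurable.pred code_algebra (\<lambda>c. i \<in> c)"
  by (auto simp: pred_def code_algebra_def)

text \<open>\<open>P\<close> can be arbitrary, since there are only finitely many prefixes of length
  \<open>n\<close> and each is fixed by finitely many digits.\<close>

lemma cylinder_code_algebra [measurable]: "{c. P (c \<inter> {..<n})} \<in> sets code_algebra"
proof -
  have "{c. c \<inter> {..<n} = S} \<in> sets code_algebra" if "S \<subseteq> {..<n}" for S
  proof -
    have "{c. c \<inter> {..<n} = S} = {c\<in>space code_algebra. \<forall>i\<in>{..<n}. i \<in> c \<longleftrightarrow> i \<in> S}"
      using that by auto
    also have "\<dots> \<in> sets code_algebra" by measurable
    finally show ?thesis .
  qed
  then have "(\<Union>S\<in>{S\<in>Pow {..<n}. P S}. {c. c \<inter> {..<n} = S}) \<in> sets code_algebra"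
    by (intro sets.finite_UN) auto
  also have "(\<Union>S\<in>{S\<in>Pow {..<n}. P S}. {c. c \<inter> {..<n} = S}) = {c. P (c \<inter> {..<n})}" by auto
  finally show ?thesis .
qed

lemma measurable_code_algebraI:
  assumes "\<And>i. {y\<in>space M. i \<in> f y} \<in> sets M"
  shows "f \<in> M \<rightarrow>\<^sub>M code_algebra"
  unfolding code_algebra_def
  by (rule measurable_measure_of) (use assms in \<open>auto simp: vimage_def Int_def conj_commute\<close>)

text \<open>A consistent system of weights on finite prefixes is realised by cutting \<open>[0, q 0 {})\<close>
  successively into intervals of the prescribed lengths: \<open>l n S\<close> is the left endpoint of the
  interval belonging to the prefix \<open>S\<close>, and a point is coded by the intervals containing it.\<close>

lemma tree_measure_exists:
  fixes q :: "nat \<Rightarrow> nat set \<Rightarrow> real"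
  assumes nonneg: "\<And>n S. 0 \<le> q n S"
    and split: "\<And>n S. S \<subseteq> {..<n} \<Longrightarrow> q n S = q (Suc n) S + q (Suc n) (insert n S)"
  obtains \<mu> where "sets \<mu> = sets code_algebra" "finite_measure \<mu>"
    "\<And>n S. S \<subseteq> {..<n} \<Longrightarrow> emeasure \<mu> {c. c \<inter> {..<n} = S} = ennreal (q n S)"
proof -
  \<comment> \<open>A prefix containing \<open>n\<close> takes the right part of the interval of the
    shorter prefix, so its left endpoint moves by the length of the left part; otherwise the
    endpoint is kept.\<close>
  define l where "l = rec_nat (\<lambda>S. 0) (\<lambda>n l S. if n \<in> S then l (S - {n}) + q (Suc n) (S - {n}) else l S)"
  have l0: "l 0 S = 0" and lS: "l (Suc n) S = (if n \<in> S then l n (S - {n}) + q (Suc n) (S - {n}) else l n S)" for n S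
    by (simp_all add: l_def)
  define I where "I n S = {l n S ..< l n S + q n S}" for n S
  have I_split: "I n S = I (Suc n) S \<union> I (Suc n) (insert n S)" "I (Suc n) S \<inter> I (Suc n) (insert n S) = {}"
    if "S \<subseteq> {..<n}" for n S
  proof -
    have nS: "n \<notin> S" using that by auto
    then have "l (Suc n) (insert n S) = l n S + q (Suc n) S" "l (Suc n) S = l n S"
      by (simp_all add: lS)
    then show "I n S = I (Suc n) S \<union> I (Suc n) (insert n S)" "I (Suc n) S \<inter> I (Suc n) (insert n S) = {}"
      using split[OF that] nonneg[of "Suc n" S] nonneg[of "Suc n" "insert n S"] by (auto simp: I_def)
  qed
  define T where "T u = {n. \<exists>S\<subseteq>{..<n}. u \<in> I (Suc n) (insert n S)}" for u
  \<comment> \<open>The two parts of an interval are disjoint and exhaust it, so knowing the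
    interval of \<open>u\<close> at level \<open>n\<close> is the same as knowing the first
    \<open>n\<close> digits of \<open>T u\<close>.\<close>
  have T: "u \<in> I n S \<longleftrightarrow> T u \<inter> {..<n} = S" if u: "u \<in> I 0 {}" and S: "S \<subseteq> {..<n}" for u n S
    using S
  proof (induction n arbitrary: S)
    case 0
    then show ?case using u by simp
  next
    case (Suc n)
    have *: "n \<in> T u \<longleftrightarrow> u \<in> I (Suc n) (insert n (T u \<inter> {..<n}))"
    proof
      assume "n \<in> T u"
      then obtain R where R: "R \<subseteq> {..<n}" "u \<in> I (Suc n) (insert n R)" by (auto simp: T_def)
      then have "u \<in> I n R" using I_split(1)[OF R(1)] by auto
      then have "T u \<inter> {..<n} = R" using Suc.IH[OF R(1)] by simp
      with R show "u \<in> I (Suc n) (insert n (T u \<inter> {..<n}))" by simp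
    next
      assume "u \<in> I (Suc n) (insert n (T u \<inter> {..<n}))"
      then have "\<exists>S\<subseteq>{..<n}. u \<in> I (Suc n) (insert n S)" by (intro exI[of _ "T u \<inter> {..<n}"]) simp
      then show "n \<in> T u" by (subst T_def) simp
    qed
    define R where "R = S \<inter> {..<n}"
    have R: "R \<subseteq> {..<n}" by (auto simp: R_def)
    have "T u \<inter> {..<Suc n} = (if n \<in> T u then insert n (T u \<inter> {..<n}) else T u \<inter> {..<n})"
      by (auto simp: lessThan_Suc)
    then have eq: "T u \<inter> {..<Suc n} = S \<longleftrightarrow> T u \<inter> {..<n} = R \<and> (n \<in> T u \<longleftrightarrow> n \<in> S)"
      using Suc.prems unfolding R_def by (auto simp: lessThan_Suc split: if_splits)
    have S1: "n \<in> S \<Longrightarrow> S = insert n R" and S0: "n \<notin> S \<Longrightarrow> S = R"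
      using Suc.prems by (auto simp: R_def lessThan_Suc)
    have uR: "u \<in> I n R \<longleftrightarrow> T u \<inter> {..<n} = R" by (rule Suc.IH[OF R])
    show ?case
    proof (cases "n \<in> S")
      case True
      show ?thesis unfolding eq using I_split[OF R] * uR True unfolding S1[OF True] by auto
    next
      case False
      then show ?thesis unfolding eq using I_split[OF R] * uR unfolding S0[OF False] by auto
    qed
  qed
  have I_meas [measurable]: "I n S \<in> sets borel" for n S by (simp add: I_def)
  define \<mu> where "\<mu> = distr (restrict_space lborel (I 0 {})) code_algebra T"
  have meas: "T \<in> restrict_space lborel (I 0 {}) \<rightarrow>\<^sub>M code_algebra"
  proof (rule measurable_code_algebraI)
    fix i
    have "{u \<in> space (restrict_space lborel (I 0 {})). i \<in> T u} = (\<Union>S\<in>Pow {..<i}. I (Suc i) (insert i S)) \<inter> I 0 {}"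
      unfolding T_def space_restrict_space by (simp add: set_eq_iff) blast
    also have "\<dots> = I 0 {} \<inter> (\<Union>S\<in>Pow {..<i}. I (Suc i) (insert i S))" by (rule Int_commute)
    also have "\<dots> \<in> sets (restrict_space lborel (I 0 {}))"
      unfolding sets_restrict_space sets_lborel by (rule imageI, rule sets.finite_UN) (simp_all add: I_meas)
    finally show "{u \<in> space (restrict_space lborel (I 0 {})). i \<in> T u} \<in> sets (restrict_space lborel (I 0 {}))" .
  qed
  have IS: "I n S \<subseteq> I 0 {}" if "S \<subseteq> {..<n}" for n S
    using that
  proof (induction n arbitrary: S)
    case (Suc n)
    define R where "R = S \<inter> {..<n}"
    have "R \<subseteq> {..<n}" by (auto simp: R_def)
    moreover have "S = R \<or> S = insert n R" using Suc.prems by (auto simp: R_def lessThan_Suc)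
    ultimately show ?case using Suc.IH[of R] I_split(1)[of R n] by blast
  qed auto
  have em: "emeasure \<mu> {c. c \<inter> {..<n} = S} = ennreal (q n S)" if S: "S \<subseteq> {..<n}" for n S
  proof -
    have "emeasure \<mu> {c. c \<inter> {..<n} = S}
        = emeasure (restrict_space lborel (I 0 {})) {u \<in> I 0 {}. T u \<inter> {..<n} = S}"
      unfolding \<mu>_def by (subst emeasure_distr[OF meas])
        (auto intro!: arg_cong[where f="emeasure _"] simp: space_restrict_space)
    also have "{u \<in> I 0 {}. T u \<inter> {..<n} = S} = I n S" using T[OF _ S] IS[OF S] by blast
    also have "emeasure (restrict_space lborel (I 0 {})) (I n S) = emeasure lborel (I n S)"
      by (subst emeasure_restrict_space) (use IS[OF S] in auto)
    also have "\<dots> = ennreal (q n S)" using nonneg[of n S] by (simp add: I_def)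
    finally show ?thesis .
  qed
  have "finite_measure \<mu>"
  proof
    show "emeasure \<mu> (space \<mu>) \<noteq> \<infinity>" using em[of "{}" 0] by (simp add: \<mu>_def)
  qed
  moreover have "sets \<mu> = sets code_algebra" by (simp add: \<mu>_def)
  ultimately show ?thesis using em that by blast
qed

section \<open>Weak limits on a compact coding space\<close>

lemma integral_cylinder:
  fixes F :: "nat set \<Rightarrow> real"
  assumes "finite_measure Q" and f: "f \<in> Q \<rightarrow>\<^sub>M code_algebra"
  shows "(\<integral>y. F (f y \<inter> {..<n}) \<partial>Q) = (\<Sum>S\<in>Pow {..<n}. F S * measure Q {y\<in>space Q. f y \<inter> {..<n} = S})"
proof -
  interpret finite_measure Q by fact
  have [measurable]: "{y\<in>space Q. f y \<inter> {..<n} = S} \<in> sets Q" for S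
    using measurable_sets[OF f cylinder_code_algebra[of "\<lambda>R. R = S" n]]
    by (simp add: vimage_def Int_def conj_commute)
  have "(\<integral>y. F (f y \<inter> {..<n}) \<partial>Q)
      = (\<integral>y. (\<Sum>S\<in>Pow {..<n}. F S * indicator {y\<in>space Q. f y \<inter> {..<n} = S} y) \<partial>Q)"
  proof (rule Bochner_Integration.integral_cong[OF refl])
    fix y assume "y \<in> space Q"
    then have "(\<Sum>S\<in>Pow {..<n}. F S * indicator {y\<in>space Q. f y \<inter> {..<n} = S} y)
       = (\<Sum>S\<in>Pow {..<n}. if S = f y \<inter> {..<n} then F S else 0)"
      by (intro sum.cong) (auto simp: indicator_def)
    also have "\<dots> = F (f y \<inter> {..<n})" by (subst sum.delta) auto
    finally show "F (f y \<inter> {..<n}) = (\<Sum>S\<in>Pow {..<n}. F S * indicator {y\<in>space Q. f y \<inter> {..<n} = S} y)" ..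
  qed
  also have "\<dots> = (\<Sum>S\<in>Pow {..<n}. F S * measure Q {y\<in>space Q. f y \<inter> {..<n} = S})"
    by (subst Bochner_Integration.integral_sum) (auto simp: less_top[symmetric])
  finally show ?thesis .
qed

section \<open>Binary coding of sequences of reals and selection of a limit law\<close>

text \<open>Subsequences are refined for one \<open>i\<close> after the other. From position
  \<open>Suc n\<close> on, the diagonal is a subsequence of the one that settles \<open>n\<close>,
  so it works for every \<open>i\<close>.\<close>

lemma convergent_diagonal:
  fixes f :: "nat \<Rightarrow> nat \<Rightarrow> real"
  assumes bd: "\<And>n i. \<bar>f n i\<bar> \<le> M"
  obtains r where "strict_mono r" "\<And>i. convergent (\<lambda>k. f (r k) i)"
proof -
  let ?P = "\<lambda>n. \<lambda>s. convergent (\<lambda>k. f (s k) n)"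
  interpret nat: subseqs ?P
  proof
    fix n :: nat and s :: "nat \<Rightarrow> nat" assume s: "strict_mono s"
    have "f (s k) n \<in> {-M..M}" for k using bd[of "s k" n] by (simp add: abs_le_iff minus_le_iff)
    then obtain l s' where "strict_mono s'" "((\<lambda>k. f (s k) n) \<circ> s') \<longlonglongrightarrow> l"
      using compact_Icc[of "-M" M] compact_imp_seq_compact seq_compactE by metis
    then show "\<exists>r'. strict_mono r' \<and> convergent (\<lambda>k. f ((s \<circ> r') k) n)"
      by (auto simp: comp_def convergent_def)
  qed
  have "?P n nat.diagseq" for n
  proof -
    have "convergent (\<lambda>k. f (nat.seqseq (Suc n) k) n)" by (rule nat.seqseq_holds)
    then have "convergent ((\<lambda>k. f (nat.seqseq (Suc n) k) n) \<circ> (\<lambda>k. nat.fold_reduce (Suc n) k (Suc n + k)))"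
      by (intro convergent_subseq_convergent nat.subseq_diagonal_rest)
    then have "convergent (\<lambda>k. f (nat.diagseq (k + Suc n)) n)"
      using fun_cong[OF nat.diagseq_seqseq[of "Suc n"]] by (simp add: comp_def add.commute)
    then show ?thesis using convergent_ignore_initial_segment[of "\<lambda>k. f (nat.diagseq k) n" "Suc n"] by simp
  qed
  then show ?thesis using nat.subseq_diagseq that by blast
qed

text \<open>One code carries a whole sequence of numbers: its positions are shared out by
  \<open>prod_encode\<close>, with \<open>j\<close> naming the number and \<open>i\<close> the
  binary digit.\<close>

definition binary_value :: "nat \<Rightarrow> nat set \<Rightarrow> real" where
  "binary_value j c = (\<Sum>i. of_bool (prod_encode (j, i) \<in> c) / 2 ^ Suc i)"

definition binary_trunc :: "nat \<Rightarrow> nat \<Rightarrow> nat set \<Rightarrow> real" where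
  "binary_trunc m j c = (\<Sum>i<m. of_bool (prod_encode (j, i) \<in> c) / 2 ^ Suc i)"

lemma binary_value:
  shows "0 \<le> binary_value j c" "binary_value j c \<le> 1" "\<bar>binary_value j c - binary_trunc m j c\<bar> \<le> 1 / 2 ^ m"
    "0 \<le> binary_trunc m j c" "binary_trunc m j c \<le> 1"
proof -
  let ?f = "\<lambda>i. of_bool (prod_encode (j, i) \<in> c) / 2 ^ Suc i :: real"
  have g: "(\<lambda>i. 1 / 2 ^ Suc i :: real) sums 1"
    using power_half_series by (simp add: power_divide)
  have fg: "?f i \<le> 1 / 2 ^ Suc i" "0 \<le> ?f i" for i by (auto simp: of_bool_def)
  have sf: "summable ?f"
    by (rule summable_comparison_test'[OF sums_summable[OF g], of 0]) (use fg in auto)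
  show "0 \<le> binary_value j c" unfolding binary_value_def using sf fg by (intro suminf_nonneg) auto
  have "binary_value j c \<le> (\<Sum>i. 1 / 2 ^ Suc i)" unfolding binary_value_def
    using sf fg sums_summable[OF g] by (intro suminf_le) auto
  then show "binary_value j c \<le> 1" unfolding sums_unique[OF g, symmetric] .
  have split: "binary_value j c = (\<Sum>i. ?f (i + m)) + binary_trunc m j c" for m
    unfolding binary_value_def binary_trunc_def by (rule suminf_split_initial_segment[OF sf])
  have sm: "summable (\<lambda>i. ?f (i + m))" for m by (rule summable_ignore_initial_segment[OF sf])
  have gm: "(\<lambda>i. 1 / 2 ^ m * (1 / 2 ^ Suc i) :: real) sums (1 / 2 ^ m * 1)" by (rule sums_mult[OF g])
  have "(\<Sum>i. ?f (i + m)) \<le> (\<Sum>i. 1 / 2 ^ m * (1 / 2 ^ Suc i))"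
    using fg(1) by (intro suminf_le[OF _ sm sums_summable[OF gm]]) (simp add: power_add mult_ac)
  also have "\<dots> = 1 / 2 ^ m" using gm by (simp only: sums_iff mult_1_right)
  finally have "(\<Sum>i. ?f (i + m)) \<le> 1 / 2 ^ m" .
  moreover have "0 \<le> (\<Sum>i. ?f (i + m))" using sm fg by (intro suminf_nonneg) auto
  ultimately show "\<bar>binary_value j c - binary_trunc m j c\<bar> \<le> 1 / 2 ^ m" unfolding split[of m] by simp
  show t0: "0 \<le> binary_trunc m j c" unfolding binary_trunc_def by (intro sum_nonneg fg)
  show "binary_trunc m j c \<le> 1" using \<open>0 \<le> (\<Sum>i. ?f (i + m))\<close> split[of m] \<open>binary_value j c \<le> 1\<close> by linarith
qed

lemma binary_value_measurable [measurable]: "binary_value j \<in> borel_measurable code_algebra"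
  unfolding binary_value_def[abs_def] of_bool_def by measurable

text \<open>\<open>\<lfloor>2 ^ m * x\<rfloor>\<close> is the integer spelled by the first
  \<open>m\<close> binary digits of \<open>x\<close>; passing to \<open>Suc m\<close> doubles it and
  adds the parity bit.\<close>

lemma binary_trunc_floor:
  fixes x :: real
  assumes "x \<in> {0..<1}" and "\<And>i. prod_encode (j, i) \<in> c \<longleftrightarrow> odd \<lfloor>2 ^ Suc i * x\<rfloor>"
  shows "binary_trunc m j c = of_int \<lfloor>2 ^ m * x\<rfloor> / 2 ^ m"
proof (induction m)
  case 0
  have "\<lfloor>x\<rfloor> = 0" using assms(1) by (simp add: floor_eq_iff)
  then show ?case by (simp add: binary_trunc_def)
next
  case (Suc m)
  have half: "\<lfloor>2 ^ m * x\<rfloor> = \<lfloor>2 ^ Suc m * x\<rfloor> div 2"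
    using floor_divide_real_eq_div[of 2 "2 ^ Suc m * x"] by simp
  have "\<lfloor>2 ^ Suc m * x\<rfloor> = 2 * \<lfloor>2 ^ m * x\<rfloor> + of_bool (prod_encode (j, m) \<in> c)"
    unfolding half assms(2) mod_2_eq_odd[symmetric] by simp
  then have "real_of_int \<lfloor>2 ^ Suc m * x\<rfloor> = 2 * of_int \<lfloor>2 ^ m * x\<rfloor> + of_bool (prod_encode (j, m) \<in> c)"
    by simp
  then show ?case using Suc by (simp add: binary_trunc_def field_simps del: power_Suc) (simp add: field_simps)
qed

text \<open>Sequential compactness of laws on a countable product of unit intervals, without any
  topology on the sample space. The values \<open>V j y\<close> are written in binary into one code,
  the prefix probabilities converge along a diagonal subsequence, and
  \<open>tree_measure_exists\<close> realises the limits. Continuous functions of finitely many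
  values are uniformly close to functions of a finite prefix. The limiting values may reach 1, hence
  the closed interval for \<open>v\<close>.\<close>

lemma weak_limit_exists:
  fixes P :: "nat \<Rightarrow> 'y measure" and V :: "nat \<Rightarrow> 'y \<Rightarrow> real"
  assumes P: "\<And>n. prob_space (P n)"
    and V [measurable]: "\<And>n j. V j \<in> borel_measurable (P n)"
    and V01: "\<And>j y. V j y \<in> {0..<1}"
  shows "\<exists>r Q (v :: nat \<Rightarrow> nat set \<Rightarrow> real). strict_mono r \<and> prob_space Q \<and>
    (\<forall>j. v j \<in> borel_measurable Q) \<and> (\<forall>j c. v j c \<in> {0..1}) \<and>
    (\<forall>J g. finite J \<longrightarrow> (\<forall>j\<in>J. continuous_on {0..1} (g j) \<and> (\<forall>x\<in>{0..1}. g j x \<in> {0..1::real})) \<longrightarrow>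
       (\<lambda>n. \<integral>y. (\<Prod>j\<in>J. g j (V j y)) \<partial>P (r n)) \<longlonglongrightarrow> (\<integral>c. (\<Prod>j\<in>J. g j (v j c)) \<partial>Q))"
proof -
  define k where "k y = {b. case prod_decode b of (j, i) \<Rightarrow> odd \<lfloor>2 ^ Suc i * V j y\<rfloor>}" for y
  have k_mem: "prod_encode (j, i) \<in> k y \<longleftrightarrow> odd \<lfloor>2 ^ Suc i * V j y\<rfloor>" for j i y
    by (simp add: k_def)
  have k [measurable]: "k \<in> P n \<rightarrow>\<^sub>M code_algebra" for n
  proof (rule measurable_code_algebraI)
    fix b
    obtain j i where b: "b = prod_encode (j, i)" by (metis prod_decode_inverse surj_pair)
    show "{y\<in>space (P n). b \<in> k y} \<in> sets (P n)" unfolding b k_mem by measurable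
  qed
  define p where "p n N S = measure (P n) {y\<in>space (P n). k y \<inter> {..<N} = S}" for n N S
  have p01: "0 \<le> p n N S" "p n N S \<le> 1" for n N S
    unfolding p_def using prob_space.prob_le_1[OF P] by auto
  have mk [measurable]: "{y\<in>space (P n). k y \<inter> {..<N} = S} \<in> sets (P n)" for n N S
    using measurable_sets[OF k cylinder_code_algebra[of "\<lambda>R. R = S" N]]
    by (simp add: vimage_def Int_def conj_commute)
  \<comment> \<open>Numbering the pairs of a length and a finite set lets a single diagonal
    subsequence serve all prefixes.\<close>
  define f where "f n i = (case prod_decode i of (N, m) \<Rightarrow> p n N (set_decode m))" for n i
  have f1: "\<bar>f n i\<bar> \<le> 1" for n i using p01 by (auto simp: f_def split: prod.split)
  obtain r where r: "strict_mono r" "\<And>i. convergent (\<lambda>k. f (r k) i)"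
    by (rule convergent_diagonal[of f 1, OF f1], rule that)
  have conv: "convergent (\<lambda>n. p (r n) N S)" if "S \<subseteq> {..<N}" for N S
    using r(2)[of "prod_encode (N, set_encode S)"] finite_subset[OF that]
    by (simp add: f_def set_encode_inverse)
  \<comment> \<open>The value 0 off the genuine prefixes makes \<open>q\<close> nonnegative
    everywhere, as the tree construction demands.\<close>
  define q where "q N S = (if S \<subseteq> {..<N} then lim (\<lambda>n. p (r n) N S) else 0)" for N S
  have q: "(\<lambda>n. p (r n) N S) \<longlonglongrightarrow> q N S" if "S \<subseteq> {..<N}" for N S
    using conv[OF that] that by (simp add: q_def convergent_LIMSEQ_iff)
  have q0: "0 \<le> q N S" for N S
  proof (cases "S \<subseteq> {..<N}")
    case True
    then show ?thesis using LIMSEQ_le_const[OF q[OF True]] p01 by blast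
  qed (simp add: q_def)
  have q_split: "q N S = q (Suc N) S + q (Suc N) (insert N S)" if S: "S \<subseteq> {..<N}" for N S
  proof -
    have "p n N S = p n (Suc N) S + p n (Suc N) (insert N S)" for n
    proof -
      interpret prob_space "P n" by (rule P)
      have "{y\<in>space (P n). k y \<inter> {..<N} = S} = {y\<in>space (P n). k y \<inter> {..<Suc N} = S} \<union>
          {y\<in>space (P n). k y \<inter> {..<Suc N} = insert N S}" using S by (auto simp: lessThan_Suc)
      then show ?thesis unfolding p_def
        by (simp only:) (rule finite_measure_Union, use S in auto)
    qed
    then have "(\<lambda>n. p (r n) N S) \<longlonglongrightarrow> q (Suc N) S + q (Suc N) (insert N S)"
      by (simp only:) (intro tendsto_add q, use S in auto)
    then show ?thesis using q[OF S] LIMSEQ_unique by blast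
  qed
  obtain Q where Q: "sets Q = sets code_algebra" "finite_measure Q"
    "\<And>N S. S \<subseteq> {..<N} \<Longrightarrow> emeasure Q {c. c \<inter> {..<N} = S} = ennreal (q N S)"
    by (rule tree_measure_exists[OF q0 q_split], assumption, rule that)
  have [measurable_cong]: "sets Q = sets code_algebra" by (rule Q)
  have spQ: "space Q = UNIV" using sets_eq_imp_space_eq[OF Q(1)] by simp
  have mQ: "measure Q {c. c \<inter> {..<N} = S} = q N S" if "S \<subseteq> {..<N}" for N S
    using Q(3)[OF that] q0 by (simp add: measure_def)
  have "p n 0 {} = 1" for n
    using prob_space.prob_space[OF P] by (simp add: p_def)
  \<comment> \<open>The empty prefix has probability 1 under each \<open>P n\<close>, so no mass is
    lost in the limit.\<close>
  then have "q 0 {} = 1" using q[of "{}" 0] LIMSEQ_unique[OF _ tendsto_const] by simp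
  then have "prob_space Q" using Q(3)[of "{}" 0] by (intro prob_spaceI) (simp add: spQ)
  interpret Q: prob_space Q by fact
  show ?thesis
  proof (intro exI conjI allI impI)
    show "strict_mono r" by (rule r(1))
    show "prob_space Q" by fact
    show "binary_value j \<in> borel_measurable Q" for j by measurable
    show "binary_value j c \<in> {0..1}" for j c using binary_value(1,2) by auto
    fix J and g :: "nat \<Rightarrow> real \<Rightarrow> real"
    assume J: "finite J" and g: "\<forall>j\<in>J. continuous_on {0..1} (g j) \<and> (\<forall>x\<in>{0..1}. g j x \<in> {0..1})"
    have cont: "continuous_on {0..1} (g j)" if "j \<in> J" for j using g that by blast
    have g01: "g j x \<in> {0..1}" if "j \<in> J" "x \<in> {0..1}" for j x using g that by blast
    \<comment> \<open>All factors lie in \<open>{0..1}\<close>, so exchanging them one at a time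
      changes the product by at most the sum of the individual changes.\<close>
    have prod_close: "\<bar>(\<Prod>j\<in>J. g j (x j)) - (\<Prod>j\<in>J. g j (y j))\<bar> \<le> (\<Sum>j\<in>J. \<bar>g j (x j) - g j (y j)\<bar>)"
      if "\<And>j. x j \<in> {0..1}" "\<And>j. y j \<in> {0..1}" for x y
      using norm_prod_diff[of J "\<lambda>j. g j (x j)" "\<lambda>j. g j (y j)"] g01 that by force
    have prod01: "(\<Prod>j\<in>J. g j (x j)) \<in> {0..1}" if "\<And>j. x j \<in> {0..1}" for x
    proof -
      have "0 \<le> g j (x j) \<and> g j (x j) \<le> 1" if "j \<in> J" for j
        using g01[OF that \<open>\<And>j. x j \<in> {0..1}\<close>[of j]] by simp
      then show ?thesis by (simp add: prod_nonneg prod_le_1)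
    qed
    have gm: "(\<lambda>y. \<Prod>j\<in>J. g j (X j y)) \<in> borel_measurable R"
      if [measurable]: "\<And>j. X j \<in> borel_measurable R" and X: "\<And>j y. X j y \<in> {0..1}"
      for X and R :: "'z measure"
    proof (rule borel_measurable_prod)
      fix j assume j: "j \<in> J"
      have "X j \<in> R \<rightarrow>\<^sub>M restrict_space borel {0..1}"
        using X by (intro measurable_restrict_space2) auto
      then show "(\<lambda>y. g j (X j y)) \<in> borel_measurable R"
        using borel_measurable_continuous_on_restrict[OF cont[OF j]] by (rule measurable_compose)
    qed
    show "(\<lambda>n. \<integral>y. (\<Prod>j\<in>J. g j (V j y)) \<partial>P (r n)) \<longlonglongrightarrow> (\<integral>c. (\<Prod>j\<in>J. g j (binary_value j c)) \<partial>Q)"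
    proof (rule LIMSEQ_I)
      fix e :: real assume e: "0 < e"
      \<comment> \<open>Each of the \<open>card J\<close> factors may err by \<open>d\<close>, in
        total by at most \<open>e / 4\<close>; adding 1 keeps the denominator positive when
        \<open>J\<close> is empty.\<close>
      define d where "d = e / (4 * (card J + 1))"
      have d: "0 < d" using e by (simp add: d_def)
      have "\<exists>m. \<forall>x\<in>{0..1}. \<forall>y\<in>{0..1}. \<bar>x - y\<bar> \<le> 1 / 2 ^ m \<longrightarrow> \<bar>g j x - g j y\<bar> \<le> d" if j: "j \<in> J" for j
      proof -
        have "uniformly_continuous_on {0..1} (g j)"
          using cont[OF j] by (intro compact_uniformly_continuous) auto
        then obtain \<delta> where \<delta>: "\<delta> > 0" "\<And>x y. x \<in> {0..1} \<Longrightarrow> y \<in> {0..1} \<Longrightarrow> dist y x < \<delta> \<Longrightarrow> dist (g j y) (g j x) < d"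
          using d unfolding uniformly_continuous_on_def by metis
        obtain m where m: "(1/2) ^ m < \<delta>" using real_arch_pow_inv[OF \<delta>(1), of "1/2"] by auto
        show ?thesis
        proof (intro exI[of _ m] ballI impI)
          fix x y :: real assume "x \<in> {0..1}" "y \<in> {0..1}" "\<bar>x - y\<bar> \<le> 1 / 2 ^ m"
          then show "\<bar>g j x - g j y\<bar> \<le> d" using \<delta>(2)[of y x] m
            by (auto simp: dist_real_def power_divide)
        qed
      qed
      then obtain m where m: "\<And>j x y. j \<in> J \<Longrightarrow> x \<in> {0..1} \<Longrightarrow> y \<in> {0..1} \<Longrightarrow> \<bar>x - y\<bar> \<le> 1 / 2 ^ m j \<Longrightarrow> \<bar>g j x - g j y\<bar> \<le> d"
        by metis
      define M where "M = Max (insert 0 (m ` J))"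
      have mM: "m j \<le> M" if "j \<in> J" for j unfolding M_def using that J by (intro Max_ge) auto
      \<comment> \<open>A length beyond all positions that hold one of the first \<open>M\<close>
        digits of a value with index in \<open>J\<close>.\<close>
      define N where "N = Suc (Max (insert 0 (prod_encode ` (J \<times> {..<M}))))"
      have N: "prod_encode (j, i) < N" if "j \<in> J" "i < M" for j i
        unfolding N_def using that J by (intro le_imp_less_Suc Max_ge) auto
      define F where "F c = (\<Prod>j\<in>J. g j (binary_trunc M j c))" for c
      have F_cyl: "F c = F (c \<inter> {..<N})" for c
        using N by (auto simp: F_def binary_trunc_def intro!: prod.cong arg_cong[where f="g _"] sum.cong)
      have close: "\<bar>(\<Prod>j\<in>J. g j (x j)) - F c\<bar> \<le> e / 4"
        if x: "\<And>j. x j \<in> {0..1}" and xc: "\<And>j. \<bar>x j - binary_trunc M j c\<bar> \<le> 1 / 2 ^ M" for x c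
      proof -
        have "\<bar>(\<Prod>j\<in>J. g j (x j)) - F c\<bar> \<le> (\<Sum>j\<in>J. \<bar>g j (x j) - g j (binary_trunc M j c)\<bar>)"
          unfolding F_def using x binary_value(4,5) by (intro prod_close) auto
        also have "\<dots> \<le> (\<Sum>j\<in>J. d)"
        proof (intro sum_mono m)
          fix j assume j: "j \<in> J"
          have "(1::real) / 2 ^ M \<le> 1 / 2 ^ m j" using mM[OF j] by (intro divide_left_mono power_increasing) auto
          then show "\<bar>x j - binary_trunc M j c\<bar> \<le> 1 / 2 ^ m j" using xc[of j] by linarith
        qed (use x binary_value(4,5) in auto)
        also have "\<dots> \<le> e / 4" using e by (simp add: d_def field_simps)
        finally show ?thesis .
      qed
      have int_close: "\<bar>(\<integral>y. (\<Prod>j\<in>J. g j (X j y)) \<partial>R) - (\<integral>y. F (h y) \<partial>R)\<bar> \<le> e / 4"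
        if R: "prob_space R" and h [measurable]: "h \<in> R \<rightarrow>\<^sub>M code_algebra" and X [measurable]: "\<And>j. X j \<in> borel_measurable R"
         and X01: "\<And>j y. X j y \<in> {0..1}"
         and xc: "\<And>j y. \<bar>X j y - binary_trunc M j (h y)\<bar> \<le> 1 / 2 ^ M" for R :: "'z measure" and X h
      proof -
        interpret R: prob_space R by fact
        have [measurable]: "(\<lambda>y. \<Prod>j\<in>J. g j (X j y)) \<in> borel_measurable R"
          by (rule gm[OF X X01])
        have [measurable]: "(\<lambda>y. F (h y)) \<in> borel_measurable R"
          unfolding F_def using binary_value(4,5)
          by (intro gm) (auto simp: binary_trunc_def of_bool_def)
        have i1: "integrable R (\<lambda>y. \<Prod>j\<in>J. g j (X j y))"
          using prod01[OF X01] by (intro R.integrable_const_bound[where B=1] AE_I2) auto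
        have F01: "F c \<in> {0..1}" for c unfolding F_def using binary_value(4,5) by (intro prod01) auto
        have i2: "integrable R (\<lambda>y. F (h y))"
          using F01 by (intro R.integrable_const_bound[where B=1] AE_I2) auto
        have "\<bar>(\<integral>y. (\<Prod>j\<in>J. g j (X j y)) \<partial>R) - (\<integral>y. F (h y) \<partial>R)\<bar>
            = \<bar>\<integral>y. (\<Prod>j\<in>J. g j (X j y)) - F (h y) \<partial>R\<bar>" using i1 i2 by simp
        also have "\<dots> \<le> (\<integral>y. \<bar>(\<Prod>j\<in>J. g j (X j y)) - F (h y)\<bar> \<partial>R)" by (rule integral_abs_bound)
        also have "\<dots> \<le> (\<integral>y. e / 4 \<partial>R)"
          using i1 i2 close[OF X01 xc] by (intro integral_mono) auto
        finally show ?thesis using R.prob_space by simp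
      qed
      have "\<bar>V j y - binary_trunc M j (k y)\<bar> \<le> 1 / 2 ^ M" for j y
      proof -
        have "2 ^ M * \<bar>V j y - of_int \<lfloor>2 ^ M * V j y\<rfloor> / 2 ^ M\<bar> = \<bar>2 ^ M * V j y - of_int \<lfloor>2 ^ M * V j y\<rfloor>\<bar>"
          by (simp add: abs_mult[symmetric] field_simps flip: abs_mult)
        also have "\<dots> \<le> 1" by linarith
        finally show ?thesis
          by (subst binary_trunc_floor[OF V01 k_mem]) (simp add: field_simps)
      qed
      then have PF: "\<bar>(\<integral>y. (\<Prod>j\<in>J. g j (V j y)) \<partial>P n) - (\<integral>y. F (k y) \<partial>P n)\<bar> \<le> e / 4" for n
        using V01 by (intro int_close P k V) (auto simp: less_imp_le)
      have QF: "\<bar>(\<integral>c. (\<Prod>j\<in>J. g j (binary_value j c)) \<partial>Q) - (\<integral>c. F c \<partial>Q)\<bar> \<le> e / 4"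
        using binary_value by (intro int_close) (auto simp: Q.prob_space_axioms)
      have "(\<lambda>n. \<integral>y. F (k y) \<partial>P (r n)) \<longlonglongrightarrow> (\<integral>c. F c \<partial>Q)"
      proof -
        have 1: "(\<integral>y. F (k y) \<partial>P n) = (\<Sum>S\<in>Pow {..<N}. F S * p n N S)" for n
          unfolding p_def by (subst F_cyl, rule integral_cylinder)
            (use P k in \<open>auto simp: prob_space.finite_measure\<close>)
        have 2: "(\<integral>c. F c \<partial>Q) = (\<Sum>S\<in>Pow {..<N}. F S * q N S)"
          by (subst F_cyl, subst integral_cylinder[where f="\<lambda>c. c"])
            (auto simp: Q.finite_measure_axioms spQ mQ)
        show ?thesis unfolding 1 2 by (intro tendsto_sum tendsto_mult tendsto_const q) auto
      qed
      from LIMSEQ_D[OF this, of "e/4"] e obtain n0 where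
        n0: "\<And>n. n \<ge> n0 \<Longrightarrow> \<bar>(\<integral>y. F (k y) \<partial>P (r n)) - (\<integral>c. F c \<partial>Q)\<bar> < e / 4" by auto
      \<comment> \<open>Three errors of at most \<open>e / 4\<close> each: truncation under
        \<open>P (r n)\<close>, truncation under \<open>Q\<close>, and convergence of the prefix
        probabilities.\<close>
      have "norm ((\<integral>y. (\<Prod>j\<in>J. g j (V j y)) \<partial>P (r n)) - (\<integral>c. (\<Prod>j\<in>J. g j (binary_value j c)) \<partial>Q)) < e"
        if "n \<ge> n0" for n
        using n0[OF that] PF[of "r n"] QF e unfolding real_norm_def by linarith
      then show "\<exists>n0. \<forall>n\<ge>n0. norm ((\<integral>y. (\<Prod>j\<in>J. g j (V j y)) \<partial>P (r n))
          - (\<integral>c. (\<Prod>j\<in>J. g j (binary_value j c)) \<partial>Q)) < e" by blast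
    qed
  qed
qed

section \<open>Laplace functionals\<close>

text \<open>The integral of a function that is not integrable is 0 by convention, so this is the
  Laplace functional only where \<open>f\<close> is integrable. Tests are integrable against every
  Radon measure.\<close>

definition laplace :: "('a \<Rightarrow> real) \<Rightarrow> 'a measure \<Rightarrow> real" where
  "laplace f \<phi> = exp (- (\<integral>x. f x \<partial>\<phi>))"

lemma laplace_01: "laplace f \<phi> \<le> 1" "0 < laplace f \<phi>" if "\<And>x. 0 \<le> f x" for f :: "'a \<Rightarrow> real" and \<phi>
  using that by (auto simp: laplace_def intro!: integral_nonneg_AE)

text \<open>The kernel is integrated out in nonnegative integrals; the bounds 0 and 1 keep
  everything finite and permit the return to real integrals.\<close>

lemma integral_bind_bounded:
  fixes h :: "'b \<Rightarrow> real"
  assumes P: "prob_space P" and K: "K \<in> P \<rightarrow>\<^sub>M prob_algebra N" and h [measurable]: "h \<in> borel_measurable N"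
    and h01: "\<And>x. x \<in> space N \<Longrightarrow> h x \<in> {0..1}"
  shows "(\<integral>x. h x \<partial>(P \<bind> K)) = (\<integral>\<mu>. (\<integral>x. h x \<partial>K \<mu>) \<partial>P)"
    and "(\<lambda>\<mu>. \<integral>x. h x \<partial>K \<mu>) \<in> borel_measurable P"
    and "prob_space (P \<bind> K)" and "sets (P \<bind> K) = sets N"
proof -
  interpret P: prob_space P by fact
  have K' [measurable]: "K \<in> P \<rightarrow>\<^sub>M subprob_algebra N" by (rule measurable_prob_algebraD[OF K])
  have Kp: "prob_space (K \<mu>)" "sets (K \<mu>) = sets N" if "\<mu> \<in> space P" for \<mu>
    using measurable_space[OF K that] by (auto simp: space_prob_algebra)
  show sets: "sets (P \<bind> K) = sets N"
    using Kp P.not_empty by (intro sets_bind) auto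
  show "(\<lambda>\<mu>. \<integral>x. h x \<partial>K \<mu>) \<in> borel_measurable P" by measurable
  then have m: "(\<lambda>\<mu>. \<integral>x. h x \<partial>K \<mu>) \<in> borel_measurable P" .
  show pB: "prob_space (P \<bind> K)"
    using Kp by (intro P.prob_space_bind[OF _ K'] AE_I2) auto
  have hR: "(\<integral>\<^sup>+x. ennreal (h x) \<partial>R) = ennreal (\<integral>x. h x \<partial>R)" "(\<integral>x. h x \<partial>R) \<in> {0..1}"
    if R: "prob_space R" "sets R = sets N" for R
  proof -
    interpret R: prob_space R by fact
    have [measurable_cong]: "sets R = sets N" by fact
    have sp: "space R = space N" by (rule sets_eq_imp_space_eq[OF R(2)])
    have i: "integrable R h" using h01 by (intro R.integrable_const_bound[where B=1] AE_I2) (auto simp: sp)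
    show "(\<integral>\<^sup>+x. ennreal (h x) \<partial>R) = ennreal (\<integral>x. h x \<partial>R)"
      using i h01 by (intro nn_integral_eq_integral AE_I2) (auto simp: sp)
    have "(\<integral>x. h x \<partial>R) \<le> (\<integral>x. 1 \<partial>R)" using i h01 by (intro integral_mono) (auto simp: sp)
    then show "(\<integral>x. h x \<partial>R) \<in> {0..1}"
      using h01 R.prob_space by (auto simp: sp intro!: Bochner_Integration.integral_nonneg)
  qed
  have "ennreal (\<integral>x. h x \<partial>(P \<bind> K)) = (\<integral>\<^sup>+\<mu>. (\<integral>\<^sup>+x. ennreal (h x) \<partial>K \<mu>) \<partial>P)"
    unfolding hR(1)[OF pB sets, symmetric] by (rule nn_integral_bind[OF _ K']) measurable
  also have "\<dots> = (\<integral>\<^sup>+\<mu>. ennreal (\<integral>x. h x \<partial>K \<mu>) \<partial>P)"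
    by (intro nn_integral_cong hR(1) Kp)
  also have "\<dots> = ennreal (\<integral>\<mu>. (\<integral>x. h x \<partial>K \<mu>) \<partial>P)"
  proof (rule nn_integral_eq_integral)
    show "integrable P (\<lambda>\<mu>. \<integral>x. h x \<partial>K \<mu>)"
      using hR(2)[OF Kp] m by (intro P.integrable_const_bound[where B=1] AE_I2) auto
    show "AE \<mu> in P. 0 \<le> (\<integral>x. h x \<partial>K \<mu>)" using hR(2)[OF Kp] by (intro AE_I2) auto
  qed
  finally show "(\<integral>x. h x \<partial>(P \<bind> K)) = (\<integral>\<mu>. (\<integral>x. h x \<partial>K \<mu>) \<partial>P)"
    using hR(2)[OF pB sets] hR(2)[OF Kp]
    by (subst (asm) ennreal_inj) (auto intro!: Bochner_Integration.integral_nonneg)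
qed

lemma relatively_compact_subset:
  "relatively_compact B \<Longrightarrow> A \<subseteq> B \<Longrightarrow> relatively_compact A"
  unfolding relatively_compact_def
  using closure_mono compact_Int_closed[OF _ closed_closure] by (metis inf.absorb2)

section \<open>Codes of points, cylinders and test functions\<close>

text \<open>The form in which local compactness, regularity and countability enter. Closures inside
  the given neighbourhood express regularity; nonemptiness is needed when a point is recovered from
  a code by compactness.\<close>

locale relatively_compact_base =
  fixes U :: "nat \<Rightarrow> 'a::{second_countable_topology, t2_space} set"
  assumes open_U: "open (U i)"
    and nonempty_U: "U i \<noteq> {}"
    and compact_closure_U: "compact (closure (U i))"
    and base_U: "open V \<Longrightarrow> x \<in> V \<Longrightarrow> \<exists>i. x \<in> U i \<and> closure (U i) \<subseteq> V"
begin

definition code :: "'a \<Rightarrow> nat set" where "code x = {i. x \<in> U i}"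

definition cyl :: "nat \<Rightarrow> nat set \<Rightarrow> 'a set" where "cyl n S = {x. code x \<inter> {..<n} = S}"

text \<open>The points outside the first \<open>n\<close> sets have an empty prefix and may carry
  infinite mass; \<open>a {} = 0\<close> keeps tests away from them. Simple Borel functions take the
  place of continuous ones with compact support.\<close>

definition tests :: "('a \<Rightarrow> real) set" where
  "tests = {f. \<exists>n a. a {} = 0 \<and> (\<forall>S. 0 \<le> a S) \<and> f = (\<lambda>x. a (code x \<inter> {..<n}))}"

lemma U_borel [measurable]: "U i \<in> sets borel"
  using open_U by simp

lemma code_measurable [measurable]: "code \<in> borel \<rightarrow>\<^sub>M code_algebra"
  by (rule measurable_code_algebraI) (simp add: code_def)

lemma cylinder_borel [measurable]: "{x. P (code x \<inter> {..<n})} \<in> sets borel"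
  using measurable_sets[OF code_measurable cylinder_code_algebra[of P n]] by (simp add: vimage_def)

lemma cyl_borel [measurable]: "cyl n S \<in> sets borel"
  unfolding cyl_def by (rule cylinder_borel)

lemma relatively_compact_U: "relatively_compact (\<Union>i<n. U i)"
proof -
  have "closure (\<Union>i<n. U i) \<subseteq> (\<Union>i<n. closure (U i))"
    by (intro closure_minimal UN_mono closure_subset closed_UN) auto
  moreover have "compact (\<Union>i<n. closure (U i))" by (intro compact_UN compact_closure_U) auto
  ultimately show ?thesis
    unfolding relatively_compact_def using compact_Int_closed[OF _ closed_closure] by (metis inf.absorb2)
qed

lemma relatively_compact_cylinder:
  assumes "\<not> P {}" shows "relatively_compact {x. P (code x \<inter> {..<n})}"
proof (rule relatively_compact_subset[OF relatively_compact_U[of n]])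
  show "{x. P (code x \<inter> {..<n})} \<subseteq> (\<Union>i<n. U i)"
  proof
    fix x assume "x \<in> {x. P (code x \<inter> {..<n})}"
    then have "code x \<inter> {..<n} \<noteq> {}" using assms by (metis mem_Collect_eq)
    then show "x \<in> (\<Union>i<n. U i)" by (auto simp: code_def)
  qed
qed

lemma relatively_compact_cyl: "S \<noteq> {} \<Longrightarrow> relatively_compact (cyl n S)"
  unfolding cyl_def by (rule relatively_compact_cylinder) simp

lemma relatively_compact_bounded:
  assumes "relatively_compact B" shows "\<exists>n. B \<subseteq> (\<Union>i<n. U i)"
proof -
  have "closure B \<subseteq> (\<Union>i. U i)" using base_U[of UNIV] by auto
  then obtain I where I: "finite I" "closure B \<subseteq> (\<Union>i\<in>I. U i)"
    using compactE_image[of "closure B" UNIV U] assms open_U by (auto simp: relatively_compact_def)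
  have "I \<subseteq> {..<Suc (Max (insert 0 I))}" using I(1) by (auto simp: less_Suc_eq_le)
  then have "B \<subseteq> (\<Union>i<Suc (Max (insert 0 I)). U i)" using I(2) closure_subset[of B] by blast
  then show ?thesis by blast
qed

lemma cylinder_eq_UN: "{x. P (code x \<inter> {..<n})} = (\<Union>S\<in>{S\<in>Pow {..<n}. P S}. cyl n S)"
  by (auto simp: cyl_def)

lemma emeasure_cylinder:
  assumes "sets \<phi> = sets borel"
  shows "emeasure \<phi> {x. P (code x \<inter> {..<n})} = (\<Sum>S\<in>{S\<in>Pow {..<n}. P S}. emeasure \<phi> (cyl n S))"
  unfolding cylinder_eq_UN
  using assms by (intro sum_emeasure[symmetric]) (auto simp: disjoint_family_on_def cyl_def)

lemma radon_finite:
  "\<phi> \<in> radon_measures \<Longrightarrow> B \<in> sets borel \<Longrightarrow> relatively_compact B \<Longrightarrow> emeasure \<phi> B < \<infinity>"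
  by (simp add: radon_measures_def)

lemma radon_sets: "\<phi> \<in> radon_measures \<Longrightarrow> sets \<phi> = sets borel"
  by (simp add: radon_measures_def)

lemma tests_nonneg: "f \<in> tests \<Longrightarrow> 0 \<le> f x"
  by (auto simp: tests_def)

lemma tests_borel: "f \<in> tests \<Longrightarrow> f \<in> borel_measurable borel"
proof -
  assume "f \<in> tests"
  then obtain n a where f: "f = (\<lambda>x. a (code x \<inter> {..<n}))" by (auto simp: tests_def)
  show ?thesis
  proof (rule measurableI)
    fix A :: "real set"
    show "f -` A \<inter> space borel \<in> sets borel"
      using cylinder_borel[of "\<lambda>S. a S \<in> A" n] by (simp add: f vimage_def)
  qed simp
qed

lemma tests_bounded: "f \<in> tests \<Longrightarrow> \<exists>C. \<forall>x. f x \<le> C"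
proof -
  assume "f \<in> tests"
  then obtain n a where f: "f = (\<lambda>x. a (code x \<inter> {..<n}))" by (auto simp: tests_def)
  have "f x \<le> Max (a ` Pow {..<n})" for x unfolding f by (rule Max_ge) auto
  then show ?thesis by blast
qed

lemma tests_zero: "(\<lambda>_. 0) \<in> tests"
  by (auto simp: tests_def intro!: exI[of _ "\<lambda>_. 0"])

lemma tests_add: "f \<in> tests \<Longrightarrow> g \<in> tests \<Longrightarrow> (\<lambda>x. f x + g x) \<in> tests"
proof -
  assume "f \<in> tests" "g \<in> tests"
  then obtain n a m b where
    f: "f = (\<lambda>x. a (code x \<inter> {..<n}))" "a {} = 0" "\<And>S. 0 \<le> a S" and
    g: "g = (\<lambda>x. b (code x \<inter> {..<m}))" "b {} = 0" "\<And>S. 0 \<le> b S" by (auto simp: tests_def)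
  have e: "A \<inter> {..<max n m} \<inter> {..<n} = A \<inter> {..<n}" "A \<inter> {..<max n m} \<inter> {..<m} = A \<inter> {..<m}" for A by auto
  show ?thesis
    unfolding tests_def using f g
    by (intro CollectI exI[of _ "max n m"] exI[of _ "\<lambda>S. a (S \<inter> {..<n}) + b (S \<inter> {..<m})"]) (simp add: e)
qed

lemma tests_comp: "f \<in> tests \<Longrightarrow> u 0 = 0 \<Longrightarrow> (\<And>x. 0 \<le> u (f x)) \<Longrightarrow> (\<lambda>x. u (f x)) \<in> tests"
proof -
  assume "f \<in> tests" and u: "u 0 = 0" "\<And>x. 0 \<le> u (f x)"
  then obtain n a where
    f: "f = (\<lambda>x. a (code x \<inter> {..<n}))" "a {} = 0" "\<And>S. 0 \<le> a S" by (auto simp: tests_def)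
  \<comment> \<open>The coefficients must be nonnegative also at sets that are the prefix of no
    point, whereas \<open>u\<close> is known to be nonnegative only at values of \<open>f\<close>;
    hence the truncation at 0.\<close>
  have "(\<lambda>x. u (f x)) = (\<lambda>x. max 0 (u (a (code x \<inter> {..<n}))))" using u(2) by (auto simp: f max_def)
  then show ?thesis unfolding tests_def using f u
    by (intro CollectI exI[of _ n] exI[of _ "\<lambda>S. max 0 (u (a S))"]) simp
qed

lemma tests_cmult: "f \<in> tests \<Longrightarrow> 0 \<le> c \<Longrightarrow> (\<lambda>x. c * f x) \<in> tests"
  by (rule tests_comp) (simp_all add: tests_nonneg)

lemma tests_indicator: "\<not> P {} \<Longrightarrow> indicator {x. P (code x \<inter> {..<n})} \<in> tests"
  unfolding tests_def
  by (intro CollectI exI[of _ n] exI[of _ "indicator {S. P S}"]) (auto simp: indicator_def fun_eq_iff)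

lemma tests_indicator_cyl: "S \<noteq> {} \<Longrightarrow> indicator (cyl n S) \<in> tests"
  unfolding cyl_def by (rule tests_indicator) simp

lemma tests_support: "f \<in> tests \<Longrightarrow> \<exists>n. \<forall>x. f x \<noteq> 0 \<longrightarrow> x \<in> (\<Union>i<n. U i)"
proof -
  assume "f \<in> tests"
  then obtain n a where f: "f = (\<lambda>x. a (code x \<inter> {..<n}))" "a {} = 0" by (auto simp: tests_def)
  have "x \<in> (\<Union>i<n. U i)" if "f x \<noteq> 0" for x
  proof -
    have "code x \<inter> {..<n} \<noteq> {}" using that f by metis
    then show ?thesis by (auto simp: code_def)
  qed
  then show ?thesis by blast
qed

lemma integral_test:
  assumes \<phi>: "\<phi> \<in> radon_measures" and a: "a {} = 0"
  shows "integrable \<phi> (\<lambda>x. a (code x \<inter> {..<n}) :: real)"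
    and "(\<integral>x. a (code x \<inter> {..<n}) \<partial>\<phi>) = (\<Sum>S\<in>Pow {..<n} - {{}}. a S * measure \<phi> (cyl n S))"
proof -
  have [measurable_cong]: "sets \<phi> = sets borel" by (rule radon_sets[OF \<phi>])
  have eq: "a (code x \<inter> {..<n}) = (\<Sum>S\<in>Pow {..<n} - {{}}. a S * indicator (cyl n S) x)" for x
  proof -
    have "(\<Sum>S\<in>Pow {..<n} - {{}}. a S * indicator (cyl n S) x)
       = (\<Sum>S\<in>Pow {..<n} - {{}}. if S = code x \<inter> {..<n} then a S else 0)"
      by (intro sum.cong) (auto simp: cyl_def)
    also have "\<dots> = a (code x \<inter> {..<n})" using a by (subst sum.delta) auto
    finally show ?thesis ..
  qed
  have i: "integrable \<phi> (\<lambda>x. a S * indicator (cyl n S) x)" if "S \<in> Pow {..<n} - {{}}" for S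
    using radon_finite[OF \<phi> cyl_borel relatively_compact_cyl, of S n] that
    by (intro integrable_mult_right integrable_real_indicator) auto
  show "integrable \<phi> (\<lambda>x. a (code x \<inter> {..<n}))"
    unfolding eq by (intro Bochner_Integration.integrable_sum i)
  have m: "(\<integral>x. indicator (cyl n S) x \<partial>\<phi>) = measure \<phi> (cyl n S)" for S
    by (simp add: sets_eq_imp_space_eq[OF radon_sets[OF \<phi>]])
  show "(\<integral>x. a (code x \<inter> {..<n}) \<partial>\<phi>) = (\<Sum>S\<in>Pow {..<n} - {{}}. a S * measure \<phi> (cyl n S))"
    unfolding eq by (subst Bochner_Integration.integral_sum) (simp_all only: i integral_mult_right_zero m)
qed

lemma tests_integrable: "\<phi> \<in> radon_measures \<Longrightarrow> f \<in> tests \<Longrightarrow> integrable \<phi> f"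
  using integral_test(1) by (auto simp: tests_def)

lemma laplace_indicator:
  assumes "\<phi> \<in> radon_measures" "S \<noteq> {}"
  shows "laplace (\<lambda>x. c * indicator (cyl n S) x) \<phi> = exp (- c * measure \<phi> (cyl n S))"
  using assms by (simp add: laplace_def sets_eq_imp_space_eq[OF radon_sets[OF assms(1)]])

lemma laplace_add:
  assumes "\<phi> \<in> radon_measures" "f \<in> tests" "g \<in> tests"
  shows "laplace (\<lambda>x. f x + g x) \<phi> = laplace f \<phi> * laplace g \<phi>"
  using tests_integrable[OF assms(1)] assms by (simp add: laplace_def exp_add[symmetric])

lemma laplace_measurable:
  assumes "f \<in> tests" shows "laplace f \<in> borel_measurable radon_algebra"
proof -
  obtain n a where f: "f = (\<lambda>x. a (code x \<inter> {..<n}))" "a {} = 0" using assms by (auto simp: tests_def)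
  note [measurable] = measurable_emeasure_radon
  have "(\<lambda>\<phi>. exp (- (\<Sum>S\<in>Pow {..<n} - {{}}. a S * enn2real (emeasure \<phi> (cyl n S))))) \<in> borel_measurable radon_algebra"
    by measurable
  then show ?thesis
    by (rule measurable_cong[THEN iffD1, rotated])
      (simp add: space_radon_algebra laplace_def f integral_test(2) measure_def)
qed

lemma incseq_U: "incseq (\<lambda>n. \<Union>i<n. U i)" and UN_U: "(\<Union>n. \<Union>i<n. U i) = UNIV"
proof -
  show "incseq (\<lambda>n. \<Union>i<n. U i)" by (intro monoI UN_mono) auto
  show "(\<Union>n. \<Union>i<n. U i) = UNIV" using base_U[of UNIV] by (auto intro: lessI)
qed

section \<open>Cylinders generate the Borel sets and the evaluations\<close>

definition cyls :: "'a set set" where "cyls = insert {} {cyl n S |n S. S \<subseteq> {..<n} \<and> S \<noteq> {}}"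

text \<open>Cylinders form a tree: two of them are nested if the longer prefix extends the shorter
  one, and disjoint otherwise.\<close>

lemma Int_stable_cyls: "Int_stable cyls"
proof (rule Int_stableI)
  have *: "cyl n S \<inter> cyl m R \<in> cyls" if "n \<le> m" "S \<subseteq> {..<n}" "R \<subseteq> {..<m}" "R \<noteq> {}" for n m S R
  proof (cases "R \<inter> {..<n} = S")
    case True
    have "cyl m R \<subseteq> cyl n S"
    proof
      fix x assume "x \<in> cyl m R"
      then have "code x \<inter> {..<m} \<inter> {..<n} = R \<inter> {..<n}" by (simp add: cyl_def)
      moreover have "code x \<inter> {..<m} \<inter> {..<n} = code x \<inter> {..<n}" using that(1) by auto
      ultimately show "x \<in> cyl n S" using True by (simp add: cyl_def)
    qed
    then have "cyl n S \<inter> cyl m R = cyl m R" by blast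
    then show ?thesis using that by (auto simp: cyls_def)
  next
    case False
    have "cyl n S \<inter> cyl m R = {}" using False that(1) by (auto simp: cyl_def)
    then show ?thesis by (simp add: cyls_def)
  qed
  fix A B assume AB: "A \<in> cyls" "B \<in> cyls"
  show "A \<inter> B \<in> cyls"
  proof (cases "A = {} \<or> B = {}")
    case True
    then show ?thesis by (auto simp: cyls_def)
  next
    case False
    then obtain n S m R where "A = cyl n S" "S \<subseteq> {..<n}" "S \<noteq> {}" "B = cyl m R" "R \<subseteq> {..<m}" "R \<noteq> {}"
      using AB by (auto simp: cyls_def)
    then show ?thesis using *[of n m S R] *[of m n R S] by (metis Int_commute nle_le)
  qed
qed

text \<open>Each \<open>U i\<close> is a finite union of cylinders of level \<open>Suc i\<close>,
  and each open set is a countable union of sets \<open>U i\<close>.\<close>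

lemma borel_eq_cyls: "sets borel = sigma_sets UNIV cyls"
proof (rule antisym)
  have sg: "sets (sigma UNIV cyls) = sigma_sets UNIV cyls" by (rule sets_measure_of) simp
  have U: "U i \<in> sets (sigma UNIV cyls)" for i
  proof -
    have "U i = {x. i \<in> code x \<inter> {..<Suc i}}" by (simp add: code_def)
    from trans[OF this cylinder_eq_UN[of "\<lambda>S. i \<in> S" "Suc i"]]
    have eq: "U i = (\<Union>S\<in>{S\<in>Pow {..<Suc i}. i \<in> S}. cyl (Suc i) S)" .
    show ?thesis unfolding eq sg by (intro sigma_sets_UNION countable_finite) (auto simp: cyls_def)
  qed
  have "V \<in> sigma_sets UNIV cyls" if "open V" for V
  proof -
    have eq: "V = (\<Union>i\<in>{i. U i \<subseteq> V}. U i)"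
    proof (intro equalityI subsetI)
      fix x assume "x \<in> V"
      from base_U[OF that this] obtain i where "x \<in> U i" "closure (U i) \<subseteq> V" by blast
      then show "x \<in> (\<Union>i\<in>{i. U i \<subseteq> V}. U i)" using closure_subset[of "U i"] by blast
    qed blast
    have "(\<Union>i\<in>{i. U i \<subseteq> V}. U i) \<in> sets (sigma UNIV cyls)"
      using U by (intro sets.countable_UN) auto
    then show ?thesis using eq sg by metis
  qed
  then show "sets borel \<subseteq> sigma_sets UNIV cyls"
    unfolding borel_def by (auto intro!: sigma_sets_mono)
  show "sigma_sets UNIV cyls \<subseteq> sets borel"
  proof -
    have "cyls \<subseteq> sets borel" by (auto simp: cyls_def)
    then show ?thesis using sets.sigma_sets_subset[of cyls borel] by simp
  qed
qed

text \<open>A Dynkin argument reduces all Borel sets to cylinders. It runs inside the sets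
  \<open>\<Union>i<k. U i\<close>, where masses are finite and complements turn into differences;
  afterwards \<open>k\<close> tends to infinity.\<close>

lemma measurable_radonI:
  assumes f: "\<And>\<omega>. \<omega> \<in> space M \<Longrightarrow> f \<omega> \<in> radon_measures"
    and m: "\<And>n S. S \<subseteq> {..<n} \<Longrightarrow> S \<noteq> {} \<Longrightarrow> (\<lambda>\<omega>. emeasure (f \<omega>) (cyl n S)) \<in> borel_measurable M"
  shows "f \<in> M \<rightarrow>\<^sub>M radon_algebra"
proof (rule measurable_radon_algebraI[OF f])
  fix B :: "'a set" assume B: "B \<in> sets borel"
  let ?V = "\<lambda>k. \<Union>i<k. U i"
  have V: "?V k \<in> sets borel" for k by measurable
  have cylm: "(\<lambda>\<omega>. emeasure (f \<omega>) {x. P (code x \<inter> {..<n})}) \<in> borel_measurable M" if "\<not> P {}" for P n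
  proof -
    have "(\<lambda>\<omega>. \<Sum>S\<in>{S\<in>Pow {..<n}. P S}. emeasure (f \<omega>) (cyl n S)) \<in> borel_measurable M"
      using that by (intro borel_measurable_sum m) auto
    then show ?thesis
      by (rule measurable_cong[THEN iffD1, rotated]) (simp add: emeasure_cylinder radon_sets f)
  qed
  have sub: "cyls \<subseteq> Pow UNIV" by simp
  have "(\<lambda>\<omega>. emeasure (f \<omega>) (B \<inter> ?V k)) \<in> borel_measurable M" for k
    using Int_stable_cyls sub B[unfolded borel_eq_cyls]
  proof (induction B rule: sigma_sets_induct_disjoint)
    case (basic A)
    show ?case
    proof (cases "A = {}")
      case False
      then obtain n S where A: "A = cyl n S" "S \<subseteq> {..<n}" "S \<noteq> {}" using basic by (auto simp: cyls_def)
      have e: "C \<inter> {..<max n k} \<inter> {..<n} = C \<inter> {..<n}" "C \<inter> {..<max n k} \<inter> {..<k} = C \<inter> {..<k}" for C by auto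
      have "A \<inter> ?V k = {x. (\<lambda>R. R \<inter> {..<n} = S \<and> R \<inter> {..<k} \<noteq> {}) (code x \<inter> {..<max n k})}"
        unfolding e A(1) by (auto simp: cyl_def code_def)
      then show ?thesis by (simp only:) (rule cylm, use A in auto)
    qed simp
  next
    case empty
    then show ?case by simp
  next
    case (compl A)
    have A: "A \<in> sets borel" using compl(1) by (simp add: borel_eq_cyls)
    have "(\<lambda>\<omega>. emeasure (f \<omega>) (?V k)) \<in> borel_measurable M"
    proof -
      have "?V k = {x. code x \<inter> {..<k} \<noteq> {}}" by (auto simp: code_def)
      then show ?thesis using cylm[of "\<lambda>S. S \<noteq> {}" k] by simp
    qed
    then have "(\<lambda>\<omega>. emeasure (f \<omega>) (?V k) - emeasure (f \<omega>) (A \<inter> ?V k)) \<in> borel_measurable M"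
      using compl by measurable
    then show ?case
    proof (rule measurable_cong[THEN iffD1, rotated])
      fix \<omega> assume \<omega>: "\<omega> \<in> space M"
      have fin: "emeasure (f \<omega>) (?V k) < \<infinity>" by (rule radon_finite[OF f[OF \<omega>] V relatively_compact_U])
      have "emeasure (f \<omega>) (A \<inter> ?V k) \<le> emeasure (f \<omega>) (?V k)"
        by (rule emeasure_mono) (use radon_sets[OF f[OF \<omega>]] V in auto)
      then have "emeasure (f \<omega>) (?V k - A \<inter> ?V k) = emeasure (f \<omega>) (?V k) - emeasure (f \<omega>) (A \<inter> ?V k)"
        using fin A V radon_sets[OF f[OF \<omega>]] by (intro emeasure_Diff) auto
      moreover have "(UNIV - A) \<inter> ?V k = ?V k - A \<inter> ?V k" by auto
      ultimately show "emeasure (f \<omega>) (?V k) - emeasure (f \<omega>) (A \<inter> ?V k) = emeasure (f \<omega>) ((UNIV - A) \<inter> ?V k)"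
        by simp
    qed
  next
    case (union A)
    have A: "range A \<subseteq> sets borel" using union(2) by (simp add: borel_eq_cyls)
    have "(\<lambda>\<omega>. \<Sum>i. emeasure (f \<omega>) (A i \<inter> ?V k)) \<in> borel_measurable M"
      using union by measurable
    then show ?case
    proof (rule measurable_cong[THEN iffD1, rotated])
      fix \<omega> assume \<omega>: "\<omega> \<in> space M"
      have "disjoint_family (\<lambda>i. A i \<inter> ?V k)" by (rule disjoint_family_subset[OF union(1)]) auto
      then have "(\<Sum>i. emeasure (f \<omega>) (A i \<inter> ?V k)) = emeasure (f \<omega>) (\<Union>i. A i \<inter> ?V k)"
        using A V radon_sets[OF f[OF \<omega>]]
        by (intro suminf_emeasure) auto
      then show "(\<Sum>i. emeasure (f \<omega>) (A i \<inter> ?V k)) = emeasure (f \<omega>) ((\<Union>i. A i) \<inter> ?V k)" by simp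
    qed
  qed
  then have "(\<lambda>\<omega>. SUP k. emeasure (f \<omega>) (B \<inter> ?V k)) \<in> borel_measurable M" by measurable
  then show "(\<lambda>\<omega>. emeasure (f \<omega>) B) \<in> borel_measurable M"
  proof (rule measurable_cong[THEN iffD1, rotated])
    fix \<omega> assume \<omega>: "\<omega> \<in> space M"
    have "(SUP k. emeasure (f \<omega>) (B \<inter> ?V k)) = emeasure (f \<omega>) (\<Union>k. B \<inter> ?V k)"
      using B V radon_sets[OF f[OF \<omega>]] incseq_U
      by (intro SUP_emeasure_incseq) (auto simp: incseq_def, blast)
    also have "(\<Union>k. B \<inter> ?V k) = B" by (simp only: Int_UN_distrib[symmetric] UN_U Int_UNIV_right)
    finally show "(SUP k. emeasure (f \<omega>) (B \<inter> ?V k)) = emeasure (f \<omega>) B" .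
  qed
qed


text \<open>The mass of a cylinder is minus the logarithm of the Laplace functional of its
  indicator.\<close>

lemma measurable_radon_laplaceI:
  assumes f: "\<And>\<omega>. \<omega> \<in> space M \<Longrightarrow> f \<omega> \<in> radon_measures"
    and m: "\<And>g. g \<in> tests \<Longrightarrow> (\<lambda>\<omega>. laplace g (f \<omega>)) \<in> borel_measurable M"
  shows "f \<in> M \<rightarrow>\<^sub>M radon_algebra"
proof (rule measurable_radonI[OF f])
  fix n and S :: "nat set" assume S: "S \<subseteq> {..<n}" "S \<noteq> {}"
  note [measurable] = m[OF tests_indicator_cyl[OF S(2)]]
  have "(\<lambda>\<omega>. ennreal (- ln (laplace (indicator (cyl n S)) (f \<omega>)))) \<in> borel_measurable M" by measurable
  then show "(\<lambda>\<omega>. emeasure (f \<omega>) (cyl n S)) \<in> borel_measurable M"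
  proof (rule measurable_cong[THEN iffD1, rotated])
    fix \<omega> assume "\<omega> \<in> space M"
    then have \<phi>: "f \<omega> \<in> radon_measures" by (rule f)
    have "laplace (indicator (cyl n S)) (f \<omega>) = exp (- measure (f \<omega>) (cyl n S))"
      using laplace_indicator[OF \<phi> S(2), of 1 n] by simp
    then show "ennreal (- ln (laplace (indicator (cyl n S)) (f \<omega>))) = emeasure (f \<omega>) (cyl n S)"
      using radon_finite[OF \<phi> cyl_borel relatively_compact_cyl[OF S(2)], of n]
      by (simp add: emeasure_eq_ennreal_measure)
  qed
qed

section \<open>Laplace functionals determine laws and kernels\<close>

text \<open>Let \<open>N\<close> carry the \<sigma>-algebra generated by the Laplace functionals.
  The identity from \<open>N\<close> into \<open>radon_algebra\<close> is measurable by
  \<open>measurable_radon_laplaceI\<close>, and this is the claimed inclusion.\<close>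

lemma sigma_sets_laplace:
  assumes \<Omega>: "\<Omega> \<subseteq> radon_measures" and A: "A \<in> sets (restrict_space radon_algebra \<Omega>)"
  shows "A \<in> sigma_sets \<Omega> {{\<phi>\<in>\<Omega>. f \<phi> > a} |f a. f \<in> laplace ` tests}"
proof -
  let ?G = "{{\<phi>\<in>\<Omega>. f \<phi> > a} |f a. f \<in> laplace ` tests}"
  define N where "N = sigma \<Omega> ?G"
  have G: "?G \<subseteq> Pow \<Omega>" by auto
  have sN: "space N = \<Omega>" "sets N = sigma_sets \<Omega> ?G"
    unfolding N_def by (rule space_measure_of[OF G], rule sets_measure_of[OF G])
  have lm [measurable]: "laplace f \<in> borel_measurable N" if "f \<in> tests" for f
    
  proof (rule borel_measurableI_greater)
    fix y
    have "{\<phi>\<in>\<Omega>. laplace f \<phi> > y} \<in> ?G" using that by blast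
    then show "{\<phi>\<in>space N. laplace f \<phi> > y} \<in> sets N" unfolding sN by (rule sigma_sets.Basic)
  qed
  have id: "(\<lambda>\<phi>. \<phi>) \<in> N \<rightarrow>\<^sub>M radon_algebra"
    by (rule measurable_radon_laplaceI) (use \<Omega> sN lm in auto)
  obtain C where C: "C \<in> sets radon_algebra" "A = \<Omega> \<inter> C" using A by (auto simp: sets_restrict_space)
  have "A = (\<lambda>\<phi>. \<phi>) -` C \<inter> space N" using C(2) sN by auto
  also have "\<dots> \<in> sets N" by (rule measurable_sets[OF id C(1)])
  finally show ?thesis by (simp add: sN)
qed

lemma space_restrict_radon: "\<Omega> \<subseteq> radon_measures \<Longrightarrow> space (restrict_space radon_algebra \<Omega>) = \<Omega>"
  by (auto simp: space_restrict_space space_radon_algebra)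

lemma laplace_restrict_measurable:
  "f \<in> tests \<Longrightarrow> laplace f \<in> borel_measurable (restrict_space radon_algebra \<Omega>)"
  by (rule measurable_restrict_space1[OF laplace_measurable])

text \<open>The rule that a sum of tests gives a product of Laplace functionals is available on
  Radon measures, where tests are integrable. Membership is therefore judged on
  \<open>\<Omega>\<close> alone, which makes the class closed under products.\<close>

definition laplace_functions :: "'a measure set \<Rightarrow> ('a measure \<Rightarrow> real) set" where
  "laplace_functions \<Omega> = {h. \<exists>f\<in>tests. \<forall>\<phi>\<in>\<Omega>. h \<phi> = laplace f \<phi>}"

lemma laplace_functions_mult:
  assumes \<Omega>: "\<Omega> \<subseteq> radon_measures" and hk: "h \<in> laplace_functions \<Omega>" "k \<in> laplace_functions \<Omega>"
  shows "(\<lambda>x. h x * k x) \<in> laplace_functions \<Omega>"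
proof -
  obtain f g where fg: "f \<in> tests" "g \<in> tests" "\<forall>\<phi>\<in>\<Omega>. h \<phi> = laplace f \<phi>" "\<forall>\<phi>\<in>\<Omega>. k \<phi> = laplace g \<phi>"
    using hk unfolding laplace_functions_def by blast
  then show ?thesis unfolding laplace_functions_def
    using \<Omega> by (intro CollectI bexI[OF _ tests_add[OF fg(1,2)]]) (auto simp: laplace_add)
qed

lemma laplace_functions_one: "(\<lambda>_. 1) \<in> laplace_functions \<Omega>"
  unfolding laplace_functions_def by (intro CollectI bexI[OF _ tests_zero]) (simp add: laplace_def)

lemma laplace_functions_range: "h \<in> laplace_functions \<Omega> \<Longrightarrow> x \<in> \<Omega> \<Longrightarrow> h x \<in> {0..1}"
proof -
  assume hx: "h \<in> laplace_functions \<Omega>" "x \<in> \<Omega>"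
  obtain f where f: "f \<in> tests" "h x = laplace f x" using hx unfolding laplace_functions_def by blast
  show ?thesis unfolding f(2) using laplace_01[of f x] tests_nonneg[OF f(1)] by auto
qed

lemma sigma_sets_laplace_sets:
  assumes \<Omega>: "\<Omega> \<subseteq> radon_measures" and A: "A \<in> sets (restrict_space radon_algebra \<Omega>)"
  shows "A \<in> sigma_sets \<Omega> {{\<phi>\<in>\<Omega>. f \<phi> > a} |f a. f \<in> laplace_functions \<Omega>}"
proof -
  have "{{\<phi>\<in>\<Omega>. f \<phi> > a} |f a. f \<in> laplace ` tests} \<subseteq> {{\<phi>\<in>\<Omega>. f \<phi> > a} |f a. f \<in> laplace_functions \<Omega>}"
  proof -
    have "laplace ` tests \<subseteq> laplace_functions \<Omega>" by (auto simp: laplace_functions_def)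
    then show ?thesis by blast
  qed
  from sigma_sets_subseteq[OF this] show ?thesis using sigma_sets_laplace[OF \<Omega> A] by blast
qed

text \<open>The parameter \<open>\<Omega>\<close> lets one uniqueness statement serve random
  measures (\<open>radon_measures\<close>) and point processes
  (\<open>counting_measures\<close>).\<close>

lemma laplace_eqI:
  assumes \<Omega>: "\<Omega> \<subseteq> radon_measures" and PQ: "prob_space P" "prob_space Q"
    and sP: "sets P = sets (restrict_space radon_algebra \<Omega>)" and sQ: "sets Q = sets (restrict_space radon_algebra \<Omega>)"
    and eq: "\<And>f. f \<in> tests \<Longrightarrow> (\<integral>\<phi>. laplace f \<phi> \<partial>P) = (\<integral>\<phi>. laplace f \<phi> \<partial>Q)"
  shows "P = Q"
proof -
  have sp: "space P = \<Omega>" "space Q = \<Omega>"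
    using sets_eq_imp_space_eq[OF sP] sets_eq_imp_space_eq[OF sQ] space_restrict_radon[OF \<Omega>] by auto
  show ?thesis
  proof (rule measure_eqI_multiplicative[OF PQ, of "laplace_functions \<Omega>"], unfold sp)
    show "sets P = sets Q" using sP sQ by simp
    show "sets Q \<subseteq> sigma_sets \<Omega> {{x\<in>\<Omega>. f x > a} |f a. f \<in> laplace_functions \<Omega>}"
      unfolding sQ using sigma_sets_laplace_sets[OF \<Omega>] by blast
    fix h assume h: "h \<in> laplace_functions \<Omega>"
    obtain f where f: "f \<in> tests" "\<And>\<phi>. \<phi> \<in> \<Omega> \<Longrightarrow> h \<phi> = laplace f \<phi>" using h unfolding laplace_functions_def by blast
    have "laplace f \<in> borel_measurable Q"
      using laplace_restrict_measurable[OF f(1), of \<Omega>] measurable_cong_sets[OF sQ refl] by blast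
    then show "h \<in> borel_measurable Q"
      by (rule measurable_cong[THEN iffD1, rotated]) (simp add: f(2) sp)
    have "(\<integral>x. h x \<partial>R) = (\<integral>x. laplace f x \<partial>R)" if "space R = \<Omega>" for R
      using that by (intro Bochner_Integration.integral_cong) (auto simp: f(2))
    then show "(\<integral>x. h x \<partial>P) = (\<integral>x. h x \<partial>Q)" using eq[OF f(1)] sp by simp
  qed (auto intro: laplace_functions_mult[OF \<Omega>] laplace_functions_one dest: laplace_functions_range)
qed

text \<open>The functions whose integral under \<open>K \<mu>\<close> depends measurably on
  \<open>\<mu>\<close> form a class for \<open>functional_monotone_class\<close>. So a kernel that
  is known only through its Laplace functionals can still be shown to be measurable.\<close>

lemma measurable_laplace_kernel:
  assumes \<Omega>: "\<Omega> \<subseteq> radon_measures"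
    and K: "\<And>\<mu>. \<mu> \<in> space M \<Longrightarrow> prob_space (K \<mu>)"
    and sK: "\<And>\<mu>. \<mu> \<in> space M \<Longrightarrow> sets (K \<mu>) = sets (restrict_space radon_algebra \<Omega>)"
    and m: "\<And>f. f \<in> tests \<Longrightarrow> (\<lambda>\<mu>. \<integral>\<phi>. laplace f \<phi> \<partial>K \<mu>) \<in> borel_measurable M"
  shows "K \<in> M \<rightarrow>\<^sub>M prob_algebra (restrict_space radon_algebra \<Omega>)"
proof -
  let ?R = "restrict_space radon_algebra \<Omega>"
  have sp: "space (K \<mu>) = \<Omega>" if "\<mu> \<in> space M" for \<mu>
    using sets_eq_imp_space_eq[OF sK[OF that]] space_restrict_radon[OF \<Omega>] by auto
  define H where "H = {h :: 'a measure \<Rightarrow> real. h \<in> borel_measurable ?R \<and> (\<exists>C. \<forall>x\<in>\<Omega>. \<bar>h x\<bar> \<le> C) \<and>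
    (\<lambda>\<mu>. \<integral>x. h x \<partial>K \<mu>) \<in> borel_measurable M}"
  have Km: "h \<in> borel_measurable (K \<mu>)" if "h \<in> borel_measurable ?R" "\<mu> \<in> space M" for h \<mu>
    using that measurable_cong_sets[OF sK[OF that(2)] refl] by auto
  have H_int: "integrable (K \<mu>) h" if "h \<in> H" "\<mu> \<in> space M" for h \<mu>
  proof -
    interpret prob_space "K \<mu>" using K that by auto
    from that(1) obtain C where h: "h \<in> borel_measurable ?R" and C: "\<forall>x\<in>\<Omega>. \<bar>h x\<bar> \<le> C" unfolding H_def by blast
    have "AE x in K \<mu>. norm (h x) \<le> C" by (rule AE_I2) (simp add: sp[OF that(2)] C)
    then show ?thesis using Km[OF h that(2)] by (rule integrable_const_bound)
  qed
  have "(\<lambda>\<mu>. emeasure (K \<mu>) A) \<in> borel_measurable M" if A: "A \<in> sets ?R" for A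
  proof -
    have "indicator A \<in> H"
    proof (rule functional_monotone_class[OF _ _ _ _ laplace_functions_one _ sigma_sets_laplace_sets[OF \<Omega> A]])
      show "laplace_functions \<Omega> \<subseteq> H"
      proof
        fix h assume h: "h \<in> laplace_functions \<Omega>"
        obtain f where f: "f \<in> tests" "\<And>\<phi>. \<phi> \<in> \<Omega> \<Longrightarrow> h \<phi> = laplace f \<phi>" using h unfolding laplace_functions_def by blast
        have "\<bar>h x\<bar> \<le> 1" if "x \<in> \<Omega>" for x using laplace_functions_range[OF h that] by auto
        moreover have "h \<in> borel_measurable ?R"
          using laplace_restrict_measurable[OF f(1), of \<Omega>]
          by (rule measurable_cong[THEN iffD1, rotated]) (simp add: f(2) space_restrict_radon[OF \<Omega>])
        moreover have "(\<lambda>\<mu>. \<integral>x. h x \<partial>K \<mu>) \<in> borel_measurable M"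
          using m[OF f(1)] by (rule measurable_cong[THEN iffD1, rotated])
            (auto intro!: Bochner_Integration.integral_cong simp: sp f(2))
        ultimately show "h \<in> H" unfolding H_def by blast
      qed
      show "(\<lambda>x. f x * g x) \<in> laplace_functions \<Omega>" if "f \<in> laplace_functions \<Omega>" "g \<in> laplace_functions \<Omega>" for f g
        using that by (rule laplace_functions_mult[OF \<Omega>])
      show "f x \<in> {0..1}" if "f \<in> laplace_functions \<Omega>" "x \<in> \<Omega>" for f x
        using that by (rule laplace_functions_range)
      show "(\<lambda>x. a * f x + b * g x) \<in> H" if "f \<in> H" "g \<in> H" for f g a b
      proof -
        from that obtain C D where [measurable]: "f \<in> borel_measurable ?R" "g \<in> borel_measurable ?R"
          and C: "\<forall>x\<in>\<Omega>. \<bar>f x\<bar> \<le> C" and D: "\<forall>x\<in>\<Omega>. \<bar>g x\<bar> \<le> D"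
          and [measurable]: "(\<lambda>\<mu>. \<integral>x. f x \<partial>K \<mu>) \<in> borel_measurable M" "(\<lambda>\<mu>. \<integral>x. g x \<partial>K \<mu>) \<in> borel_measurable M"
          by (auto simp: H_def)
        have "\<bar>a * f x + b * g x\<bar> \<le> \<bar>a\<bar> * C + \<bar>b\<bar> * D" if "x \<in> \<Omega>" for x
          using C[rule_format, OF that] D[rule_format, OF that]
        by (intro order.trans[OF abs_triangle_ineq] add_mono) (auto simp: abs_mult intro!: mult_left_mono)
        moreover have "(\<lambda>\<mu>. a * (\<integral>x. f x \<partial>K \<mu>) + b * (\<integral>x. g x \<partial>K \<mu>)) \<in> borel_measurable M" by measurable
        then have "(\<lambda>\<mu>. \<integral>x. a * f x + b * g x \<partial>K \<mu>) \<in> borel_measurable M"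
          by (rule measurable_cong[THEN iffD1, rotated]) (simp add: H_int that)
        ultimately show ?thesis unfolding H_def by auto
      qed
      fix f g and C :: real assume f: "\<And>n. f n \<in> H" and C: "\<And>n x. x \<in> \<Omega> \<Longrightarrow> \<bar>f n x\<bar> \<le> C"
        and g: "\<And>x. x \<in> \<Omega> \<Longrightarrow> (\<lambda>n. f n x) \<longlonglongrightarrow> g x"
      have fm: "f n \<in> borel_measurable ?R" for n using f by (auto simp: H_def)
      have gm: "g \<in> borel_measurable ?R"
        by (rule borel_measurable_LIMSEQ_real[where u=f, OF _ fm]) (simp add: space_restrict_radon[OF \<Omega>] g)
      have "(\<lambda>\<mu>. \<integral>x. g x \<partial>K \<mu>) \<in> borel_measurable M"
      proof (rule borel_measurable_LIMSEQ_real)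
        show "(\<lambda>\<mu>. \<integral>x. f n x \<partial>K \<mu>) \<in> borel_measurable M" for n using f by (auto simp: H_def)
        fix \<mu> assume \<mu>: "\<mu> \<in> space M"
        interpret prob_space "K \<mu>" using K \<mu> by auto
        show "(\<lambda>n. \<integral>x. f n x \<partial>K \<mu>) \<longlonglongrightarrow> (\<integral>x. g x \<partial>K \<mu>)"
          using g C Km[OF fm \<mu>] Km[OF gm \<mu>]
          by (intro integral_dominated_convergence[where w="\<lambda>_. C"] AE_I2) (auto simp: sp[OF \<mu>])
      qed
      moreover have "\<bar>g x\<bar> \<le> C" if "x \<in> \<Omega>" for x
        using C that by (intro LIMSEQ_le_const2[OF tendsto_rabs[OF g[OF that]]]) auto
      ultimately show "g \<in> H" using gm unfolding H_def by auto
    qed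
    then have [measurable]: "(\<lambda>\<mu>. \<integral>x. indicator A x \<partial>K \<mu> :: real) \<in> borel_measurable M" by (simp add: H_def)
    have "(\<lambda>\<mu>. ennreal (\<integral>x. indicator A x \<partial>K \<mu> :: real)) \<in> borel_measurable M" by measurable
    then show ?thesis
    proof (rule measurable_cong[THEN iffD1, rotated])
      fix \<mu> assume \<mu>: "\<mu> \<in> space M"
      interpret prob_space "K \<mu>" using K \<mu> by auto
      have "A \<inter> space (K \<mu>) = A" using A sets.sets_into_space[of A "K \<mu>"] sK[OF \<mu>] by auto
      then show "ennreal (\<integral>x. indicator A x \<partial>K \<mu> :: real) = emeasure (K \<mu>) A"
        by (simp add: emeasure_eq_measure)
    qed
  qed
  then have "K \<in> M \<rightarrow>\<^sub>M subprob_algebra ?R"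
    using K sK by (intro measurable_subprob_algebra) (auto simp: prob_space_imp_subprob_space)
  then show ?thesis
    unfolding prob_algebra_def using K by (intro measurable_restrict_space2) auto
qed

end

section \<open>Thinning and stability\<close>

lemma emeasure_atoms_finite:
  assumes "B \<in> sets borel" "finite {i\<in>I. x i \<in> B}"
  shows "emeasure (atoms I x) B = of_nat (card {i\<in>I. x i \<in> B})"
  using assms by (simp add: emeasure_atoms)

lemma sets_atoms [simp]: "sets (atoms I x) = sets borel" and space_atoms [simp]: "space (atoms I x) = UNIV"
  by (simp_all add: atoms_def)

lemma finite_atoms:
  assumes "atoms I x \<in> radon_measures" "B \<in> sets borel" "relatively_compact B"
  shows "finite {i\<in>I. x i \<in> B}"
proof (rule ccontr)
  assume "infinite {i\<in>I. x i \<in> B}"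
  then have "emeasure (atoms I x) B = \<infinity>" using assms by (simp add: emeasure_atoms emeasure_count_space_infinite)
  moreover have "emeasure (atoms I x) B < \<infinity>" using assms unfolding radon_measures_def by blast
  ultimately show False by simp
qed

lemma atoms_radonI:
  assumes "\<And>B. B \<in> sets borel \<Longrightarrow> relatively_compact B \<Longrightarrow> finite {i\<in>I. x i \<in> B}"
  shows "atoms I x \<in> radon_measures"
  using assms by (auto simp: radon_measures_def emeasure_atoms_finite of_nat_less_top)

lemma atoms_counting: "atoms I x \<in> radon_measures \<Longrightarrow> atoms I x \<in> counting_measures"
  by (auto simp: counting_measures_def)

lemma laplace_atoms:
  fixes f :: "'a::topological_space \<Rightarrow> real"
  assumes f: "f \<in> borel_measurable borel" and J: "finite J" "J \<subseteq> I" "\<And>i. i \<in> I - J \<Longrightarrow> f (x i) = 0"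
  shows "laplace f (atoms I x) = (\<Prod>i\<in>J. exp (- f (x i)))"
proof -
  have fin: "finite {i\<in>I. f (x i) \<noteq> 0}" by (rule finite_subset[OF _ J(1)]) (use J(3) in blast)
  have "(\<integral>y. f y \<partial>atoms I x) = (\<integral>i. f (x i) \<partial>count_space I)"
    unfolding atoms_def by (rule integral_distr) (use f in auto)
  also have "\<dots> = (\<Sum>i | i \<in> I \<and> f (x i) \<noteq> 0. f (x i))"
    by (rule lebesgue_integral_count_space_finite_support[OF fin])
  also have "\<dots> = (\<Sum>i\<in>J. f (x i))"
    by (rule sum.mono_neutral_left[OF J(1)]) (use J in auto)
  finally show ?thesis by (simp add: laplace_def exp_sum[OF J(1)] sum_negf[symmetric])
qed

lemma add_measure_radon:
  "\<mu> \<in> radon_measures \<Longrightarrow> \<nu> \<in> radon_measures \<Longrightarrow> add_measure \<mu> \<nu> \<in> radon_measures"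
  by (auto simp: radon_measures_def emeasure_add_measure less_top)

text \<open>\<open>sum_encode\<close> places disjoint copies of the two index sets inside the
  natural numbers.\<close>

lemma add_measure_counting:
  assumes "\<mu> \<in> counting_measures" "\<nu> \<in> counting_measures"
  shows "add_measure \<mu> \<nu> \<in> counting_measures"
proof -
  obtain I x J y where \<mu>: "\<mu> = atoms I x" and \<nu>: "\<nu> = atoms J y"
    using assms unfolding counting_measures_def by blast
  define K where "K = sum_encode ` (Inl ` I \<union> Inr ` J)"
  define z where "z k = (case sum_decode k of Inl i \<Rightarrow> x i | Inr j \<Rightarrow> y j)" for k
  have "add_measure \<mu> \<nu> = atoms K z"
  proof (rule measure_eqI)
    show "sets (add_measure \<mu> \<nu>) = sets (atoms K z)" by (simp add: \<mu>)
    fix B assume "B \<in> sets (add_measure \<mu> \<nu>)"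
    then have B: "B \<in> sets borel" by (simp add: \<mu>)
    let ?I = "{i\<in>I. x i \<in> B}" and ?J = "{j\<in>J. y j \<in> B}"
    have eq: "{k\<in>K. z k \<in> B} = (sum_encode \<circ> Inl) ` ?I \<union> (sum_encode \<circ> Inr) ` ?J"
      by (auto simp: K_def z_def)
    have iI: "inj_on (sum_encode \<circ> Inl) ?I" and iJ: "inj_on (sum_encode \<circ> Inr) ?J"
      by (auto simp: inj_on_def dest: injD[OF inj_sum_encode])
    have dis: "(sum_encode \<circ> Inl) ` ?I \<inter> (sum_encode \<circ> Inr) ` ?J = {}"
      by (auto dest: injD[OF inj_sum_encode])
    show "emeasure (add_measure \<mu> \<nu>) B = emeasure (atoms K z) B"
    proof (cases "finite ?I \<and> finite ?J")
      case True
      then have "card {k\<in>K. z k \<in> B} = card ?I + card ?J"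
        unfolding eq using card_Un_disjoint[OF _ _ dis]
        by (simp only: card_image[OF iI] card_image[OF iJ] finite_imageI simp_thms)
      then show ?thesis using True B eq
        by (simp add: emeasure_add_measure \<mu> \<nu> emeasure_atoms_finite)
    next
      case False
      then have "infinite {k\<in>K. z k \<in> B}" unfolding eq finite_Un finite_image_iff[OF iI] finite_image_iff[OF iJ] by blast
      then show ?thesis using False B
        by (auto simp: emeasure_add_measure \<mu> \<nu> emeasure_atoms emeasure_count_space_infinite)
    qed
  qed
  moreover have "add_measure \<mu> \<nu> \<in> radon_measures"
    using assms by (intro add_measure_radon) (auto simp: counting_measures_def)
  ultimately show ?thesis by (auto simp: counting_measures_def)
qed

lemma nn_integral_add_measure:
  assumes s: "sets \<nu> = sets \<mu>" and f: "f \<in> borel_measurable \<mu>"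
  shows "(\<integral>\<^sup>+x. f x \<partial>add_measure \<mu> \<nu>) = (\<integral>\<^sup>+x. f x \<partial>\<mu>) + (\<integral>\<^sup>+x. f x \<partial>\<nu>)"
  using f
proof (induction rule: borel_measurable_induct)
  case (cong f g)
  have "space \<nu> = space \<mu>" by (rule sets_eq_imp_space_eq[OF s])
  then have "(\<integral>\<^sup>+x. g x \<partial>R) = (\<integral>\<^sup>+x. f x \<partial>R)" if "R \<in> {\<mu>, \<nu>, add_measure \<mu> \<nu>}" for R
    using that cong by (intro nn_integral_cong) auto
  then show ?case using cong by simp
next
  case (set A)
  then show ?case using s by (simp add: emeasure_add_measure)
next
  case (mult f c)
  then show ?case using s
    by (simp add: nn_integral_cmult distrib_left measurable_cong_sets[OF s refl] measurable_cong_sets[of "add_measure \<mu> \<nu>" \<mu>])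
next
  case (add f g)
  then show ?case using s
    by (simp add: nn_integral_add ac_simps measurable_cong_sets[OF s refl] measurable_cong_sets[of "add_measure \<mu> \<nu>" \<mu>])
next
  case (seq F)
  have m: "F i \<in> borel_measurable \<mu>" "F i \<in> borel_measurable \<nu>" "F i \<in> borel_measurable (add_measure \<mu> \<nu>)" for i
    using seq(1) s by (auto simp: measurable_cong_sets[OF s refl] measurable_cong_sets[of "add_measure \<mu> \<nu>" \<mu>])
  have inc: "incseq (\<lambda>i. \<integral>\<^sup>+x. F i x \<partial>R)" for R
    using seq(3) by (intro monoI nn_integral_mono) (auto simp: incseq_def le_fun_def)
  have e: "(\<integral>\<^sup>+x. (SUP i. F i) x \<partial>R) = (SUP i. \<integral>\<^sup>+x. F i x \<partial>R)" if "\<And>i. F i \<in> borel_measurable R" for R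
    unfolding SUP_apply by (rule nn_integral_monotone_convergence_SUP[OF seq(3) that])
  show ?case
    unfolding e[OF m(1)] e[OF m(2)] e[OF m(3)] using seq.IH ennreal_SUP_add[OF inc inc] by simp
qed

lemma laplace_add_measure:
  fixes f :: "'a \<Rightarrow> real"
  assumes s: "sets \<nu> = sets \<mu>" and f: "integrable \<mu> f" "integrable \<nu> f" "\<And>x. 0 \<le> f x"
  shows "laplace f (add_measure \<mu> \<nu>) = laplace f \<mu> * laplace f \<nu>"
proof -
  have fm: "f \<in> borel_measurable \<mu>" using f by auto
  then have fa: "f \<in> borel_measurable (add_measure \<mu> \<nu>)"
    by (simp add: measurable_cong_sets[of "add_measure \<mu> \<nu>" \<mu>])
  have "(\<integral>\<^sup>+x. ennreal (f x) \<partial>add_measure \<mu> \<nu>) = ennreal (\<integral>x. f x \<partial>\<mu>) + ennreal (\<integral>x. f x \<partial>\<nu>)"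
    using fm f by (subst nn_integral_add_measure[OF s]) (auto simp: nn_integral_eq_integral)
  also have "\<dots> = ennreal ((\<integral>x. f x \<partial>\<mu>) + (\<integral>x. f x \<partial>\<nu>))"
    using f(3) by (intro ennreal_plus[symmetric]) (auto intro!: Bochner_Integration.integral_nonneg)
  finally have N: "(\<integral>\<^sup>+x. ennreal (f x) \<partial>add_measure \<mu> \<nu>) = ennreal ((\<integral>x. f x \<partial>\<mu>) + (\<integral>x. f x \<partial>\<nu>))" .
  have "(\<integral>x. f x \<partial>add_measure \<mu> \<nu>) = enn2real (\<integral>\<^sup>+x. ennreal (f x) \<partial>add_measure \<mu> \<nu>)"
    by (rule integral_eq_nn_integral) (use f(3) fa in auto)
  also have "\<dots> = (\<integral>x. f x \<partial>\<mu>) + (\<integral>x. f x \<partial>\<nu>)"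
    unfolding N using f(3) by (intro enn2real_ennreal add_nonneg_nonneg Bochner_Integration.integral_nonneg)
  finally have "(\<integral>x. f x \<partial>add_measure \<mu> \<nu>) = (\<integral>x. f x \<partial>\<mu>) + (\<integral>x. f x \<partial>\<nu>)" .
  then show ?thesis by (simp add: laplace_def exp_add[symmetric])
qed

lemma scale_measure_eq_density: "scale_measure r M = density M (\<lambda>_. r)"
  by (rule measure_eqI) (auto simp: emeasure_density nn_integral_cmult_indicator)

lemma laplace_scale_measure:
  assumes "0 \<le> c" "integrable \<mu> f"
  shows "laplace f (scale_measure (ennreal c) \<mu>) = laplace (\<lambda>x. c * f x) \<mu>"
    and "integrable (scale_measure (ennreal c) \<mu>) f"
proof -
  have [measurable]: "f \<in> borel_measurable \<mu>" using assms by auto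
  show "laplace f (scale_measure (ennreal c) \<mu>) = laplace (\<lambda>x. c * f x) \<mu>"
    unfolding laplace_def scale_measure_eq_density using assms(1) by (subst integral_density) auto
  show "integrable (scale_measure (ennreal c) \<mu>) f"
    unfolding scale_measure_eq_density using assms by (subst integrable_density) auto
qed

lemma integral_pair_mult:
  fixes g :: "'b \<Rightarrow> real" and h :: "'c \<Rightarrow> real"
  assumes P: "prob_space P" and Q: "prob_space Q"
    and g: "g \<in> borel_measurable P" "\<And>x. \<bar>g x\<bar> \<le> 1" and h: "h \<in> borel_measurable Q" "\<And>x. \<bar>h x\<bar> \<le> 1"
  shows "(\<integral>(x, y). g x * h y \<partial>(P \<Otimes>\<^sub>M Q)) = (\<integral>x. g x \<partial>P) * (\<integral>y. h y \<partial>Q)"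
proof -
  interpret P: prob_space P by fact
  interpret Q: prob_space Q by fact
  interpret PQ: pair_prob_space P Q ..
  note [measurable] = g(1) h(1)
  have "\<bar>g (fst z) * h (snd z)\<bar> \<le> 1" for z
    unfolding abs_mult using g(2)[of "fst z"] h(2)[of "snd z"] by (simp add: mult_le_one)
  then have "integrable (P \<Otimes>\<^sub>M Q) (\<lambda>z. g (fst z) * h (snd z))"
    by (intro PQ.P.integrable_const_bound[where B=1] AE_I2) auto
  then have "integrable (P \<Otimes>\<^sub>M Q) (\<lambda>(x, y). g x * h y)" by (simp add: split_beta')
  from PQ.integral_fst[OF this] show ?thesis by simp
qed

context relatively_compact_base
begin

lemma restrict_counting: "counting_algebra = restrict_space radon_algebra counting_measures"
  by (simp add: counting_algebra_def)

lemma restrict_radon: "restrict_space radon_algebra radon_measures = (radon_algebra :: 'a measure measure)"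
  by (intro measure_eqI) (auto simp: sets_restrict_space space_radon_algebra[symmetric] emeasure_restrict_space
      dest: sets.sets_into_space intro!: image_eqI)

lemma counting_subset: "counting_measures \<subseteq> radon_measures"
  by (auto simp: counting_measures_def)

lemma atoms_tests_finite:
  assumes "atoms I x \<in> radon_measures" "f \<in> tests"
  shows "finite {i\<in>I. f (x i) \<noteq> 0}"
proof -
  obtain n where n: "\<forall>x. f x \<noteq> 0 \<longrightarrow> x \<in> (\<Union>i<n. U i)" using tests_support[OF assms(2)] by blast
  have "finite {i\<in>I. x i \<in> (\<Union>i<n. U i)}"
    by (rule finite_atoms[OF assms(1) _ relatively_compact_U]) measurable
  then show ?thesis by (rule rev_finite_subset) (use n in auto)
qed

lemma laplace_restrict_counting: "f \<in> tests \<Longrightarrow> laplace f \<in> borel_measurable counting_algebra"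
  unfolding restrict_counting by (rule laplace_restrict_measurable)

section \<open>Thinning and its Laplace functional\<close>

text \<open>A point at \<open>x\<close> survives with probability \<open>p\<close>, so its mean
  factor in the Laplace functional is \<open>1 - p + p * exp (- f x)\<close>; the new test is minus
  the logarithm of this.\<close>

definition thin :: "real \<Rightarrow> ('a \<Rightarrow> real) \<Rightarrow> 'a \<Rightarrow> real" where
  "thin p f = (\<lambda>x. - ln (1 - p + p * exp (- f x)))"

lemma thin_pos:
  assumes "p \<in> {0..1}" shows "0 < 1 - p + p * exp (- u :: real)"
  using assms by (cases "p = 1") (auto intro: add_pos_nonneg)

lemma tests_thin:
  assumes f: "f \<in> tests" and p: "p \<in> {0..1}" shows "thin p f \<in> tests"
  unfolding thin_def
proof (rule tests_comp[OF f, where u="\<lambda>u. - ln (1 - p + p * exp (- u))"])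
  fix x
  have "1 - p + p * exp (- f x) \<le> 1 - p + p * 1"
    using p tests_nonneg[OF f, of x] by (intro add_left_mono mult_left_mono) auto
  then show "0 \<le> - ln (1 - p + p * exp (- f x))" using thin_pos[OF p, of "f x"] by simp
qed simp

text \<open>The marks are independent and a test vanishes at all but finitely many points, so the
  expectation is a finite product of Bernoulli means. The result mentions \<open>\<phi>\<close>
  only, whatever enumeration was chosen.\<close>

lemma thin_law_props:
  assumes \<phi>: "\<phi> \<in> counting_measures" and p: "p \<in> {0..1}"
  shows "prob_space (thin_law p \<phi>)" "sets (thin_law p \<phi>) = sets counting_algebra"
    and "\<And>f. f \<in> tests \<Longrightarrow> (\<integral>\<psi>. laplace f \<psi> \<partial>thin_law p \<phi>) = laplace (thin p f) \<phi>"
proof -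
  obtain I x where enum: "enumeration \<phi> = (I, x)" by (cases "enumeration \<phi>")
  have "\<exists>z. case z of (I, x) \<Rightarrow> \<phi> = atoms I x" using \<phi> by (auto simp: counting_measures_def)
  from someI_ex[OF this] have \<phi>_eq: "\<phi> = atoms I x" using enum by (simp add: enumeration_def)
  have radon: "atoms I x \<in> radon_measures" using \<phi> \<phi>_eq by (simp add: counting_measures_def)
  let ?P = "\<Pi>\<^sub>M i\<in>I. measure_pmf (bernoulli_pmf p)" and ?A = "\<lambda>b. atoms {i\<in>I. b i} x"
  have thin: "thin_law p \<phi> = distr ?P counting_algebra ?A" by (simp add: thin_law_def enum)
  have A: "?A b \<in> counting_measures" for b
  proof (intro atoms_counting atoms_radonI)
    fix B :: "'a set" assume "B \<in> sets borel" "relatively_compact B"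
    from finite_atoms[OF radon this] show "finite {i\<in>{i\<in>I. b i}. x i \<in> B}" by (rule rev_finite_subset) auto
  qed
  have meas: "?A \<in> ?P \<rightarrow>\<^sub>M counting_algebra"
    unfolding restrict_counting
  proof (rule measurable_restrict_space2)
    show "?A \<in> ?P \<rightarrow>\<^sub>M radon_algebra"
    proof (rule measurable_radonI)
      show "?A b \<in> radon_measures" for b using A counting_subset by blast
      fix n and S :: "nat set" assume "S \<noteq> {}"
      then have fin: "finite {i\<in>I. x i \<in> cyl n S}"
        by (intro finite_atoms[OF radon] relatively_compact_cyl cyl_borel)
      have "emeasure (?A b) (cyl n S) = (\<Sum>i\<in>{i\<in>I. x i \<in> cyl n S}. if b i then 1 else 0)" for b
      proof -
        have eq: "{i\<in>{i\<in>I. b i}. x i \<in> cyl n S} = {i\<in>{i\<in>I. x i \<in> cyl n S}. b i}" by auto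
        have fin2: "finite {i\<in>{i\<in>I. b i}. x i \<in> cyl n S}" by (rule rev_finite_subset[OF fin]) auto
        then have "finite {i\<in>{i\<in>I. x i \<in> cyl n S}. b i}" unfolding eq .
        then show ?thesis
          unfolding emeasure_atoms_finite[OF cyl_borel fin2] eq sum.If_cases[OF fin] Int_def by simp
      qed
      moreover have "(\<lambda>b. \<Sum>i\<in>{i\<in>I. x i \<in> cyl n S}. if b i then 1 else 0 :: ennreal) \<in> borel_measurable ?P"
        by (intro borel_measurable_sum measurable_If) (auto simp: pred_def[symmetric] intro!: measurable_compose[OF measurable_component_singleton])
      ultimately show "(\<lambda>b. emeasure (?A b) (cyl n S)) \<in> borel_measurable ?P" by simp
    qed
  qed (use A in auto)
  have "prob_space ?P" by (intro prob_space_PiM prob_space_measure_pmf)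
  then show "prob_space (thin_law p \<phi>)" unfolding thin using meas by (rule prob_space.prob_space_distr)
  show "sets (thin_law p \<phi>) = sets counting_algebra" by (simp add: thin)
  fix f assume f: "f \<in> tests"
  let ?J = "{i\<in>I. f (x i) \<noteq> 0}"
  have J: "finite ?J" by (rule atoms_tests_finite[OF radon f])
  have "(\<integral>\<psi>. laplace f \<psi> \<partial>thin_law p \<phi>) = (\<integral>b. laplace f (?A b) \<partial>?P)"
    unfolding thin by (rule integral_distr[OF meas laplace_restrict_counting[OF f]])
  also have "\<dots> = (\<integral>b. (\<Prod>i\<in>?J. if b i then exp (- f (x i)) else 1) \<partial>?P)"
  proof (rule Bochner_Integration.integral_cong[OF refl])
    fix b
    have "laplace f (?A b) = (\<Prod>i\<in>{i\<in>?J. b i}. exp (- f (x i)))"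
      by (rule laplace_atoms[OF tests_borel[OF f] rev_finite_subset[OF J]]) auto
    also have "\<dots> = (\<Prod>i\<in>?J. if b i then exp (- f (x i)) else 1)"
      by (rule prod.inter_filter[OF J])
    finally show "laplace f (?A b) = (\<Prod>i\<in>?J. if b i then exp (- f (x i)) else 1)" .
  qed
  also have "\<dots> = (\<Prod>i\<in>?J. \<integral>c. (if c then exp (- f (x i)) else 1) \<partial>measure_pmf (bernoulli_pmf p))"
    using J tests_nonneg[OF f]
    by (intro integral_PiM_prod[where C=1] prob_space_measure_pmf) auto
  also have "\<dots> = (\<Prod>i\<in>?J. exp (- thin p f (x i)))"
    using p thin_pos[OF p] by (intro prod.cong) (auto simp: thin_def add.commute)
  also have "\<dots> = laplace (thin p f) \<phi>"
    unfolding \<phi>_eq by (rule laplace_atoms[symmetric, OF tests_borel[OF tests_thin[OF f p]] J])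
      (auto simp: thin_def)
  finally show "(\<integral>\<psi>. laplace f \<psi> \<partial>thin_law p \<phi>) = laplace (thin p f) \<phi>" .
qed

text \<open>The enumeration is picked by \<open>SOME\<close> for each measure separately, so its
  dependence on the measure is not under control. The Laplace functional of the thinned law is
  nevertheless the measurable function \<open>laplace (thin p f)\<close>, and that suffices.\<close>

lemma thin_law_kernel:
  assumes p: "p \<in> {0..1}"
  shows "thin_law p \<in> counting_algebra \<rightarrow>\<^sub>M prob_algebra (counting_algebra :: 'a measure measure)"
  unfolding restrict_counting
proof (rule measurable_laplace_kernel[OF counting_subset], unfold restrict_counting[symmetric] space_counting_algebra)
  show "prob_space (thin_law p \<mu>)" "sets (thin_law p \<mu>) = sets counting_algebra"
    if "\<mu> \<in> counting_measures" for \<mu> :: "'a measure" using thin_law_props[OF that p] by auto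
  fix f assume f: "f \<in> tests"
  show "(\<lambda>\<mu>. \<integral>\<phi>. laplace f \<phi> \<partial>thin_law p \<mu>) \<in> borel_measurable counting_algebra"
    using laplace_restrict_counting[OF tests_thin[OF f p]]
    by (rule measurable_cong[THEN iffD1, rotated]) (simp add: space_counting_algebra thin_law_props(3)[OF _ p f])
qed

lemma thinned_law_props:
  assumes M: "prob_space M" and \<Phi>: "\<Phi> \<in> M \<rightarrow>\<^sub>M counting_algebra" and p: "p \<in> {0..1}"
  shows "prob_space (thinned_law p M \<Phi>)" "sets (thinned_law p M \<Phi>) = sets counting_algebra"
    and "\<And>f. f \<in> tests \<Longrightarrow> (\<integral>\<psi>. laplace f \<psi> \<partial>thinned_law p M \<Phi>)
      = (\<integral>\<phi>. laplace (thin p f) \<phi> \<partial>distr M counting_algebra \<Phi>)"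
proof -
  let ?P = "distr M counting_algebra \<Phi>"
  have P: "prob_space ?P" by (rule prob_space.prob_space_distr[OF M \<Phi>])
  have K: "thin_law p \<in> ?P \<rightarrow>\<^sub>M prob_algebra counting_algebra" using thin_law_kernel[OF p] by simp
  have l01: "laplace f x \<in> {0..1}" if "f \<in> tests" for f x
    using laplace_01[of f x] tests_nonneg[OF that] by auto
  show "prob_space (thinned_law p M \<Phi>)" "sets (thinned_law p M \<Phi>) = sets counting_algebra"
    unfolding thinned_law_def
    using integral_bind_bounded(3,4)[OF P K laplace_restrict_counting[OF tests_zero] l01[OF tests_zero]] by auto
  fix f assume f: "f \<in> tests"
  have "(\<integral>\<psi>. laplace f \<psi> \<partial>thinned_law p M \<Phi>) = (\<integral>\<phi>. (\<integral>\<psi>. laplace f \<psi> \<partial>thin_law p \<phi>) \<partial>?P)"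
    unfolding thinned_law_def
    by (rule integral_bind_bounded(1)[OF P K laplace_restrict_counting[OF f] l01[OF f]])
  also have "\<dots> = (\<integral>\<phi>. laplace (thin p f) \<phi> \<partial>?P)"
    by (rule Bochner_Integration.integral_cong[OF refl]) (simp add: space_counting_algebra thin_law_props(3)[OF _ p f])
  finally show "(\<integral>\<psi>. laplace f \<psi> \<partial>thinned_law p M \<Phi>) = (\<integral>\<phi>. laplace (thin p f) \<phi> \<partial>?P)" .
qed

lemma laplace_le_1: "f \<in> tests \<Longrightarrow> \<bar>laplace f x\<bar> \<le> 1"
  using laplace_01[of f x] tests_nonneg[of f] by auto

lemma measurable_add_counting:
  "(\<lambda>(\<mu>, \<nu>). add_measure \<mu> \<nu>) \<in> counting_algebra \<Otimes>\<^sub>M counting_algebra \<rightarrow>\<^sub>M (counting_algebra :: 'a measure measure)"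
  unfolding restrict_counting
proof (rule measurable_restrict_space2)
  let ?R = "restrict_space radon_algebra counting_measures :: 'a measure measure"
  have sp: "space ?R = counting_measures" by (rule space_restrict_radon[OF counting_subset])
  show "(\<lambda>(\<mu>, \<nu>). add_measure \<mu> \<nu>) \<in> space (?R \<Otimes>\<^sub>M ?R) \<rightarrow> counting_measures"
    by (auto simp: space_pair_measure sp add_measure_counting)
  show "(\<lambda>(\<mu>, \<nu>). add_measure \<mu> \<nu>) \<in> ?R \<Otimes>\<^sub>M ?R \<rightarrow>\<^sub>M radon_algebra"
  proof (rule measurable_radonI)
    show "(case p of (\<mu>, \<nu>) \<Rightarrow> add_measure \<mu> \<nu>) \<in> radon_measures" if "p \<in> space (?R \<Otimes>\<^sub>M ?R)" for p
      using that counting_subset by (auto simp: space_pair_measure sp intro!: add_measure_radon)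
    fix n and S :: "nat set"
    have [measurable]: "(\<lambda>\<mu>. emeasure \<mu> (cyl n S)) \<in> borel_measurable ?R"
      by (intro measurable_restrict_space1 measurable_emeasure_radon cyl_borel)
    have "(\<lambda>p. emeasure (fst p) (cyl n S) + emeasure (snd p) (cyl n S)) \<in> borel_measurable (?R \<Otimes>\<^sub>M ?R)"
      by measurable
    then show "(\<lambda>p. emeasure (case p of (\<mu>, \<nu>) \<Rightarrow> add_measure \<mu> \<nu>) (cyl n S)) \<in> borel_measurable (?R \<Otimes>\<^sub>M ?R)"
    proof (rule measurable_cong[THEN iffD1, rotated])
      fix p assume "p \<in> space (?R \<Otimes>\<^sub>M ?R)"
      then have "sets (fst p) = sets borel" "sets (snd p) = sets borel"
        using counting_subset by (auto simp: space_pair_measure sp intro!: radon_sets)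
      then show "emeasure (fst p) (cyl n S) + emeasure (snd p) (cyl n S)
          = emeasure (case p of (\<mu>, \<nu>) \<Rightarrow> add_measure \<mu> \<nu>) (cyl n S)"
        by (simp add: split_beta' emeasure_add_measure)
    qed
  qed
qed

section \<open>Stability as a functional equation\<close>

text \<open>Thinned laws and sums of independent copies are eliminated here: stability becomes an
  identity between numbers, one for each \<open>t\<close> and each test.\<close>

lemma discrete_stable_iff:
  assumes \<Phi>: "point_process M \<Phi>" and \<alpha>: "0 < \<alpha>"
  shows "discrete_stable \<alpha> M \<Phi> \<longleftrightarrow> (\<forall>t\<in>{0..1}. \<forall>f\<in>tests.
    (\<integral>\<omega>. laplace (thin (t powr (1 / \<alpha>)) f) (\<Phi> \<omega>) \<partial>M) * (\<integral>\<omega>. laplace (thin ((1 - t) powr (1 / \<alpha>)) f) (\<Phi> \<omega>) \<partial>M)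
    = (\<integral>\<omega>. laplace f (\<Phi> \<omega>) \<partial>M))" 
proof -
  have M: "prob_space M" and m: "\<Phi> \<in> M \<rightarrow>\<^sub>M counting_algebra"
    using \<Phi> by (auto simp: point_process_def random_measure_def counting_algebra_def intro!: measurable_restrict_space2)
  let ?P = "distr M counting_algebra \<Phi>"
  have P: "prob_space ?P" by (rule prob_space.prob_space_distr[OF M m])
  have LP: "(\<integral>\<phi>. laplace f \<phi> \<partial>?P) = (\<integral>\<omega>. laplace f (\<Phi> \<omega>) \<partial>M)" if "f \<in> tests" for f
    by (rule integral_distr[OF m laplace_restrict_counting[OF that]])
  have "distr (thinned_law p M \<Phi> \<Otimes>\<^sub>M thinned_law q M \<Phi>) counting_algebra (\<lambda>(\<phi>', \<phi>''). add_measure \<phi>' \<phi>'') = ?P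
    \<longleftrightarrow> (\<forall>f\<in>tests. (\<integral>\<omega>. laplace (thin p f) (\<Phi> \<omega>) \<partial>M) * (\<integral>\<omega>. laplace (thin q f) (\<Phi> \<omega>) \<partial>M) = (\<integral>\<omega>. laplace f (\<Phi> \<omega>) \<partial>M))"
    (is "?D = ?P \<longleftrightarrow> ?F") if p: "p \<in> {0..1}" and q: "q \<in> {0..1}" for p q
  proof -
    note tp = thinned_law_props[OF M m p] and tq = thinned_law_props[OF M m q]
    let ?A = "thinned_law p M \<Phi>" and ?B = "thinned_law q M \<Phi>"
    interpret A: prob_space ?A by (rule tp)
    interpret B: prob_space ?B by (rule tq)
    interpret AB: pair_prob_space ?A ?B ..
    have add: "(\<lambda>(\<mu>, \<nu>). add_measure \<mu> \<nu>) \<in> ?A \<Otimes>\<^sub>M ?B \<rightarrow>\<^sub>M counting_algebra"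
      using measurable_add_counting measurable_cong_sets[OF sets_pair_measure_cong[OF tp(2) tq(2)] refl] by blast
    have D: "prob_space ?D" by (rule AB.P.prob_space_distr[OF add])
    have LD: "(\<integral>\<phi>. laplace f \<phi> \<partial>?D) = (\<integral>\<omega>. laplace (thin p f) (\<Phi> \<omega>) \<partial>M) * (\<integral>\<omega>. laplace (thin q f) (\<Phi> \<omega>) \<partial>M)"
      if f: "f \<in> tests" for f
    proof -
      have "(\<integral>\<phi>. laplace f \<phi> \<partial>?D) = (\<integral>z. laplace f (case z of (\<mu>, \<nu>) \<Rightarrow> add_measure \<mu> \<nu>) \<partial>(?A \<Otimes>\<^sub>M ?B))"
        by (rule integral_distr[OF add laplace_restrict_counting[OF f]])
      also have "\<dots> = (\<integral>(\<mu>, \<nu>). laplace f \<mu> * laplace f \<nu> \<partial>(?A \<Otimes>\<^sub>M ?B))"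
      proof (rule Bochner_Integration.integral_cong[OF refl])
        fix z assume "z \<in> space (?A \<Otimes>\<^sub>M ?B)"
        then obtain \<mu> \<nu> where z: "z = (\<mu>, \<nu>)" "\<mu> \<in> radon_measures" "\<nu> \<in> radon_measures"
          using counting_subset sets_eq_imp_space_eq[OF tp(2)] sets_eq_imp_space_eq[OF tq(2)]
          by (auto simp: space_pair_measure space_counting_algebra)
        show "laplace f (case z of (\<mu>, \<nu>) \<Rightarrow> add_measure \<mu> \<nu>) = (case z of (\<mu>, \<nu>) \<Rightarrow> laplace f \<mu> * laplace f \<nu>)"
          using z(2,3) f by (simp add: z(1) laplace_add_measure radon_sets tests_integrable tests_nonneg)
      qed
      also have "\<dots> = (\<integral>\<mu>. laplace f \<mu> \<partial>?A) * (\<integral>\<nu>. laplace f \<nu> \<partial>?B)"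
        using laplace_restrict_counting[OF f] measurable_cong_sets[OF tp(2) refl] measurable_cong_sets[OF tq(2) refl]
        by (intro integral_pair_mult A.prob_space_axioms B.prob_space_axioms laplace_le_1 f) blast+
      finally show ?thesis unfolding tp(3)[OF f] tq(3)[OF f] LP[OF tests_thin[OF f p]] LP[OF tests_thin[OF f q]] .
    qed
    show ?thesis
    proof
      assume "?D = ?P"
      then show ?F using LD LP by metis
    next
      assume F: ?F
      show "?D = ?P"
        by (rule laplace_eqI[OF counting_subset D P]) (use F LD LP in \<open>auto simp: restrict_counting\<close>)
    qed
  qed
  note eq = this
  have "t powr (1 / \<alpha>) \<in> {0..1}" "(1 - t) powr (1 / \<alpha>) \<in> {0..1}" if "t \<in> {0..1}" for t
    using that \<alpha> by (auto simp: powr_le1)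
  then show ?thesis unfolding discrete_stable_def using \<Phi> eq by simp
qed

text \<open>Scaling a measure amounts to scaling the test; this linear operation stands where
  \<open>thin\<close> stands for point processes.\<close>

lemma strictly_stable_iff:
  assumes M: "prob_space M" and m: "\<zeta> \<in> M \<rightarrow>\<^sub>M radon_algebra"
  shows "strictly_stable \<alpha> M \<zeta> \<longleftrightarrow> (\<forall>t\<in>{0..1}. \<forall>f\<in>tests.
    (\<integral>\<omega>. laplace (\<lambda>x. t powr (1 / \<alpha>) * f x) (\<zeta> \<omega>) \<partial>M) * (\<integral>\<omega>. laplace (\<lambda>x. (1 - t) powr (1 / \<alpha>) * f x) (\<zeta> \<omega>) \<partial>M)
    = (\<integral>\<omega>. laplace f (\<zeta> \<omega>) \<partial>M))"
proof -
  interpret prob_space M by fact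
  interpret MM: pair_prob_space M M ..
  let ?P = "distr M radon_algebra \<zeta>"
  have P: "prob_space ?P" by (rule prob_space_distr[OF m])
  have LP: "(\<integral>\<phi>. laplace f \<phi> \<partial>?P) = (\<integral>\<omega>. laplace f (\<zeta> \<omega>) \<partial>M)" if "f \<in> tests" for f
    by (rule integral_distr[OF m laplace_measurable[OF that]])
  have "distr (M \<Otimes>\<^sub>M M) radon_algebra
          (\<lambda>(\<omega>', \<omega>''). add_measure (scale_measure (ennreal a) (\<zeta> \<omega>')) (scale_measure (ennreal b) (\<zeta> \<omega>''))) = ?P
    \<longleftrightarrow> (\<forall>f\<in>tests. (\<integral>\<omega>. laplace (\<lambda>x. a * f x) (\<zeta> \<omega>) \<partial>M) * (\<integral>\<omega>. laplace (\<lambda>x. b * f x) (\<zeta> \<omega>) \<partial>M) = (\<integral>\<omega>. laplace f (\<zeta> \<omega>) \<partial>M))"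
    (is "distr _ _ ?S = ?P \<longleftrightarrow> ?F") if a: "0 \<le> a" and b: "0 \<le> b" for a b
  proof -
    have S: "?S \<in> M \<Otimes>\<^sub>M M \<rightarrow>\<^sub>M radon_algebra"
    proof -
      have "(\<lambda>z. (\<zeta> (fst z), \<zeta> (snd z))) \<in> M \<Otimes>\<^sub>M M \<rightarrow>\<^sub>M radon_algebra \<Otimes>\<^sub>M radon_algebra" using m by measurable
      from measurable_compose[OF this measurable_stable_combination[OF a b]] show ?thesis
        by (simp add: split_beta')
    qed
    let ?D = "distr (M \<Otimes>\<^sub>M M) radon_algebra ?S"
    have D: "prob_space ?D" by (rule MM.P.prob_space_distr[OF S])
    have LD: "(\<integral>\<phi>. laplace f \<phi> \<partial>?D) = (\<integral>\<omega>. laplace (\<lambda>x. a * f x) (\<zeta> \<omega>) \<partial>M) * (\<integral>\<omega>. laplace (\<lambda>x. b * f x) (\<zeta> \<omega>) \<partial>M)"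
      if f: "f \<in> tests" for f
    proof -
      have "(\<integral>\<phi>. laplace f \<phi> \<partial>?D) = (\<integral>z. laplace f (?S z) \<partial>(M \<Otimes>\<^sub>M M))"
        by (rule integral_distr[OF S laplace_measurable[OF f]])
      also have "\<dots> = (\<integral>(\<omega>', \<omega>''). laplace (\<lambda>x. a * f x) (\<zeta> \<omega>') * laplace (\<lambda>x. b * f x) (\<zeta> \<omega>'') \<partial>(M \<Otimes>\<^sub>M M))"
      proof (rule Bochner_Integration.integral_cong[OF refl])
        fix z assume "z \<in> space (M \<Otimes>\<^sub>M M)"
        then have z: "\<zeta> (fst z) \<in> radon_measures" "\<zeta> (snd z) \<in> radon_measures"
          using measurable_space[OF m] by (auto simp: space_pair_measure space_radon_algebra)
        note sc = laplace_scale_measure[OF _ tests_integrable[OF z(1) f]] laplace_scale_measure[OF _ tests_integrable[OF z(2) f]]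
        show "laplace f (?S z) = (case z of (\<omega>', \<omega>'') \<Rightarrow> laplace (\<lambda>x. a * f x) (\<zeta> \<omega>') * laplace (\<lambda>x. b * f x) (\<zeta> \<omega>''))"
          using z a b by (simp add: split_beta' laplace_add_measure radon_sets sc tests_nonneg[OF f])
      qed
      also have "\<dots> = (\<integral>\<omega>. laplace (\<lambda>x. a * f x) (\<zeta> \<omega>) \<partial>M) * (\<integral>\<omega>. laplace (\<lambda>x. b * f x) (\<zeta> \<omega>) \<partial>M)"
        using a b by (intro integral_pair_mult prob_space_axioms laplace_le_1 tests_cmult f
          measurable_compose[OF m] laplace_measurable)
      finally show ?thesis .
    qed
    show ?thesis
    proof
      assume "?D = ?P"
      then show ?F using LD LP by metis
    next
      assume F: ?F
      show "?D = ?P"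
        by (rule laplace_eqI[OF order_refl D P]) (use F LD LP in \<open>auto simp: restrict_radon\<close>)
    qed
  qed
  then show ?thesis
    unfolding strictly_stable_def random_measure_def using M m by auto
qed

end

section \<open>Poisson processes\<close>

text \<open>Poisson weights sum to 1, so almost every point lies in some \<open>A k\<close>, and the
  integral is the Poisson generating function at \<open>c\<close>. Abstract events allow the use
  both for a mass function and for the counts of a random measure.\<close>

lemma poisson_generating:
  fixes h :: "'b \<Rightarrow> real" and m :: real
  assumes M: "prob_space M" and A: "\<And>k. A k \<in> sets M" "disjoint_family A"
    and P: "\<And>k. measure M (A k) = m ^ k / fact k * exp (- m)"
    and h: "h \<in> borel_measurable M" "\<And>x. x \<in> space M \<Longrightarrow> h x \<in> {0..1}"
    and c: "0 \<le> c" "\<And>k x. x \<in> A k \<Longrightarrow> h x = c ^ k" and m: "0 \<le> m"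
  shows "(\<integral>x. h x \<partial>M) = exp (- (m * (1 - c)))"
proof -
  interpret prob_space M by fact
  note [measurable] = A(1) h(1)
  have s: "(\<lambda>k. c ^ k * (m ^ k / fact k * exp (- m))) sums exp (- (m * (1 - c)))" for c
  proof -
    have "(\<lambda>k. exp (- m) * ((m * c) ^ k /\<^sub>R fact k)) sums (exp (- m) * exp (m * c))"
      by (intro sums_mult exp_converges)
    moreover have "exp (- m) * exp (m * c) = exp (- (m * (1 - c)))"
      by (simp add: exp_add[symmetric] algebra_simps)
    ultimately show ?thesis by (simp add: power_mult_distrib divide_inverse ac_simps)
  qed
  have "(\<lambda>k. emeasure M (A k)) sums emeasure M (\<Union>k. A k)"
    using A by (intro sums_emeasure) auto
  moreover have "(\<lambda>k. ennreal (m ^ k / fact k * exp (- m))) sums ennreal 1"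
    using s[of 1] m by (subst sums_ennreal) auto
  ultimately have "emeasure M (\<Union>k. A k) = 1"
    by (simp add: emeasure_eq_measure P sums_iff)
  then have ae: "AE x in M. x \<in> (\<Union>k. A k)"
    by (intro AE_in_set_eq_1[THEN iffD2]) (auto simp: emeasure_eq_measure)
  have "(\<integral>\<^sup>+x. ennreal (h x) \<partial>M) = (\<integral>\<^sup>+x. (\<Sum>k. ennreal (c ^ k) * indicator (A k) x) \<partial>M)"
  proof (rule nn_integral_cong_AE, use ae in \<open>rule AE_mp\<close>, rule AE_I2, rule impI)
    fix x assume "x \<in> (\<Union>k. A k)"
    then obtain j where j: "x \<in> A j" by auto
    have nj: "x \<notin> A k" if "k \<noteq> j" for k using A(2) j that by (auto simp: disjoint_family_on_def)
    have "(\<Sum>k. ennreal (c ^ k) * indicator (A k) x) = (\<Sum>k\<in>{j}. ennreal (c ^ k) * indicator (A k) x)"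
      by (rule suminf_finite) (auto simp: nj)
    then show "ennreal (h x) = (\<Sum>k. ennreal (c ^ k) * indicator (A k) x)" using j c(2) by simp
  qed
  also have "\<dots> = (\<Sum>k. ennreal (c ^ k) * emeasure M (A k))"
    by (subst nn_integral_suminf) (auto simp: nn_integral_cmult_indicator)
  also have "\<dots> = (\<Sum>k. ennreal (c ^ k * (m ^ k / fact k * exp (- m))))"
  proof -
    have "ennreal (c ^ k) * emeasure M (A k) = ennreal (c ^ k * (m ^ k / fact k * exp (- m)))" for k
      unfolding emeasure_eq_measure P by (rule ennreal_mult[symmetric]) (use c(1) m in auto)
    then show ?thesis by simp
  qed
  also have "\<dots> = ennreal (exp (- (m * (1 - c))))"
    using s[of c] c(1) m by (intro suminf_ennreal_eq) auto
  finally have "ennreal (\<integral>x. h x \<partial>M) = ennreal (exp (- (m * (1 - c))))"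
    using h(2) by (subst (asm) nn_integral_eq_integral)
      (auto intro!: AE_I2 integrable_const_bound[where B=1])
  then show ?thesis using h(2) by (subst (asm) ennreal_inj) (auto intro!: Bochner_Integration.integral_nonneg)
qed

text \<open>The library leaves \<^const>\<open>poisson_pmf\<close> unspecified at rate \<open>0\<close>.\<close>

definition poisson0_pmf :: "real \<Rightarrow> nat pmf" where
  "poisson0_pmf m = (if m = 0 then return_pmf 0 else poisson_pmf m)"

lemma pmf_poisson0: "0 \<le> m \<Longrightarrow> pmf (poisson0_pmf m) k = m ^ k / fact k * exp (- m)"
  by (cases k) (auto simp: poisson0_pmf_def pmf_return)

lemma integral_poisson0:
  assumes "0 \<le> m" "c \<in> {0..1}"
  shows "(\<integral>k. c ^ k \<partial>measure_pmf (poisson0_pmf m)) = exp (- (m * (1 - c)))"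
  by (rule poisson_generating[where A="\<lambda>k. {k}"])
    (use assms in \<open>auto simp: disjoint_family_on_def pmf_poisson0 measure_pmf_single prob_space_measure_pmf power_le_one\<close>)

text \<open>An order-reversing Borel bijection of [0, \<infinity>] onto [0, 1]. Counts are extended
  reals and might a priori be infinite, while the uniqueness argument works with bounded
  functions.\<close>

definition exp_neg :: "ennreal \<Rightarrow> real" where
  "exp_neg y = (if y = \<infinity> then 0 else exp (- enn2real y))"

lemma exp_neg_measurable [measurable]: "exp_neg \<in> borel_measurable borel"
  unfolding exp_neg_def[abs_def] by measurable

lemma exp_neg_01: "exp_neg y \<in> {0..1}"
  by (auto simp: exp_neg_def)

text \<open>Uniqueness in the Hausdorff moment problem: monomials in the
  \<open>exp_neg (X i)\<close> are closed under products, and each \<open>X i\<close> can be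
  recovered from \<open>exp_neg (X i)\<close>. The hypothesis \<open>gen\<close> says that the
  \<open>X i\<close> generate the \<sigma>-algebra.\<close>

lemma measure_eqI_exp_neg:
  fixes X :: "'i \<Rightarrow> 'b \<Rightarrow> ennreal"
  assumes PQ: "prob_space P" "prob_space Q" "sets P = sets Q" and I: "finite I"
    and X: "\<And>i. i \<in> I \<Longrightarrow> X i \<in> borel_measurable Q"
    and gen: "\<And>N. space N = space Q \<Longrightarrow> (\<And>i. i \<in> I \<Longrightarrow> X i \<in> borel_measurable N) \<Longrightarrow> sets Q \<subseteq> sets N"
    and eq: "\<And>k :: 'i \<Rightarrow> nat. (\<integral>x. (\<Prod>i\<in>I. exp_neg (X i x) ^ k i) \<partial>P) = (\<integral>x. (\<Prod>i\<in>I. exp_neg (X i x) ^ k i) \<partial>Q)"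
  shows "P = Q"
proof (rule measure_eqI_multiplicative[OF PQ])
  define F where "F = range (\<lambda>(k :: 'i \<Rightarrow> nat) x. \<Prod>i\<in>I. exp_neg (X i x) ^ k i)"
  show "f \<in> borel_measurable Q" if "f \<in> F" for f
    using that X by (auto simp: F_def intro!: borel_measurable_prod borel_measurable_power
      measurable_compose[OF _ exp_neg_measurable])
  show "(\<lambda>x. f x * g x) \<in> F" if "f \<in> F" "g \<in> F" for f g
  proof -
    obtain k l where "f = (\<lambda>x. \<Prod>i\<in>I. exp_neg (X i x) ^ k i)" "g = (\<lambda>x. \<Prod>i\<in>I. exp_neg (X i x) ^ l i)"
      using \<open>f \<in> F\<close> \<open>g \<in> F\<close> unfolding F_def by blast
    then have "(\<lambda>x. f x * g x) = (\<lambda>x. \<Prod>i\<in>I. exp_neg (X i x) ^ (k i + l i))"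
      by (simp add: power_add prod.distrib)
    then show ?thesis unfolding F_def by (intro image_eqI[where x="\<lambda>i. k i + l i"]) auto
  qed
  show "(\<lambda>_. 1) \<in> F" unfolding F_def by (intro image_eqI[where x="\<lambda>_. 0"]) auto
  show "f x \<in> {0..1}" if "f \<in> F" for f x
  proof -
    have "0 \<le> exp_neg (X i x) ^ k \<and> exp_neg (X i x) ^ k \<le> 1" for i k
      using exp_neg_01[of "X i x"] by (auto simp: power_le_one)
    then show ?thesis using that by (auto simp: F_def intro!: prod_nonneg prod_le_1)
  qed
  show "(\<integral>x. f x \<partial>P) = (\<integral>x. f x \<partial>Q)" if "f \<in> F" for f using that eq by (auto simp: F_def)
  let ?G = "{{x\<in>space Q. f x > a} |f a. f \<in> F}"
  have G: "?G \<subseteq> Pow (space Q)" by auto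
  define N where "N = sigma (space Q) ?G"
  have sN: "space N = space Q" "sets N = sigma_sets (space Q) ?G"
    unfolding N_def by (rule space_measure_of[OF G], rule sets_measure_of[OF G])
  have "X i \<in> borel_measurable N" if i: "i \<in> I" for i
  proof -
    have "(\<lambda>x. \<Prod>j\<in>I. exp_neg (X j x) ^ (if j = i then 1 else 0)) \<in> F"
      unfolding F_def by (intro image_eqI[where x="\<lambda>j. if j = i then 1 else 0"]) auto
    also have "(\<lambda>x. \<Prod>j\<in>I. exp_neg (X j x) ^ (if j = i then 1 else 0)) = (\<lambda>x. exp_neg (X i x))"
    proof
      fix x
      have "(\<Prod>j\<in>I. exp_neg (X j x) ^ (if j = i then 1 else 0)) = (\<Prod>j\<in>I. if j = i then exp_neg (X j x) else 1)"
        by (rule prod.cong) auto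
      also have "\<dots> = exp_neg (X i x)" using I i by simp
      finally show "(\<Prod>j\<in>I. exp_neg (X j x) ^ (if j = i then 1 else 0)) = exp_neg (X i x)" .
    qed
    finally have F: "(\<lambda>x. exp_neg (X i x)) \<in> F" .
    have [measurable]: "(\<lambda>x. exp_neg (X i x)) \<in> borel_measurable N"
    proof (rule borel_measurableI_greater)
      fix y
      have "{x\<in>space Q. exp_neg (X i x) > y} \<in> ?G"
        by (intro CollectI exI[of _ "\<lambda>x. exp_neg (X i x)"] exI[of _ y]) (simp add: F)
      then show "{x\<in>space N. exp_neg (X i x) > y} \<in> sets N" unfolding sN by (rule sigma_sets.Basic)
    qed
    \<comment> \<open>The inverse of \<open>exp_neg\<close>; the value 0 is taken at \<infinity>
      only and is treated apart from the logarithm.\<close>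
    have "(\<lambda>x. if exp_neg (X i x) = 0 then \<infinity> else ennreal (- ln (exp_neg (X i x)))) \<in> borel_measurable N"
      by measurable
    also have "(\<lambda>x. if exp_neg (X i x) = 0 then \<infinity> else ennreal (- ln (exp_neg (X i x)))) = X i"
      by (auto simp: exp_neg_def less_top)
    finally show ?thesis .
  qed
  from gen[OF sN(1) this] show "sets Q \<subseteq> sigma_sets (space Q) ?G" by (simp add: sN)
qed

text \<open>Mixed moments that factorise identify the joint law with the product of the
  marginals.\<close>

lemma (in prob_space) indep_vars_exp_neg:
  fixes X :: "'i \<Rightarrow> 'a \<Rightarrow> ennreal"
  assumes I: "finite I" and X [measurable]: "\<And>i. i \<in> I \<Longrightarrow> X i \<in> borel_measurable M"
    and eq: "\<And>k :: 'i \<Rightarrow> nat. (\<integral>x. (\<Prod>i\<in>I. exp_neg (X i x) ^ k i) \<partial>M) = (\<Prod>i\<in>I. \<integral>x. exp_neg (X i x) ^ k i \<partial>M)"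
  shows "indep_vars (\<lambda>_. borel) X I"
proof (cases "I = {}")
  case True
  then show ?thesis by (simp add: indep_vars_def2 indep_sets_def)
next
  case False
  let ?P = "PiM I (\<lambda>_. borel :: ennreal measure)" and ?D = "\<lambda>i. distr M borel (X i)"
  \<comment> \<open>Point masses outside \<open>I\<close> make \<open>D\<close> a family of
    probability spaces over the whole index type, as \<open>integral_PiM_prod\<close> demands; the
    product over \<open>I\<close> is unaffected.\<close>
  define D where "D i = (if i \<in> I then ?D i else return borel 0)" for i
  have D: "prob_space (D i)" for i
    unfolding D_def by (auto intro!: prob_space_distr prob_space_return)
  have sD: "sets (D i) = sets borel" for i by (simp add: D_def)
  have PD: "PiM I ?D = PiM I D" by (rule PiM_cong) (auto simp: D_def)
  have sets: "sets (PiM I D) = sets ?P" by (rule sets_PiM_cong) (auto simp: sD)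
  have [measurable]: "(\<lambda>x. \<lambda>i\<in>I. X i x) \<in> M \<rightarrow>\<^sub>M ?P" by (rule measurable_restrict) simp
  have "distr M ?P (\<lambda>x. \<lambda>i\<in>I. X i x) = PiM I D"
  proof (rule measure_eqI_exp_neg[where I=I and X="\<lambda>i x. x i"])
    show "prob_space (distr M ?P (\<lambda>x. \<lambda>i\<in>I. X i x))" by (rule prob_space_distr) measurable
    show "prob_space (PiM I D)" by (intro prob_space_PiM D)
    show "sets (distr M ?P (\<lambda>x. \<lambda>i\<in>I. X i x)) = sets (PiM I D)" by (simp add: sets)
    show "finite I" by (rule I)
    show "(\<lambda>x. x i) \<in> borel_measurable (PiM I D)" if "i \<in> I" for i
      unfolding measurable_cong_sets[OF sets refl] using that by (rule measurable_component_singleton)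
    show "sets (PiM I D) \<subseteq> sets N"
      if sp: "space N = space (PiM I D)" and m: "\<And>i. i \<in> I \<Longrightarrow> (\<lambda>x. x i) \<in> borel_measurable N" for N
    proof
      fix A assume A: "A \<in> sets (PiM I D)"
      have spP: "space N = space ?P" using sp sets_eq_imp_space_eq[OF sets] by simp
      have "(\<lambda>x. x) \<in> N \<rightarrow>\<^sub>M ?P"
      proof (rule measurable_PiM_single')
        show "(\<lambda>x. x) \<in> space N \<rightarrow> (\<Pi>\<^sub>E i\<in>I. space borel)" by (auto simp: spP space_PiM)
      qed (rule m)
      from measurable_sets[OF this, of A] show "A \<in> sets N"
        using A sets sets.sets_into_space[of A ?P] by (simp add: spP Int_absorb2 vimage_def)
    qed
    fix k :: "'i \<Rightarrow> nat"
    have "(\<integral>x. (\<Prod>i\<in>I. exp_neg (x i) ^ k i) \<partial>distr M ?P (\<lambda>x. \<lambda>i\<in>I. X i x))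
        = (\<integral>x. (\<Prod>i\<in>I. exp_neg (X i x) ^ k i) \<partial>M)"
      by (subst integral_distr) (auto intro!: Bochner_Integration.integral_cong prod.cong)
    also have "\<dots> = (\<Prod>i\<in>I. \<integral>x. exp_neg x ^ k i \<partial>D i)"
      unfolding eq by (rule prod.cong) (auto simp: D_def integral_distr)
    also have "\<dots> = (\<integral>x. (\<Prod>i\<in>I. exp_neg (x i) ^ k i) \<partial>PiM I D)"
      using I exp_neg_01 by (intro integral_PiM_prod[where C=1, symmetric] D)
        (auto simp: power_le_one power_abs measurable_cong_sets[OF sD refl])
    finally show "(\<integral>x. (\<Prod>i\<in>I. exp_neg (x i) ^ k i) \<partial>distr M ?P (\<lambda>x. \<lambda>i\<in>I. X i x))
       = (\<integral>x. (\<Prod>i\<in>I. exp_neg (x i) ^ k i) \<partial>PiM I D)" .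
  qed
  then show ?thesis unfolding PD[symmetric] by (subst indep_vars_iff_distr_eq_PiM'[OF False]) auto
qed

text \<open>The right-hand side of \<open>eq\<close> is the \<open>k\<close>-th moment of
  \<open>exp_neg\<close> of a Poisson variable with mean \<open>m\<close>, so moments identify the
  law of \<open>X\<close>.\<close>

lemma (in prob_space) poisson_probabilities:
  fixes X :: "'a \<Rightarrow> ennreal" and m :: real
  assumes X [measurable]: "X \<in> borel_measurable M" and m: "0 \<le> m"
    and eq: "\<And>k. (\<integral>x. exp_neg (X x) ^ k \<partial>M) = exp (- (m * (1 - exp (- real k))))"
  shows "measure M {x\<in>space M. X x = of_nat k} = m ^ k / fact k * exp (- m)"
proof -
  let ?Q = "distr (measure_pmf (poisson0_pmf m)) borel (\<lambda>k. of_nat k :: ennreal)"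
  have "distr M borel X = ?Q"
  proof (rule measure_eqI_exp_neg[where I="{()}" and X="\<lambda>_ x. x"])
    show "prob_space (distr M borel X)" by (rule prob_space_distr) measurable
    show "prob_space ?Q" by (rule measure_pmf.prob_space_distr) simp
    show "sets ?Q \<subseteq> sets N" if sp: "space N = space ?Q" and m: "\<And>i. i \<in> {()} \<Longrightarrow> (\<lambda>x. x) \<in> borel_measurable N" for N
    proof
      fix A assume "A \<in> sets ?Q"
      with measurable_sets[OF m[of "()"], of A] show "A \<in> sets N" using sp by simp
    qed
    fix j :: "unit \<Rightarrow> nat"
    have "exp_neg (of_nat k) = exp (- real k)" for k
      by (simp add: exp_neg_def flip: ennreal_of_nat_eq_real_of_nat)
    moreover have "exp (- real k) ^ j () = exp (- real (j ())) ^ k" for k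
      by (simp add: exp_of_nat_mult[symmetric] mult.commute)
    ultimately have "(\<integral>x. exp_neg x ^ j () \<partial>?Q) = (\<integral>k. exp (- real (j ())) ^ k \<partial>measure_pmf (poisson0_pmf m))"
      by (subst integral_distr) simp_all
    also have "\<dots> = exp (- (m * (1 - exp (- real (j ())))))"
      by (rule integral_poisson0[OF m]) auto
    finally show "(\<integral>x. (\<Prod>i\<in>{()}. exp_neg x ^ j i) \<partial>distr M borel X) = (\<integral>x. (\<Prod>i\<in>{()}. exp_neg x ^ j i) \<partial>?Q)"
      by (simp add: integral_distr eq)
  qed auto
  then have "measure (distr M borel X) {of_nat k} = measure ?Q {of_nat k}" by simp
  then show ?thesis using m
    by (simp add: measure_distr vimage_def Int_def conj_commute)
      (simp add: measure_pmf_single pmf_poisson0)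
qed


context relatively_compact_base
begin

section \<open>Laplace functional of a Poisson process\<close>

lemma measurable_emeasure_counting:
  assumes [measurable]: "B \<in> sets borel" shows "(\<lambda>\<phi>. emeasure \<phi> B) \<in> borel_measurable (counting_algebra :: 'a measure measure)"
  unfolding restrict_counting by (intro measurable_restrict_space1 measurable_emeasure_radon) fact

text \<open>Stated for every law satisfying \<open>poisson_process\<close>, since the definition of
  a Cox process admits any kernel of such laws. A test is a combination of disjoint cylinders, whose
  counts are independent Poisson variables, so a product of generating functions results.\<close>

lemma laplace_poisson:
  assumes K: "prob_space K" "sets K = sets counting_algebra" and P: "poisson_process \<mu> K (\<lambda>\<phi>. \<phi>)"
    and \<mu>: "\<mu> \<in> radon_measures" and f: "f \<in> tests"
  shows "(\<integral>\<phi>. laplace f \<phi> \<partial>K) = laplace (\<lambda>x. 1 - exp (- f x)) \<mu>"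
proof -
  interpret prob_space K by fact
  have [measurable_cong]: "sets K = sets counting_algebra" by fact
  have sp: "space K = counting_measures" using sets_eq_imp_space_eq[OF K(2)] by (simp add: space_counting_algebra)
  obtain n a where a: "a {} = 0" "\<And>S. 0 \<le> a S" "f = (\<lambda>x. a (code x \<inter> {..<n}))" using f by (auto simp: tests_def)
  \<comment> \<open>Independence is stated for a set of sets, so a prefix must be recoverable from
    its cylinder; leaving out empty cylinders makes \<open>cyl n\<close> injective.\<close>
  define I where "I = {S\<in>Pow {..<n} - {{}}. cyl n S \<noteq> {}}"
  have I: "finite I" by (simp add: I_def)
  have S0: "S \<noteq> {}" if "S \<in> I" for S using that by (simp add: I_def)
  have lap: "laplace (\<lambda>x. b (code x \<inter> {..<n})) \<phi> = (\<Prod>S\<in>I. exp (- b S * measure \<phi> (cyl n S)))"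
    if "\<phi> \<in> radon_measures" "b {} = 0" for \<phi> b
  proof -
    have "(\<Sum>S\<in>Pow {..<n} - {{}}. b S * measure \<phi> (cyl n S)) = (\<Sum>S\<in>I. b S * measure \<phi> (cyl n S))"
      by (rule sum.mono_neutral_right) (auto simp: I_def)
    then show ?thesis by (simp add: laplace_def integral_test(2)[where a=b and n=n, OF that] exp_sum[OF I] sum_negf[symmetric])
  qed
  have dis: "disjoint (cyl n ` I)" by (auto simp: disjoint_def cyl_def)
  have inj: "inj_on (cyl n) I" by (force simp: inj_on_def I_def cyl_def)
  have "indep_vars (\<lambda>_. borel) (\<lambda>B \<phi>. emeasure \<phi> B) (cyl n ` I)"
    using P I dis unfolding poisson_process_def
    by (auto simp: I_def relatively_compact_cyl)
  from indep_vars_compose2[OF this, of "\<lambda>B y. exp (- a (inv_into I (cyl n) B) * enn2real y)" "\<lambda>_. borel"]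
  have ind: "indep_vars (\<lambda>_. borel) (\<lambda>B \<phi>. exp (- a (inv_into I (cyl n) B) * measure \<phi> B)) (cyl n ` I)"
    by (simp add: measure_def)
  have reindex: "(\<Prod>B\<in>cyl n ` I. h (inv_into I (cyl n) B) B) = (\<Prod>S\<in>I. h S (cyl n S))" for h :: "nat set \<Rightarrow> 'a set \<Rightarrow> real"
    by (simp add: prod.reindex[OF inj] inv_into_f_f[OF inj])
  have m: "(\<lambda>\<phi>. exp (- a S * measure \<phi> (cyl n S))) \<in> borel_measurable K" for S
    using measurable_emeasure_counting[OF cyl_borel, of n S] unfolding measure_def by measurable
  have le: "\<bar>exp (- a S * measure \<phi> (cyl n S))\<bar> \<le> 1" for S \<phi> using a(2)[of S] by simp
  have one: "(\<integral>\<phi>. exp (- a S * measure \<phi> (cyl n S)) \<partial>K) = exp (- (measure \<mu> (cyl n S) * (1 - exp (- a S))))"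
    if S: "S \<in> I" for S
  proof (rule poisson_generating[OF K(1), where A="\<lambda>k. {\<phi>\<in>space K. emeasure \<phi> (cyl n S) = of_nat k}"])
    show "{\<phi>\<in>space K. emeasure \<phi> (cyl n S) = of_nat k} \<in> sets K" for k
      using measurable_emeasure_counting[OF cyl_borel, of n S] by measurable
    show "disjoint_family (\<lambda>k. {\<phi>\<in>space K. emeasure \<phi> (cyl n S) = of_nat k})"
      by (auto simp: disjoint_family_on_def)
    show "measure K {\<phi>\<in>space K. emeasure \<phi> (cyl n S) = of_nat k} = measure \<mu> (cyl n S) ^ k / fact k * exp (- measure \<mu> (cyl n S))" for k
      using P relatively_compact_cyl[OF S0[OF S]] cyl_borel unfolding poisson_process_def by blast
    show "exp (- a S * measure \<phi> (cyl n S)) = exp (- a S) ^ k" if "\<phi> \<in> {\<phi>\<in>space K. emeasure \<phi> (cyl n S) = of_nat k}" for k \<phi>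
      using that by (simp add: measure_def exp_of_nat_mult[symmetric] ac_simps flip: ennreal_of_nat_eq_real_of_nat)
  qed (use m le a(2) in auto)
  have "(\<integral>\<phi>. laplace f \<phi> \<partial>K) = (\<integral>\<phi>. (\<Prod>S\<in>I. exp (- a S * measure \<phi> (cyl n S))) \<partial>K)"
    using lap[of _ a, OF _ a(1)] counting_subset by (intro Bochner_Integration.integral_cong) (auto simp: a(3) sp)
  also have "\<dots> = (\<integral>\<phi>. (\<Prod>B\<in>cyl n ` I. exp (- a (inv_into I (cyl n) B) * measure \<phi> B)) \<partial>K)"
    by (simp only: reindex[of "\<lambda>S B. exp (- a S * measure _ B)"])
  also have "\<dots> = (\<Prod>B\<in>cyl n ` I. \<integral>\<phi>. exp (- a (inv_into I (cyl n) B) * measure \<phi> B) \<partial>K)"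
  proof (rule indep_vars_lebesgue_integral[OF _ ind])
    fix B assume "B \<in> cyl n ` I"
    then obtain S where B: "B = cyl n S" "inv_into I (cyl n) B = S" by (auto simp: inv_into_f_f[OF inj])
    have "AE \<phi> in K. norm (exp (- a S * measure \<phi> (cyl n S))) \<le> 1" using le by (intro AE_I2) simp
    then show "integrable K (\<lambda>\<phi>. exp (- a (inv_into I (cyl n) B) * measure \<phi> B))"
      unfolding B(2) unfolding B(1) using m by (rule integrable_const_bound)
  qed (use I in simp)
  also have "\<dots> = (\<Prod>S\<in>I. \<integral>\<phi>. exp (- a S * measure \<phi> (cyl n S)) \<partial>K)"
    by (rule reindex[of "\<lambda>S B. \<integral>\<phi>. exp (- a S * measure \<phi> B) \<partial>K"])
  also have "\<dots> = (\<Prod>S\<in>I. exp (- (1 - exp (- a S)) * measure \<mu> (cyl n S)))"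
  proof (rule prod.cong[OF refl])
    fix S assume "S \<in> I"
    show "(\<integral>\<phi>. exp (- a S * measure \<phi> (cyl n S)) \<partial>K) = exp (- (1 - exp (- a S)) * measure \<mu> (cyl n S))"
      unfolding one[OF \<open>S \<in> I\<close>] by (simp add: algebra_simps)
  qed
  also have "\<dots> = laplace (\<lambda>x. 1 - exp (- f x)) \<mu>"
    unfolding a(3) by (rule lap[OF \<mu>, symmetric]) (simp add: a(1))
  finally show ?thesis .
qed

lemma tests_one_minus_exp: "f \<in> tests \<Longrightarrow> (\<lambda>x. 1 - exp (- f x)) \<in> tests"
  by (rule tests_comp) (simp_all add: tests_nonneg)

section \<open>Construction of a Poisson process with given intensity\<close>

text \<open>A point belongs to the layer of the first base set that contains it. The layers
  partition the space into relatively compact pieces, on which a Radon measure is finite.\<close>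

definition layer :: "nat \<Rightarrow> 'a set" where "layer k = U k - (\<Union>i<k. U i)"

lemma layer_borel [measurable]: "layer k \<in> sets borel"
  unfolding layer_def by measurable

lemma disjoint_layer: "disjoint_family layer"
proof -
  have "layer m \<inter> layer n = {}" if "m < n" for m n using that by (auto simp: layer_def)
  then show ?thesis unfolding disjoint_family_on_def by (metis Int_commute linorder_neqE_nat)
qed

lemma UN_layer: "(\<Union>k<n. layer k) = (\<Union>i<n. U i)"
proof (induction n)
  case (Suc n)
  then show ?case by (auto simp: lessThan_Suc layer_def)
qed simp

lemma relatively_compact_layer: "relatively_compact (layer k)"
  by (rule relatively_compact_subset[OF relatively_compact_U[of "Suc k"]]) (auto simp: layer_def)

text \<open>The law of one point in the layer. In a layer of mass 0 the number of points is 0 almost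
  surely, and any probability measure will do.\<close>

definition layer_law :: "'a measure \<Rightarrow> nat \<Rightarrow> 'a measure" where
  "layer_law \<mu> k = (if measure \<mu> (layer k) = 0 then return borel undefined else uniform_measure \<mu> (layer k))"

text \<open>Independently for each layer, a Poisson number and an infinite sequence of independent
  positions, of which only that many are used; the space of positions thus does not depend on the
  number.\<close>

definition poisson_source :: "'a measure \<Rightarrow> (nat \<Rightarrow> nat \<times> (nat \<Rightarrow> 'a)) measure" where
  "poisson_source \<mu> = PiM UNIV (\<lambda>k. measure_pmf (poisson0_pmf (measure \<mu> (layer k))) \<Otimes>\<^sub>M PiM UNIV (\<lambda>_. layer_law \<mu> k))"

text \<open>A point falling outside its layer, which happens with probability \<open>0\<close>, is discarded, so that
  every outcome is locally finite.\<close>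

definition poisson_atoms :: "(nat \<Rightarrow> nat \<times> (nat \<Rightarrow> 'a)) \<Rightarrow> 'a measure" where
  "poisson_atoms \<omega> = atoms
     {l. case prod_decode l of (k, i) \<Rightarrow> i < fst (\<omega> k) \<and> snd (\<omega> k) i \<in> layer k}
     (\<lambda>l. case prod_decode l of (k, i) \<Rightarrow> snd (\<omega> k) i)"

definition poisson_law :: "'a measure \<Rightarrow> 'a measure measure" where
  "poisson_law \<mu> = distr (poisson_source \<mu>) counting_algebra poisson_atoms"

text \<open>Layers with index at least \<open>n\<close> avoid \<open>\<Union>i<n. U i\<close>, so
  only finitely many layers contribute a factor different from 1.\<close>

lemma laplace_poisson_atoms:
  assumes f: "f \<in> borel_measurable borel" and n: "\<And>x. f x \<noteq> 0 \<Longrightarrow> x \<in> (\<Union>i<n. U i)"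
  shows "laplace f (poisson_atoms \<omega>)
    = (\<Prod>k<n. \<Prod>i<fst (\<omega> k). if snd (\<omega> k) i \<in> layer k then exp (- f (snd (\<omega> k) i)) else 1)"
proof -
  let ?J = "SIGMA k:{..<n}. {i. i < fst (\<omega> k) \<and> snd (\<omega> k) i \<in> layer k}"
  have J: "finite ?J" by auto
  have "laplace f (poisson_atoms \<omega>) = (\<Prod>l\<in>prod_encode ` ?J. exp (- f (case prod_decode l of (k, i) \<Rightarrow> snd (\<omega> k) i)))"
    unfolding poisson_atoms_def
  proof (rule laplace_atoms[OF f])
    show "finite (prod_encode ` ?J)" using J by simp
    show "prod_encode ` ?J \<subseteq> {l. case prod_decode l of (k, i) \<Rightarrow> i < fst (\<omega> k) \<and> snd (\<omega> k) i \<in> layer k}"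
      by auto
    fix l assume l: "l \<in> {l. case prod_decode l of (k, i) \<Rightarrow> i < fst (\<omega> k) \<and> snd (\<omega> k) i \<in> layer k} - prod_encode ` ?J"
    obtain k i where ki: "prod_decode l = (k, i)" by fastforce
    then have lki: "l = prod_encode (k, i)" by (metis prod_decode_inverse)
    have "\<not> k < n" using l ki unfolding lki by auto
    moreover have "snd (\<omega> k) i \<in> layer k" using l ki by simp
    ultimately have "snd (\<omega> k) i \<notin> (\<Union>i<n. U i)" unfolding layer_def by auto
    then show "f (case prod_decode l of (k, i) \<Rightarrow> snd (\<omega> k) i) = 0" using n ki by auto
  qed
  also have "\<dots> = (\<Prod>z\<in>?J. exp (- f (snd (\<omega> (fst z)) (snd z))))"
    by (subst prod.reindex) (auto simp: inj_on_def split_beta' intro!: prod.cong)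
  also have "\<dots> = (\<Prod>k<n. \<Prod>i\<in>{i. i < fst (\<omega> k) \<and> snd (\<omega> k) i \<in> layer k}. exp (- f (snd (\<omega> k) i)))"
    by (subst prod.Sigma) (auto simp: split_beta')
  also have "\<dots> = (\<Prod>k<n. \<Prod>i<fst (\<omega> k). if snd (\<omega> k) i \<in> layer k then exp (- f (snd (\<omega> k) i)) else 1)"
  proof (rule prod.cong[OF refl])
    fix k
    have "{i. i < fst (\<omega> k) \<and> snd (\<omega> k) i \<in> layer k} = {i\<in>{..<fst (\<omega> k)}. snd (\<omega> k) i \<in> layer k}" by auto
    then show "(\<Prod>i\<in>{i. i < fst (\<omega> k) \<and> snd (\<omega> k) i \<in> layer k}. exp (- f (snd (\<omega> k) i)))
        = (\<Prod>i<fst (\<omega> k). if snd (\<omega> k) i \<in> layer k then exp (- f (snd (\<omega> k) i)) else 1)"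
      by (simp only: prod.inter_filter[OF finite_lessThan])
  qed
  finally show ?thesis .
qed

lemma poisson_atoms_counting: "poisson_atoms \<omega> \<in> counting_measures"
  unfolding poisson_atoms_def
proof (intro atoms_counting atoms_radonI)
  fix B :: "'a set" assume "relatively_compact B"
  then obtain n where n: "B \<subseteq> (\<Union>i<n. U i)" using relatively_compact_bounded by blast
  let ?L = "{l \<in> {l. case prod_decode l of (k, i) \<Rightarrow> i < fst (\<omega> k) \<and> snd (\<omega> k) i \<in> layer k}.
      (case prod_decode l of (k, i) \<Rightarrow> snd (\<omega> k) i) \<in> B}"
  have "?L \<subseteq> prod_encode ` (SIGMA k:{..<n}. {..<fst (\<omega> k)})"
  proof
    fix l assume l: "l \<in> ?L"
    obtain k i where ki: "prod_decode l = (k, i)" by fastforce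
    then have lki: "l = prod_encode (k, i)" by (metis prod_decode_inverse)
    have li: "i < fst (\<omega> k)" "snd (\<omega> k) i \<in> layer k" "snd (\<omega> k) i \<in> (\<Union>i<n. U i)" using l ki n by auto
    then obtain j where j: "j < n" "snd (\<omega> k) i \<in> U j" by auto
    then have "\<not> j < k" using li(2) unfolding layer_def by auto
    then have "k < n" using j(1) by simp
    then show "l \<in> prod_encode ` (SIGMA k:{..<n}. {..<fst (\<omega> k)})" unfolding lki using li by auto
  qed
  then show "finite ?L" by (rule finite_subset) auto
qed

lemma prob_space_layer_law:
  assumes \<mu>: "\<mu> \<in> radon_measures" shows "prob_space (layer_law \<mu> k)" "sets (layer_law \<mu> k) = sets borel"
proof -
  have fin: "emeasure \<mu> (layer k) < \<infinity>" by (rule radon_finite[OF \<mu> layer_borel relatively_compact_layer])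
  show "prob_space (layer_law \<mu> k)"
  proof (cases "measure \<mu> (layer k) = 0")
    case False
    then have "emeasure \<mu> (layer k) \<noteq> 0" by (auto simp: measure_def)
    then show ?thesis using fin False
      by (simp add: layer_law_def prob_space_uniform_measure)
  qed (simp add: layer_law_def prob_space_return)
  show "sets (layer_law \<mu> k) = sets borel" using radon_sets[OF \<mu>] by (simp add: layer_law_def)
qed

text \<open>The last claim is not confined to tests, because it will be applied to combinations of
  indicators of arbitrary relatively compact Borel sets. For these the measurability of the Laplace
  functional is a separate premise.\<close>

lemma poisson_law_props:
  assumes \<mu>: "\<mu> \<in> radon_measures"
  shows "poisson_atoms \<in> poisson_source \<mu> \<rightarrow>\<^sub>M counting_algebra"
    and "prob_space (poisson_law \<mu>)" and "sets (poisson_law \<mu>) = sets counting_algebra"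
    and "\<And>f n. f \<in> borel_measurable borel \<Longrightarrow> (\<And>x. 0 \<le> f x) \<Longrightarrow> (\<And>x. f x \<noteq> 0 \<Longrightarrow> x \<in> (\<Union>i<n. U i)) \<Longrightarrow>
      laplace f \<in> borel_measurable counting_algebra \<Longrightarrow>
      (\<integral>\<phi>. laplace f \<phi> \<partial>poisson_law \<mu>) = laplace (\<lambda>x. 1 - exp (- f x)) \<mu>"
proof -
  let ?N = "\<lambda>k. measure_pmf (poisson0_pmf (measure \<mu> (layer k)))" and ?L = "layer_law \<mu>"
  let ?M = "\<lambda>k. ?N k \<Otimes>\<^sub>M PiM UNIV (\<lambda>_::nat. ?L k)"
  note L = prob_space_layer_law[OF \<mu>]
  have [measurable_cong]: "sets (?L k) = sets borel" for k by (rule L)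
  have PL: "prob_space (PiM UNIV (\<lambda>_::nat. ?L k))" for k by (intro prob_space_PiM L)
  have PM: "prob_space (?M k)" for k by (intro prob_space_pair prob_space_measure_pmf PL)
  have src: "prob_space (poisson_source \<mu>)" unfolding poisson_source_def by (intro prob_space_PiM PM)
  define g where "g f k z = (\<Prod>i<fst z. if snd z i \<in> layer k then exp (- f (snd z i)) else 1)"
    for f :: "'a \<Rightarrow> real" and k and z :: "nat \<times> (nat \<Rightarrow> 'a)"
  have gm [measurable]: "g f k \<in> borel_measurable (?M k)" if [measurable]: "f \<in> borel_measurable borel" for f k
    unfolding g_def[abs_def]
    by (rule measurable_compose_countable[where f="\<lambda>n z. \<Prod>i<n. if snd z i \<in> layer k then exp (- f (snd z i)) else 1" and g=fst])
      (measurable)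
  have g01: "g f k z \<in> {0..1}" if "\<And>x. 0 \<le> f x" for f k z
    using that unfolding g_def by (auto intro!: prod_nonneg prod_le_1)
  have lap: "laplace f (poisson_atoms \<omega>) = (\<Prod>k<n. g f k (\<omega> k))"
    if "f \<in> borel_measurable borel" "\<And>x. f x \<noteq> 0 \<Longrightarrow> x \<in> (\<Union>i<n. U i)" for f n \<omega>
    unfolding g_def using that by (rule laplace_poisson_atoms)
  show meas: "poisson_atoms \<in> poisson_source \<mu> \<rightarrow>\<^sub>M counting_algebra"
    unfolding restrict_counting
  proof (rule measurable_restrict_space2)
    show "poisson_atoms \<in> poisson_source \<mu> \<rightarrow>\<^sub>M radon_algebra"
    proof (rule measurable_radon_laplaceI)
      show "poisson_atoms \<omega> \<in> radon_measures" for \<omega> using poisson_atoms_counting counting_subset by blast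
      fix f assume f: "f \<in> tests"
      obtain n where n: "\<And>x. f x \<noteq> 0 \<Longrightarrow> x \<in> (\<Union>i<n. U i)" using tests_support[OF f] by blast
      have eq: "(\<lambda>\<omega>. laplace f (poisson_atoms \<omega>)) = (\<lambda>\<omega>. \<Prod>k<n. g f k (\<omega> k))"
        by (rule ext, rule lap[OF tests_borel[OF f] n])
      show "(\<lambda>\<omega>. laplace f (poisson_atoms \<omega>)) \<in> borel_measurable (poisson_source \<mu>)"
        unfolding eq poisson_source_def
        using measurable_compose[OF measurable_component_singleton[of _ UNIV ?M] gm[OF tests_borel[OF f]]]
        by (intro borel_measurable_prod) simp
    qed
  qed (use poisson_atoms_counting in auto)
  show "prob_space (poisson_law \<mu>)" unfolding poisson_law_def by (rule prob_space.prob_space_distr[OF src meas])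
  show "sets (poisson_law \<mu>) = sets counting_algebra" by (simp add: poisson_law_def)
  fix f and n :: nat assume f [measurable]: "f \<in> borel_measurable borel" and f0: "\<And>x. 0 \<le> f x"
    and n: "\<And>x. f x \<noteq> 0 \<Longrightarrow> x \<in> (\<Union>i<n. U i)" and lm: "laplace f \<in> borel_measurable counting_algebra"
  have [measurable_cong]: "sets \<mu> = sets borel" by (rule radon_sets[OF \<mu>])
  have fin: "emeasure \<mu> (layer k) < \<infinity>" for k by (rule radon_finite[OF \<mu> layer_borel relatively_compact_layer])
  have int: "integrable \<mu> (\<lambda>x. indicator (layer k) x * exp (- f x))" "integrable \<mu> (indicator (layer k) :: _ \<Rightarrow> real)" for k
  proof -
    show i: "integrable \<mu> (indicator (layer k) :: _ \<Rightarrow> real)" using fin[of k] by simp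
    show "integrable \<mu> (\<lambda>x. indicator (layer k) x * exp (- f x))"
      by (rule Bochner_Integration.integrable_bound[OF i]) (use f0 in \<open>auto simp: indicator_def\<close>)
  qed
  \<comment> \<open>Given the number \<open>N\<close> of points in the layer, their positions are
    independent with mean factor \<open>c\<close>. Averaging \<open>c ^ N\<close> gives
    \<open>exp (- (?m * (1 - c)))\<close>, and \<open>?m * (1 - c)\<close> is an integral over the
    layer.\<close>
  have one: "(\<integral>z. g f k z \<partial>?M k) = exp (- (\<integral>x. indicator (layer k) x * (1 - exp (- f x)) \<partial>\<mu>))" for k
  proof -
    let ?m = "measure \<mu> (layer k)" and ?G = "\<lambda>y. if y \<in> layer k then exp (- f y) else 1"
    define c where "c = (\<integral>y. ?G y \<partial>?L k)"
    interpret L: prob_space "?L k" by (rule L)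
    interpret PL: prob_space "PiM UNIV (\<lambda>_::nat. ?L k)" by (rule PL)
    interpret N: prob_space "?N k" by (rule prob_space_measure_pmf)
    interpret P: pair_prob_space "?N k" "PiM UNIV (\<lambda>_::nat. ?L k)" ..
    have G01: "0 \<le> ?G y" "?G y \<le> 1" for y using f0 by auto
    have Gi: "integrable (?L k) ?G" using G01 by (intro L.integrable_const_bound[where B=1] AE_I2) auto
    have c01: "c \<in> {0..1}"
    proof -
      have "c \<le> (\<integral>y. 1 \<partial>?L k)" unfolding c_def using Gi G01 by (intro integral_mono) auto
      moreover have "0 \<le> c" unfolding c_def using G01 by (intro Bochner_Integration.integral_nonneg)
      ultimately show ?thesis using L.prob_space by simp
    qed
    have gi: "integrable (?M k) (g f k)"
      using g01[OF f0] gm[OF f] by (intro P.P.integrable_const_bound[where B=1] AE_I2) auto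
    have "(\<integral>z. g f k z \<partial>?M k) = (\<integral>N. (\<integral>y. g f k (N, y) \<partial>PiM UNIV (\<lambda>_::nat. ?L k)) \<partial>?N k)"
      by (rule P.integral_fst'[OF gi, symmetric])
    also have "(\<lambda>N. \<integral>y. g f k (N, y) \<partial>PiM UNIV (\<lambda>_::nat. ?L k)) = (\<lambda>N. c ^ N)"
    proof
      fix N
      have "(\<integral>y. (\<Prod>i<N. ?G (y i)) \<partial>PiM UNIV (\<lambda>_::nat. ?L k)) = (\<Prod>i<N. \<integral>x. ?G x \<partial>?L k)"
        by (rule integral_PiM_prod[where C=1]) (use L(1) G01 in auto)
      then show "(\<integral>y. g f k (N, y) \<partial>PiM UNIV (\<lambda>_::nat. ?L k)) = c ^ N" by (simp add: g_def c_def cong: if_cong)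
    qed
    also have "(\<integral>N. c ^ N \<partial>?N k) = exp (- (?m * (1 - c)))" by (rule integral_poisson0[OF _ c01]) simp
    also have "?m * (1 - c) = (\<integral>x. indicator (layer k) x * (1 - exp (- f x)) \<partial>\<mu>)"
    proof -
      have split: "(\<integral>x. indicator (layer k) x * (1 - exp (- f x)) \<partial>\<mu>)
          = ?m - (\<integral>x. indicator (layer k) x * exp (- f x) \<partial>\<mu>)"
      proof -
        have "(\<integral>x. indicator (layer k) x * (1 - exp (- f x)) \<partial>\<mu>)
          = (\<integral>x. indicator (layer k) x - indicator (layer k) x * exp (- f x) \<partial>\<mu>)"
          by (simp add: algebra_simps)
        then show ?thesis using int[of k] sets_eq_imp_space_eq[OF radon_sets[OF \<mu>]] by simp
      qed
      show ?thesis
      proof (cases "?m = 0")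
        case True
        then have "emeasure \<mu> (layer k) = 0" using fin[of k] by (simp add: emeasure_eq_ennreal_measure)
        then have "AE x in \<mu>. x \<notin> layer k" by (intro AE_not_in) (auto simp: null_sets_def)
        then have "(\<integral>x. indicator (layer k) x * exp (- f x) \<partial>\<mu>) = (\<integral>x. 0 \<partial>\<mu>)"
          by (intro integral_cong_AE) (auto elim!: eventually_mono)
        then show ?thesis using True split by simp
      next
        case False
        have "1 / ennreal ?m = ennreal (1 / ?m)"
          using divide_ennreal[of 1 ?m] False by (simp add: zero_less_measure_iff)
        then have Lk: "?L k = density \<mu> (\<lambda>x. ennreal (indicator (layer k) x / ?m))"
          unfolding layer_law_def uniform_measure_def using False fin[of k]
          by (auto intro!: density_cong simp: emeasure_eq_ennreal_measure indicator_def divide_ennreal[symmetric] less_top)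
        have "c = (\<integral>x. indicator (layer k) x / ?m * ?G x \<partial>\<mu>)"
          unfolding c_def Lk by (subst integral_density) auto
        also have "\<dots> = (\<integral>x. indicator (layer k) x * exp (- f x) / ?m \<partial>\<mu>)"
          by (rule Bochner_Integration.integral_cong) (auto simp: indicator_def)
        also have "\<dots> = (\<integral>x. indicator (layer k) x * exp (- f x) \<partial>\<mu>) / ?m" by simp
        finally show ?thesis unfolding split using False by (simp add: field_simps)
      qed
    qed
    finally show ?thesis .
  qed
  have "(\<integral>\<phi>. laplace f \<phi> \<partial>poisson_law \<mu>) = (\<integral>\<omega>. (\<Prod>k<n. g f k (\<omega> k)) \<partial>poisson_source \<mu>)"
  proof -
    have "(\<integral>\<phi>. laplace f \<phi> \<partial>poisson_law \<mu>) = (\<integral>\<omega>. laplace f (poisson_atoms \<omega>) \<partial>poisson_source \<mu>)"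
      unfolding poisson_law_def by (rule integral_distr[OF meas lm])
    also have "\<dots> = (\<integral>\<omega>. (\<Prod>k<n. g f k (\<omega> k)) \<partial>poisson_source \<mu>)"
      by (rule Bochner_Integration.integral_cong[OF refl], rule lap[OF f n])
    finally show ?thesis .
  qed
  also have "\<dots> = (\<Prod>k<n. \<integral>z. g f k z \<partial>?M k)"
    unfolding poisson_source_def
    by (rule integral_PiM_prod[where C=1]) (use PM gm[OF f] g01[OF f0] in auto)
  also have "\<dots> = exp (- (\<Sum>k<n. \<integral>x. indicator (layer k) x * (1 - exp (- f x)) \<partial>\<mu>))"
    by (simp add: one exp_sum sum_negf[symmetric])
  also have "(\<Sum>k<n. \<integral>x. indicator (layer k) x * (1 - exp (- f x)) \<partial>\<mu>)
      = (\<integral>x. (\<Sum>k<n. indicator (layer k) x * (1 - exp (- f x))) \<partial>\<mu>)"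
    using int by (subst Bochner_Integration.integral_sum) (auto simp: right_diff_distrib)
  also have "(\<lambda>x. \<Sum>k<n. indicator (layer k) x * (1 - exp (- f x))) = (\<lambda>x. 1 - exp (- f x))"
  proof
    fix x
    show "(\<Sum>k<n. indicator (layer k) x * (1 - exp (- f x))) = 1 - exp (- f x)"
    proof (cases "f x = 0")
      case False
      then obtain k where k: "k < n" "x \<in> layer k" using n[of x] unfolding UN_layer[symmetric] by auto
      have "indicator (layer j) x * (1 - exp (- f x)) = (if j = k then 1 - exp (- f x) else 0)" for j
        using k(2) disjoint_family_onD[OF disjoint_layer, of j k] by (cases "j = k") (auto simp: indicator_def)
      then show ?thesis using k(1) by simp
    qed simp
  qed
  finally show "(\<integral>\<phi>. laplace f \<phi> \<partial>poisson_law \<mu>) = laplace (\<lambda>x. 1 - exp (- f x)) \<mu>" by (simp add: laplace_def)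
qed


text \<open>Integer combinations of indicators of disjoint sets yield all mixed
  \<open>exp_neg\<close> moments of the counts. They factorise, which gives independence, and for a
  single set they are the moments of a Poisson variable.\<close>

lemma poisson_law_process:
  assumes \<mu>: "\<mu> \<in> radon_measures"
  shows "poisson_process \<mu> (poisson_law \<mu>) (\<lambda>\<phi>. \<phi>)"
proof -
  note props = poisson_law_props[OF \<mu>]
  interpret prob_space "poisson_law \<mu>" by (rule props)
  have [measurable_cong]: "sets (poisson_law \<mu>) = sets counting_algebra" by (rule props)
  have sp: "space (poisson_law \<mu>) = counting_measures"
    using sets_eq_imp_space_eq[OF props(3)] by (simp add: space_counting_algebra)
  have [measurable_cong]: "sets \<mu> = sets borel" by (rule radon_sets[OF \<mu>])
  have X: "(\<lambda>\<phi>. emeasure \<phi> B) \<in> borel_measurable (poisson_law \<mu>)" if "B \<in> sets borel" for B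
    using measurable_emeasure_counting[OF that] by measurable
  have joint: "(\<integral>\<phi>. (\<Prod>B\<in>\<B>. exp_neg (emeasure \<phi> B) ^ k B) \<partial>poisson_law \<mu>)
      = (\<Prod>B\<in>\<B>. exp (- (measure \<mu> B * (1 - exp (- real (k B))))))"
    if \<B>: "finite \<B>" "disjoint \<B>" "\<And>B. B \<in> \<B> \<Longrightarrow> B \<in> sets borel \<and> relatively_compact B" for \<B> and k :: "'a set \<Rightarrow> nat"
  proof -
    define f where "f x = (\<Sum>B\<in>\<B>. real (k B) * indicator B x)" for x
    have fm: "f \<in> borel_measurable borel"
      unfolding f_def[abs_def] using \<B>(3) by (intro borel_measurable_sum borel_measurable_times borel_measurable_const borel_measurable_indicator) blast
    have f0: "0 \<le> f x" for x unfolding f_def by (intro sum_nonneg) auto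
    have "relatively_compact (\<Union>\<B>)"
    proof -
      have "closed (\<Union>B\<in>\<B>. closure B)" using \<B>(1) by (intro closed_UN) auto
      then have "closure (\<Union>\<B>) \<subseteq> (\<Union>B\<in>\<B>. closure B)" using closure_subset by (intro closure_minimal) blast+
      moreover have "compact (\<Union>B\<in>\<B>. closure B)" using \<B> by (intro compact_UN) (auto simp: relatively_compact_def)
      ultimately show ?thesis
        unfolding relatively_compact_def using compact_Int_closed[OF _ closed_closure] by (metis inf.absorb2)
    qed
    then obtain n where n: "\<Union>\<B> \<subseteq> (\<Union>i<n. U i)" using relatively_compact_bounded by blast
    have fn: "x \<in> (\<Union>i<n. U i)" if "f x \<noteq> 0" for x
    proof -
      have "\<exists>B\<in>\<B>. real (k B) * indicator B x \<noteq> (0::real)"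
        using that unfolding f_def by (rule contrapos_np) (auto intro: sum.neutral)
      then have "x \<in> \<Union>\<B>" by (auto simp: indicator_def split: if_splits)
      then show ?thesis using n by blast
    qed
    have lap: "laplace f \<phi> = (\<Prod>B\<in>\<B>. exp_neg (emeasure \<phi> B) ^ k B)" if \<phi>: "\<phi> \<in> radon_measures" for \<phi>
    proof -
      have s: "sets \<phi> = sets borel" "space \<phi> = UNIV" using radon_sets[OF \<phi>] sets_eq_imp_space_eq[OF radon_sets[OF \<phi>]] by auto
      have fin: "emeasure \<phi> B < \<infinity>" if "B \<in> \<B>" for B using radon_finite[OF \<phi>] \<B>(3)[OF that] by blast
      have "(\<integral>x. f x \<partial>\<phi>) = (\<Sum>B\<in>\<B>. real (k B) * measure \<phi> B)"
        unfolding f_def using fin \<B>(3) s by (subst Bochner_Integration.integral_sum) (auto simp: less_top)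
      then have "laplace f \<phi> = (\<Prod>B\<in>\<B>. exp (- (real (k B) * measure \<phi> B)))"
        by (simp add: laplace_def exp_sum[OF \<B>(1)] sum_negf[symmetric])
      also have "\<dots> = (\<Prod>B\<in>\<B>. exp_neg (emeasure \<phi> B) ^ k B)"
      proof (rule prod.cong[OF refl])
        fix B assume "B \<in> \<B>"
        then show "exp (- (real (k B) * measure \<phi> B)) = exp_neg (emeasure \<phi> B) ^ k B"
          using fin[of B] by (simp add: exp_neg_def measure_def exp_of_nat_mult[symmetric])
      qed
      finally show ?thesis .
    qed
    have "(\<integral>\<phi>. (\<Prod>B\<in>\<B>. exp_neg (emeasure \<phi> B) ^ k B) \<partial>poisson_law \<mu>) = (\<integral>\<phi>. laplace f \<phi> \<partial>poisson_law \<mu>)"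
      using lap counting_subset by (intro Bochner_Integration.integral_cong) (auto simp: sp)
    also have "\<dots> = laplace (\<lambda>x. 1 - exp (- f x)) \<mu>"
    proof (rule props(4)[OF fm f0 fn])
      have "(\<lambda>\<phi>. \<Prod>B\<in>\<B>. exp_neg (emeasure \<phi> B) ^ k B) \<in> borel_measurable (counting_algebra :: 'a measure measure)"
        using \<B>(3) by (intro borel_measurable_prod borel_measurable_power
          measurable_compose[OF measurable_emeasure_counting exp_neg_measurable]) blast
      then show "laplace f \<in> borel_measurable counting_algebra"
        by (rule measurable_cong[THEN iffD1, rotated])
          (use counting_subset lap in \<open>auto simp: space_counting_algebra\<close>)
    qed
    \<comment> \<open>Disjointness enters here: at most one of the sets contains \<open>x\<close>,
      so the exponential of the sum splits into single terms.\<close>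
    also have "(\<lambda>x. 1 - exp (- f x)) = (\<lambda>x. \<Sum>B\<in>\<B>. (1 - exp (- real (k B))) * indicator B x)"
    proof
      fix x
      show "1 - exp (- f x) = (\<Sum>B\<in>\<B>. (1 - exp (- real (k B))) * indicator B x)"
      proof (cases "x \<in> \<Union>\<B>")
        case True
        then obtain B where B: "B \<in> \<B>" "x \<in> B" by auto
        have ind: "indicator C x = (if C = B then 1 else 0::real)" if "C \<in> \<B>" for C
          using disjointD[OF \<B>(2) that B(1)] B(2) by (cases "C = B") (auto simp: indicator_def)
        have "f x = (\<Sum>C\<in>\<B>. if C = B then real (k B) else 0)"
          unfolding f_def by (rule sum.cong) (auto simp: ind)
        moreover have "(\<Sum>C\<in>\<B>. (1 - exp (- real (k C))) * indicator C x) = (\<Sum>C\<in>\<B>. if C = B then 1 - exp (- real (k B)) else 0)"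
          by (rule sum.cong) (auto simp: ind)
        ultimately show ?thesis using B \<B>(1) by simp
      next
        case False
        then show ?thesis by (auto simp: f_def indicator_def intro!: sum.neutral[symmetric] sum.neutral)
      qed
    qed
    also have "laplace (\<lambda>x. \<Sum>B\<in>\<B>. (1 - exp (- real (k B))) * indicator B x) \<mu>
        = (\<Prod>B\<in>\<B>. exp (- (measure \<mu> B * (1 - exp (- real (k B))))))"
    proof -
      have fin: "emeasure \<mu> B < \<infinity>" if "B \<in> \<B>" for B using radon_finite[OF \<mu>] \<B>(3)[OF that] by blast
      have "(\<integral>x. (\<Sum>B\<in>\<B>. (1 - exp (- real (k B))) * indicator B x) \<partial>\<mu>) = (\<Sum>B\<in>\<B>. (1 - exp (- real (k B))) * measure \<mu> B)"
        using fin \<B>(3) sets_eq_imp_space_eq[OF radon_sets[OF \<mu>]] radon_sets[OF \<mu>]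
        by (subst Bochner_Integration.integral_sum) (auto simp: less_top)
      then show ?thesis by (simp add: laplace_def exp_sum[OF \<B>(1)] sum_negf[symmetric] mult.commute)
    qed
    finally show ?thesis .
  qed
  have single: "(\<integral>\<phi>. exp_neg (emeasure \<phi> B) ^ k \<partial>poisson_law \<mu>) = exp (- (measure \<mu> B * (1 - exp (- real k))))"
    if "B \<in> sets borel" "relatively_compact B" for B k
    using joint[of "{B}" "\<lambda>_. k"] that by (simp add: disjoint_def)
  show ?thesis unfolding poisson_process_def point_process_def random_measure_def
  proof (intro conjI ballI allI impI)
    show "prob_space (poisson_law \<mu>)" by (rule props)
    show "(\<lambda>\<phi>. \<phi>) \<in> poisson_law \<mu> \<rightarrow>\<^sub>M radon_algebra"
      by (rule measurable_radonI) (use sp counting_subset X in auto)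
    show "\<phi> \<in> counting_measures" if "\<phi> \<in> space (poisson_law \<mu>)" for \<phi> using that sp by simp
    fix \<B> :: "'a set set" assume \<B>: "finite \<B> \<and> disjoint \<B> \<and> (\<forall>B\<in>\<B>. B \<in> sets borel \<and> relatively_compact B)"
    show "indep_vars (\<lambda>_. borel) (\<lambda>B \<phi>. emeasure \<phi> B) \<B>"
    proof (rule indep_vars_exp_neg)
      show "(\<integral>\<phi>. (\<Prod>B\<in>\<B>. exp_neg (emeasure \<phi> B) ^ k B) \<partial>poisson_law \<mu>) = (\<Prod>B\<in>\<B>. \<integral>\<phi>. exp_neg (emeasure \<phi> B) ^ k B \<partial>poisson_law \<mu>)" for k
        using joint[of \<B> k] single \<B> by simp
    qed (use \<B> X in auto)
  next
    fix B :: "'a set" and k assume "B \<in> sets borel" "relatively_compact B"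
    then show "measure (poisson_law \<mu>) {\<phi>\<in>space (poisson_law \<mu>). emeasure \<phi> B = of_nat k} = measure \<mu> B ^ k / fact k * exp (- measure \<mu> B)"
      by (intro poisson_probabilities X single) simp_all
  qed
qed

text \<open>The sample space of the construction itself varies with \<open>\<mu>\<close>, so
  measurability is read off from the Laplace functional, which is measurable in
  \<open>\<mu>\<close>.\<close>

lemma poisson_law_kernel:
  "poisson_law \<in> radon_algebra \<rightarrow>\<^sub>M prob_algebra (counting_algebra :: 'a measure measure)"
  unfolding restrict_counting
proof (rule measurable_laplace_kernel[OF counting_subset], unfold restrict_counting[symmetric] space_radon_algebra)
  show "prob_space (poisson_law \<mu>)" "sets (poisson_law \<mu>) = sets counting_algebra"
    if "\<mu> \<in> radon_measures" for \<mu> :: "'a measure" using poisson_law_props[OF that] by auto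
  fix f assume f: "f \<in> tests"
  show "(\<lambda>\<mu>. \<integral>\<phi>. laplace f \<phi> \<partial>poisson_law \<mu>) \<in> borel_measurable radon_algebra"
    using laplace_measurable[OF tests_one_minus_exp[OF f]]
  proof (rule measurable_cong[THEN iffD1, rotated])
    fix \<mu> :: "'a measure" assume "\<mu> \<in> space radon_algebra"
    then have \<mu>: "\<mu> \<in> radon_measures" by (simp add: space_radon_algebra)
    show "laplace (\<lambda>x. 1 - exp (- f x)) \<mu> = (\<integral>\<phi>. laplace f \<phi> \<partial>poisson_law \<mu>)"
      by (rule laplace_poisson[symmetric, OF poisson_law_props(2,3)[OF \<mu>] poisson_law_process[OF \<mu>] \<mu> f])
  qed
qed

end

section \<open>Limits of random measures\<close>

text \<open>Countable additivity is an interchange of two sums of nonnegative terms, one of them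
  written as an integral over counting measure.\<close>

lemma suminf_measure_exists:
  assumes s: "\<And>k :: nat. sets (\<nu> k) = sets N"
  obtains \<mu> where "sets \<mu> = sets N" "\<And>B. B \<in> sets N \<Longrightarrow> emeasure \<mu> B = (\<Sum>k. emeasure (\<nu> k) B)"
proof -
  define \<mu> where "\<mu> = measure_of (space N) (sets N) (\<lambda>B. \<Sum>k. emeasure (\<nu> k) B)"
  have "countably_additive (sets N) (\<lambda>B. \<Sum>k. emeasure (\<nu> k) B)"
  proof (rule countably_additiveI)
    fix A :: "nat \<Rightarrow> 'a set" assume A: "range A \<subseteq> sets N" "disjoint_family A"
    have "(\<Sum>i. \<Sum>k. emeasure (\<nu> k) (A i)) = (\<Sum>i. \<integral>\<^sup>+k. emeasure (\<nu> k) (A i) \<partial>count_space UNIV)"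
      by (simp add: nn_integral_count_space_nat)
    also have "\<dots> = (\<integral>\<^sup>+k. (\<Sum>i. emeasure (\<nu> k) (A i)) \<partial>count_space UNIV)"
      by (rule nn_integral_suminf[symmetric]) simp
    also have "\<dots> = (\<integral>\<^sup>+k. emeasure (\<nu> k) (\<Union>i. A i) \<partial>count_space UNIV)"
      using A s by (intro nn_integral_cong suminf_emeasure) auto
    finally show "(\<Sum>i. \<Sum>k. emeasure (\<nu> k) (A i)) = (\<Sum>k. emeasure (\<nu> k) (\<Union>i. A i))"
      by (simp add: nn_integral_count_space_nat)
  qed
  then have "emeasure \<mu> B = (\<Sum>k. emeasure (\<nu> k) B)" if "B \<in> sets N" for B
    unfolding \<mu>_def by (rule emeasure_measure_of_sigma[rotated 2])
      (use that in \<open>auto simp: positive_def sets.sigma_algebra_axioms\<close>)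
  moreover have "sets \<mu> = sets N" by (simp add: \<mu>_def)
  ultimately show ?thesis using that by blast
qed

context relatively_compact_base
begin

text \<open>The codes of points are described by countably many conditions on cylinders. A family of
  sets of \<open>U\<close> closed under shrinking intersections (\<open>b = True\<close>) and decided by separation
  (\<open>b = False\<close>) consists, by compactness, of all \<open>U i\<close> around a single point.\<close>

definition cond_level :: "nat \<Rightarrow> nat \<Rightarrow> nat" where "cond_level i j = Suc (max i j)"

definition cond_pre :: "bool \<Rightarrow> nat \<Rightarrow> nat \<Rightarrow> nat set \<Rightarrow> bool" where
  "cond_pre b i j S \<longleftrightarrow> (if b then i \<in> S \<and> j \<in> S else closure (U i) \<subseteq> U j \<and> j \<notin> S)"

definition cond_post :: "bool \<Rightarrow> nat \<Rightarrow> nat \<Rightarrow> nat set" where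
  "cond_post b i j = (if b then {k. closure (U k) \<subseteq> U i \<inter> U j} else {k. U k \<inter> U i = {}})"

definition valid_code :: "nat set \<Rightarrow> bool" where
  "valid_code c \<longleftrightarrow> c \<noteq> {} \<and> (\<forall>b i j. cond_pre b i j (c \<inter> {..<cond_level i j}) \<longrightarrow> (\<exists>k\<in>cond_post b i j. k \<in> c))"

text \<open>The base property is applied to the open set \<open>U i \<inter> U j\<close> in one case
  and to the complement of \<open>closure (U i)\<close> in the other.\<close>

lemma cond_code:
  assumes "cond_pre b i j (code x \<inter> {..<cond_level i j})" shows "\<exists>k\<in>cond_post b i j. k \<in> code x"
proof (cases b)
  case True
  then have "x \<in> U i \<inter> U j" using assms by (auto simp: cond_pre_def code_def)
  then obtain k where "x \<in> U k" "closure (U k) \<subseteq> U i \<inter> U j"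
    using base_U[of "U i \<inter> U j" x] open_U by auto
  then show ?thesis using True by (auto simp: cond_post_def code_def)
next
  case False
  then have "closure (U i) \<subseteq> U j" "x \<notin> U j" using assms by (auto simp: cond_pre_def code_def cond_level_def)
  then have "x \<in> - closure (U i)" by auto
  then obtain k where k: "x \<in> U k" "closure (U k) \<subseteq> - closure (U i)"
    using base_U[of "- closure (U i)" x] by (auto simp: open_Compl)
  then have "U k \<inter> U i = {}" using closure_subset[of "U k"] closure_subset[of "U i"] by blast
  then show ?thesis using False k(1) by (auto simp: cond_post_def code_def)
qed

lemma code_inj: "code x = code y \<Longrightarrow> x = y"
proof (rule ccontr)
  assume eq: "code x = code y" and "x \<noteq> y"
  then obtain V where "open V" "x \<in> V" "y \<notin> V" using t1_space by blast
  then obtain i where "x \<in> U i" "closure (U i) \<subseteq> V" using base_U by blast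
  then have "i \<in> code x" "i \<notin> code y" using \<open>y \<notin> V\<close> closure_subset[of "U i"] by (auto simp: code_def)
  then show False using eq by simp
qed

text \<open>The closures of the members are directed, so they share a point in the compact set
  \<open>closure (U i0)\<close>. Shrinking puts this point into each member itself, and separation
  shows that no further \<open>U i\<close> contains it.\<close>

lemma valid_code_ex:
  assumes c: "valid_code c" shows "\<exists>x. code x = c"
proof -
  have shrink: "\<exists>k\<in>c. closure (U k) \<subseteq> U i \<inter> U j" if "i \<in> c" "j \<in> c" for i j
  proof -
    have "cond_pre True i j (c \<inter> {..<cond_level i j})" using that by (auto simp: cond_pre_def cond_level_def)
    then have "\<exists>k\<in>cond_post True i j. k \<in> c" using c unfolding valid_code_def by blast
    then show ?thesis by (auto simp: cond_post_def)
  qed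
  have sep: "\<exists>k\<in>c. U k \<inter> U i = {}" if "closure (U i) \<subseteq> U j" "j \<notin> c" for i j
  proof -
    have "cond_pre False i j (c \<inter> {..<cond_level i j})" using that by (auto simp: cond_pre_def)
    then have "\<exists>k\<in>cond_post False i j. k \<in> c" using c unfolding valid_code_def by blast
    then show ?thesis by (auto simp: cond_post_def)
  qed
  have dir: "\<exists>k\<in>c. closure (U k) \<subseteq> (\<Inter>i\<in>F. closure (U i))" if "finite F" "F \<subseteq> c" for F
    using that
  proof (induction F rule: finite_induct)
    case empty
    then show ?case using c by (auto simp: valid_code_def)
  next
    case (insert i F)
    then obtain k where k: "k \<in> c" "closure (U k) \<subseteq> (\<Inter>i\<in>F. closure (U i))" by auto
    obtain l where l: "l \<in> c" "closure (U l) \<subseteq> U i \<inter> U k" using shrink[of i k] insert k by auto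
    have "closure (U l) \<subseteq> closure (U i) \<inter> closure (U k)" using l(2) closure_subset by blast
    then show ?case using l(1) k(2) by blast
  qed
  obtain i0 where i0: "i0 \<in> c" using c by (auto simp: valid_code_def)
  have "closure (U i0) \<inter> (\<Inter>i\<in>c. closure (U i)) \<noteq> {}"
  proof (rule compact_imp_fip_image[OF compact_closure_U])
    fix F assume F: "finite F" "F \<subseteq> c"
    obtain k where k: "k \<in> c" "closure (U k) \<subseteq> (\<Inter>i\<in>insert i0 F. closure (U i))" using dir[of "insert i0 F"] F i0 by auto
    have "U k \<noteq> {}" by (rule nonempty_U)
    then show "closure (U i0) \<inter> (\<Inter>i\<in>F. closure (U i)) \<noteq> {}" using k(2) closure_subset[of "U k"] by blast
  qed simp
  then obtain x where x: "x \<in> (\<Inter>i\<in>c. closure (U i))" by auto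
  have xU: "x \<in> U i" if "i \<in> c" for i
    using shrink[OF that that] x by blast
  have "i \<in> c" if i: "x \<in> U i" for i
  proof (rule ccontr)
    assume "i \<notin> c"
    obtain j where j: "x \<in> U j" "closure (U j) \<subseteq> U i" using base_U[OF open_U i] by blast
    obtain k where "k \<in> c" "U k \<inter> U j = {}" using sep[OF j(2) \<open>i \<notin> c\<close>] by blast
    then show False using xU[of k] j(1) by blast
  qed
  then have "code x = c" using xU by (auto simp: code_def)
  then show ?thesis ..
qed


lemma valid_code_measurable [measurable]: "Measurable.pred code_algebra valid_code"
proof -
  have [measurable]: "Measurable.pred code_algebra (\<lambda>c. cond_pre b i j (c \<inter> {..<cond_level i j}))" for b i j
    using cylinder_code_algebra[of "cond_pre b i j" "cond_level i j"] by (simp add: pred_def)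
  have "Measurable.pred code_algebra (\<lambda>c. (\<exists>i. i \<in> c) \<and> (\<forall>b i j. cond_pre b i j (c \<inter> {..<cond_level i j}) \<longrightarrow> (\<exists>k. k \<in> cond_post b i j \<and> k \<in> c)))"
    by measurable
  also have "(\<lambda>c. (\<exists>i. i \<in> c) \<and> (\<forall>b i j. cond_pre b i j (c \<inter> {..<cond_level i j}) \<longrightarrow> (\<exists>k. k \<in> cond_post b i j \<and> k \<in> c))) = valid_code"
    by (auto simp: valid_code_def fun_eq_iff Bex_def)
  finally show ?thesis .
qed

definition decode :: "nat set \<Rightarrow> 'a" where "decode c = (THE x. code x = c)"

lemma code_decode: "valid_code c \<Longrightarrow> code (decode c) = c"
proof -
  assume "valid_code c"
  then obtain x where x: "code x = c" using valid_code_ex by blast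
  have "decode c = x" unfolding decode_def using x code_inj by (intro the_equality) auto
  then show ?thesis using x by simp
qed

lemma decode_measurable:
  assumes s: "sets \<mu> = sets code_algebra"
  shows "decode \<in> restrict_space \<mu> {c. valid_code c} \<rightarrow>\<^sub>M borel"
proof (rule measurable_sigma_sets[OF borel_eq_cyls])
  have sp: "space \<mu> = UNIV" using sets_eq_imp_space_eq[OF s] by simp
  fix A assume A: "A \<in> cyls"
  show "decode -` A \<inter> space (restrict_space \<mu> {c. valid_code c}) \<in> sets (restrict_space \<mu> {c. valid_code c})"
  proof (cases "A = {}")
    case False
    then obtain n S where A: "A = cyl n S" using A by (auto simp: cyls_def)
    have "decode -` A \<inter> space (restrict_space \<mu> {c. valid_code c}) = {c. valid_code c} \<inter> {c. c \<inter> {..<n} = S}"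
      by (auto simp: A sp space_restrict_space cyl_def code_decode)
    also have "\<dots> \<in> sets (restrict_space \<mu> {c. valid_code c})"
      using cylinder_code_algebra[of "\<lambda>R. R = S" n] by (auto simp: sets_restrict_space s)
    finally show ?thesis .
  qed simp
qed simp_all

section \<open>From weights on prefixes to a Radon measure\<close>

text \<open>Prefixes that violate a condition as far as can be seen at length \<open>n\<close>: the
  premise holds and no witness below \<open>n\<close> has appeared. Fixing the least element
  \<open>k\<close> confines attention to codes of layer \<open>k\<close>, a part of finite
  mass.\<close>

definition cond_prefixes :: "bool \<Rightarrow> nat \<Rightarrow> nat \<Rightarrow> nat \<Rightarrow> nat \<Rightarrow> nat set set" where
  "cond_prefixes b i j k n = {S\<in>Pow {..<n}. S \<inter> {..k} = {k} \<and> cond_pre b i j (S \<inter> {..<cond_level i j}) \<and> S \<inter> cond_post b i j = {}}"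

text \<open>The total mass may be infinite, so the weights are cut into systems \<open>q k\<close>
  of prefixes with least element \<open>k\<close>, each realised by a finite measure on codes. The
  hypothesis \<open>null\<close> makes the invalid codes a null set; the valid ones are carried to
  the space by \<open>decode\<close>, and the pieces are added up.\<close>

lemma measure_from_weights:
  fixes z :: "nat \<Rightarrow> nat set \<Rightarrow> real"
  assumes nonneg: "\<And>n S. 0 \<le> z n S"
    and split: "\<And>n S. S \<subseteq> {..<n} \<Longrightarrow> S \<noteq> {} \<Longrightarrow> z n S = z (Suc n) S + z (Suc n) (insert n S)"
    and null: "\<And>b i j k e. 0 < e \<Longrightarrow> \<exists>n>k. n \<ge> cond_level i j \<and> (\<Sum>S\<in>cond_prefixes b i j k n. z n S) < e"
  shows "\<exists>\<zeta>\<in>radon_measures. \<forall>n S. S \<subseteq> {..<n} \<longrightarrow> S \<noteq> {} \<longrightarrow> emeasure \<zeta> (cyl n S) = ennreal (z n S)"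
proof -
  \<comment> \<open>A set with least element \<open>k\<close> has only empty prefixes up to length
    \<open>k\<close>, so the empty prefix carries the whole mass \<open>z (Suc k) {k}\<close>
    there.\<close>
  define q where "q k n S = (if k < n then (if S \<inter> {..k} = {k} then z n S else 0) else if S = {} then z (Suc k) {k} else 0)"
    for k n S
  have q0: "0 \<le> q k n S" for k n S using nonneg by (simp add: q_def)
  have q_split: "q k n S = q k (Suc n) S + q k (Suc n) (insert n S)" if S: "S \<subseteq> {..<n}" for k n S
  proof -
    consider "k < n" | "k = n" | "n < k" by linarith
    then show ?thesis
    proof cases
      case 1
      then have "insert n S \<inter> {..k} = S \<inter> {..k}" by auto
      then show ?thesis using split[OF S] 1 by (auto simp: q_def)
    next
      case 2
      have "S \<inter> {..k} = S" using S 2 by auto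
      moreover have "insert n S \<inter> {..k} = insert k S" using S 2 by auto
      moreover have "k \<notin> S" using S 2 by auto
      ultimately show ?thesis using 2 by (auto simp: q_def)
    next
      case 3
      then show ?thesis by (auto simp: q_def)
    qed
  qed
  have "\<exists>\<mu>. sets \<mu> = sets code_algebra \<and> (\<forall>n S. S \<subseteq> {..<n} \<longrightarrow> emeasure \<mu> {c. c \<inter> {..<n} = S} = ennreal (q k n S))" for k
    by (rule tree_measure_exists[of "q k", OF q0 q_split], assumption) blast
  then obtain \<mu> where \<mu>s: "\<And>k. sets (\<mu> k) = sets code_algebra"
    and \<mu>: "\<And>k n S. S \<subseteq> {..<n} \<Longrightarrow> emeasure (\<mu> k) {c. c \<inter> {..<n} = S} = ennreal (q k n S)" by metis
  have sp: "space (\<mu> k) = UNIV" for k using sets_eq_imp_space_eq[OF \<mu>s] by simp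
  have cylm: "emeasure (\<mu> k) {c. P (c \<inter> {..<n})} = (\<Sum>S\<in>{S\<in>Pow {..<n}. P S}. ennreal (q k n S))" for k n P
  proof -
    have eq: "{c. P (c \<inter> {..<n})} = (\<Union>S\<in>{S\<in>Pow {..<n}. P S}. {c. c \<inter> {..<n} = S})" by auto
    have "emeasure (\<mu> k) {c. P (c \<inter> {..<n})} = (\<Sum>S\<in>{S\<in>Pow {..<n}. P S}. emeasure (\<mu> k) {c. c \<inter> {..<n} = S})"
      unfolding eq using cylinder_code_algebra[of "\<lambda>R. R = _" n]
      by (intro sum_emeasure[symmetric]) (auto simp: disjoint_family_on_def \<mu>s)
    then show ?thesis using \<mu> by simp
  qed
  have valid: "AE c in \<mu> k. valid_code c" for k
  proof -
    have "AE c in \<mu> k. \<not> (c \<inter> {..<Suc k} = {})"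
    proof (rule AE_not_in[of "{c. c \<inter> {..<Suc k} = {}}", simplified])
      show "{c. c \<inter> {..<Suc k} = {}} \<in> null_sets (\<mu> k)"
        using \<mu>[of "{}" "Suc k" k] cylinder_code_algebra[of "\<lambda>R. R = {}" "Suc k"] by (auto simp: null_sets_def \<mu>s q_def)
    qed
    moreover have "AE c in \<mu> k. \<forall>b i j. cond_pre b i j (c \<inter> {..<cond_level i j}) \<longrightarrow> (\<exists>l\<in>cond_post b i j. l \<in> c)"
      unfolding AE_all_countable
    proof (intro allI)
      fix b i j
      let ?B = "{c. cond_pre b i j (c \<inter> {..<cond_level i j}) \<and> c \<inter> cond_post b i j = {}}"
      have Bs: "?B \<in> sets (\<mu> k)"
      proof -
        have [measurable]: "Measurable.pred code_algebra (\<lambda>c. cond_pre b i j (c \<inter> {..<cond_level i j}))"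
          using cylinder_code_algebra[of "cond_pre b i j" "cond_level i j"] by (simp add: pred_def)
        have "?B = {c\<in>space code_algebra. cond_pre b i j (c \<inter> {..<cond_level i j}) \<and> (\<forall>l. l \<in> cond_post b i j \<longrightarrow> \<not> l \<in> c)}" by auto
        also have "\<dots> \<in> sets code_algebra" by measurable
        finally show ?thesis by (simp add: \<mu>s)
      qed
      have le: "emeasure (\<mu> k) ?B \<le> ennreal e" if "0 < e" for e
      proof -
        from null[OF that, of k i j b] obtain n where n: "n > k" "n \<ge> cond_level i j"
          "(\<Sum>S\<in>cond_prefixes b i j k n. z n S) < e" by blast
        let ?P = "\<lambda>S. cond_pre b i j (S \<inter> {..<cond_level i j}) \<and> S \<inter> cond_post b i j = {}"
        \<comment> \<open>A code without any witness has none below \<open>n\<close> either, so the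
          violation lies in a cylinder set whose mass is the sum made small by
          \<open>null\<close>.\<close>
        have sub: "?B \<subseteq> {c. ?P (c \<inter> {..<n})}"
        proof
          fix c assume c: "c \<in> ?B"
          have "c \<inter> {..<n} \<inter> {..<cond_level i j} = c \<inter> {..<cond_level i j}" using n(2) by auto
          then show "c \<in> {c. ?P (c \<inter> {..<n})}" using c by auto
        qed
        have "emeasure (\<mu> k) ?B \<le> emeasure (\<mu> k) {c. ?P (c \<inter> {..<n})}"
          by (rule emeasure_mono[OF sub]) (unfold \<mu>s, rule cylinder_code_algebra[of ?P n])
        also have "\<dots> = (\<Sum>S\<in>{S\<in>Pow {..<n}. ?P S}. ennreal (q k n S))" by (rule cylm)
        also have "\<dots> = (\<Sum>S\<in>cond_prefixes b i j k n. ennreal (z n S))"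
          by (rule sum.mono_neutral_cong_right) (use n(1) in \<open>auto simp: cond_prefixes_def q_def\<close>)
        also have "\<dots> = ennreal (\<Sum>S\<in>cond_prefixes b i j k n. z n S)" using nonneg by (intro sum_ennreal)
        also have "\<dots> \<le> ennreal e" using n(3) by (intro ennreal_leI) simp
        finally show ?thesis .
      qed
      have "emeasure (\<mu> k) ?B = 0"
      proof (rule ccontr)
        assume ne: "emeasure (\<mu> k) ?B \<noteq> 0"
        have fin: "emeasure (\<mu> k) ?B < top" using le[of 1] by (auto simp: le_less_trans)
        then obtain v where "emeasure (\<mu> k) ?B = ennreal v" "0 \<le> v" by (cases "emeasure (\<mu> k) ?B") auto
        with ne have v: "emeasure (\<mu> k) ?B = ennreal v" "0 < v" by (cases "v = 0", auto)
        have "ennreal v \<le> ennreal (v / 2)" using le[of "v / 2"] v by simp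
        then show False using v(2) by simp
      qed
      then have "AE c in \<mu> k. c \<notin> ?B" using Bs by (intro AE_not_in) (auto simp: null_sets_def)
      then show "AE c in \<mu> k. cond_pre b i j (c \<inter> {..<cond_level i j}) \<longrightarrow> (\<exists>l\<in>cond_post b i j. l \<in> c)"
        by eventually_elim auto
    qed
    ultimately show ?thesis by eventually_elim (auto simp: valid_code_def)
  qed
  define \<nu> where "\<nu> k = distr (restrict_space (\<mu> k) {c. valid_code c}) borel decode" for k
  have \<nu>: "emeasure (\<nu> k) (cyl n S) = ennreal (q k n S)" if S: "S \<subseteq> {..<n}" for k n S
  proof -
    have vm: "{c. valid_code c} \<in> sets (\<mu> k)" using valid_code_measurable by (simp add: pred_def \<mu>s)
    have cm: "{c. c \<inter> {..<n} = S} \<in> sets (\<mu> k)" by (simp only: \<mu>s cylinder_code_algebra[of "\<lambda>R. R = S"])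
    have "emeasure (\<nu> k) (cyl n S) = emeasure (restrict_space (\<mu> k) {c. valid_code c})
        (decode -` cyl n S \<inter> space (restrict_space (\<mu> k) {c. valid_code c}))"
      unfolding \<nu>_def by (rule emeasure_distr[OF decode_measurable[OF \<mu>s] cyl_borel])
    also have "decode -` cyl n S \<inter> space (restrict_space (\<mu> k) {c. valid_code c}) = {c. c \<inter> {..<n} = S} \<inter> {c. valid_code c}"
      by (auto simp: sp space_restrict_space cyl_def code_decode)
    also have "emeasure (restrict_space (\<mu> k) {c. valid_code c}) ({c. c \<inter> {..<n} = S} \<inter> {c. valid_code c})
        = emeasure (\<mu> k) ({c. c \<inter> {..<n} = S} \<inter> {c. valid_code c})"
      by (rule emeasure_restrict_space) (use vm in \<open>auto simp: sp\<close>)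
    also have "\<dots> = emeasure (\<mu> k) {c. c \<inter> {..<n} = S}"
      by (rule emeasure_eq_AE) (use valid[of k] vm cm in \<open>auto elim: eventually_mono\<close>)
    also have "\<dots> = ennreal (q k n S)" by (rule \<mu>[OF S])
    finally show ?thesis .
  qed
  obtain \<zeta> where \<zeta>: "sets \<zeta> = sets borel" "\<And>B. B \<in> sets borel \<Longrightarrow> emeasure \<zeta> B = (\<Sum>k. emeasure (\<nu> k) B)"
    by (rule suminf_measure_exists[of \<nu> borel]) (simp_all add: \<nu>_def)
  \<comment> \<open>Only the piece belonging to the least element of \<open>S\<close> gives mass to
    this cylinder.\<close>
  have \<zeta>c: "emeasure \<zeta> (cyl n S) = ennreal (z n S)" if S: "S \<subseteq> {..<n}" "S \<noteq> {}" for n S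
  proof -
    obtain s where "s \<in> S" using S(2) by auto
    define k where "k = (LEAST s. s \<in> S)"
    have k: "k \<in> S" unfolding k_def using \<open>s \<in> S\<close> by (rule LeastI)
    have kl: "k \<le> s" if "s \<in> S" for s unfolding k_def using that by (rule Least_le)
    have kn: "k < n" using k S(1) by auto
    have 1: "q k n S = z n S" using kn k kl by (auto simp: q_def dest: kl)
    have 2: "q l n S = 0" if "l \<noteq> k" for l
    proof -
      have "S \<inter> {..l} \<noteq> {l}" using that k kl by (metis Int_iff atMost_iff le_antisym nle_le order_refl singletonD singletonI)
      then show ?thesis using S(2) by (simp add: q_def)
    qed
    have "emeasure \<zeta> (cyl n S) = (\<Sum>l. ennreal (q l n S))" using \<zeta>(2)[OF cyl_borel] \<nu>[OF S(1)] by simp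
    also have "\<dots> = (\<Sum>l\<in>{k}. ennreal (q l n S))" by (rule suminf_finite) (auto simp: 2)
    finally show ?thesis using 1 by simp
  qed
  have "\<zeta> \<in> radon_measures"
    unfolding radon_measures_def
  proof (intro CollectI conjI ballI impI \<zeta>(1))
    fix B :: "'a set" assume "B \<in> sets borel" "relatively_compact B"
    then obtain n where n: "B \<subseteq> (\<Union>i<n. U i)" using relatively_compact_bounded by blast
    have eq: "(\<Union>i<n. U i) = {x. code x \<inter> {..<n} \<noteq> {}}" by (auto simp: code_def)
    have "emeasure \<zeta> B \<le> emeasure \<zeta> {x. code x \<inter> {..<n} \<noteq> {}}"
      using n unfolding eq by (rule emeasure_mono) (simp only: \<zeta>(1) cylinder_borel[of "\<lambda>R. R \<noteq> {}"])
    also have "\<dots> = (\<Sum>S\<in>{S\<in>Pow {..<n}. S \<noteq> {}}. emeasure \<zeta> (cyl n S))" by (rule emeasure_cylinder[OF \<zeta>(1)])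
    also have "\<dots> = (\<Sum>S\<in>{S\<in>Pow {..<n}. S \<noteq> {}}. ennreal (z n S))" by (rule sum.cong) (auto simp: \<zeta>c)
    also have "\<dots> < \<infinity>" using nonneg by (simp add: sum_ennreal)
    finally show "emeasure \<zeta> B < \<infinity>" .
  qed
  then show ?thesis using \<zeta>c by blast
qed


section \<open>Existence of the limiting random measure\<close>

text \<open>\<open>L_zero\<close> is a continuity property at 0 under domination and is used twice:
  for small multiples of one cylinder indicator, which gives finite masses, and for indicators of
  violated conditions, which confines the mass to codes of points. Additivity of the limit needs a
  separate second moment argument.\<close>

lemma random_measure_exists:
  assumes P: "\<And>n. prob_space (P n)" and sP: "\<And>n. sets (P n) = sets (radon_algebra :: 'a measure measure)"
    and L: "\<And>f. f \<in> tests \<Longrightarrow> (\<lambda>n. \<integral>\<phi>. laplace f \<phi> \<partial>P n) \<longlonglongrightarrow> L f"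
    and L_zero: "\<And>f g. (\<And>m :: nat. f m \<in> tests) \<Longrightarrow> g \<in> tests \<Longrightarrow> (\<And>m x. f m x \<le> g x) \<Longrightarrow>
      (\<And>x. (\<lambda>m. f m x) \<longlonglongrightarrow> 0) \<Longrightarrow> (\<lambda>m. L (f m)) \<longlonglongrightarrow> 1"
  obtains Z where "prob_space Z" "sets Z = sets (radon_algebra :: 'a measure measure)"
    "\<And>f. f \<in> tests \<Longrightarrow> (\<integral>\<phi>. laplace f \<phi> \<partial>Z) = L f"
proof -
  \<comment> \<open>Pairs of a length and a finite prefix are numbered so that cylinder masses form
    one sequence. Empty prefixes count as improper, since their cylinders may have infinite
    mass.\<close>
  define piece where "piece j = (case prod_decode j of (n, m) \<Rightarrow> cyl n (set_decode m))" for j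
  define proper where "proper j \<longleftrightarrow> set_decode (snd (prod_decode j)) \<noteq> {}" for j
  define idx where "idx n S = prod_encode (n, set_encode S)" for n S
  have idx: "piece (idx n S) = cyl n S" "proper (idx n S) \<longleftrightarrow> S \<noteq> {}" if "S \<subseteq> {..<n}" for n S
    using finite_subset[OF that] by (auto simp: piece_def proper_def idx_def set_encode_inverse)
  define V where "V j \<phi> = (if proper j then 1 - exp (- measure \<phi> (piece j)) else 0)" for j and \<phi> :: "'a measure"
  have V01: "V j \<phi> \<in> {0..<1}" for j \<phi> by (auto simp: V_def)
  have piece_borel: "piece j \<in> sets borel" for j by (auto simp: piece_def split: prod.split)
  have Vm: "V j \<in> borel_measurable (P n)" for j n
  proof -
    have [measurable]: "(\<lambda>\<phi>. emeasure \<phi> (piece j)) \<in> borel_measurable (P n)"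
      using measurable_emeasure_radon[OF piece_borel] measurable_cong_sets[OF sP refl] by blast
    show ?thesis unfolding V_def[abs_def] measure_def by measurable
  qed
  obtain r Q and v :: "nat \<Rightarrow> nat set \<Rightarrow> real" where r: "strict_mono r" and Q: "prob_space Q"
    and vm': "\<forall>j. v j \<in> borel_measurable Q" and v01': "\<forall>j c. v j c \<in> {0..1}"
    and vlim: "\<forall>J g. finite J \<longrightarrow> (\<forall>j\<in>J. continuous_on {0..1} (g j) \<and> (\<forall>x\<in>{0..1}. g j x \<in> {0..1::real})) \<longrightarrow>
       (\<lambda>n. \<integral>y. (\<Prod>j\<in>J. g j (V j y)) \<partial>P (r n)) \<longlonglongrightarrow> (\<integral>c. (\<Prod>j\<in>J. g j (v j c)) \<partial>Q)"
    using weak_limit_exists[of P V, OF P Vm V01] by - (elim exE conjE, rule that)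
  have vm: "v j \<in> borel_measurable Q" and v01: "v j c \<in> {0..1}" for j c using vm' v01' by auto
  interpret Q: prob_space Q by fact
  \<comment> \<open>The limiting counterpart of \<open>exp (- measure \<phi> (cyl n S))\<close>; the
    value 0 would correspond to infinite mass.\<close>
  define w where "w n S c = 1 - v (idx n S) c" for n S c
  have wm [measurable]: "w n S \<in> borel_measurable Q" for n S using vm by (simp add: w_def[abs_def])
  have w01: "0 \<le> w n S c" "w n S c \<le> 1" for n S c using v01[of "idx n S" c] by (auto simp: w_def)
  \<comment> \<open>Exponents are positive because only then is \<open>(1 - x) powr a\<close>
    continuous at \<open>x = 1\<close>.\<close>
  have wlim: "(\<lambda>n. \<integral>\<phi>. (\<Prod>p\<in>J. exp (- measure \<phi> (cyl (fst p) (snd p))) powr a p) \<partial>P (r n))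
      \<longlonglongrightarrow> (\<integral>c. (\<Prod>p\<in>J. w (fst p) (snd p) c powr a p) \<partial>Q)"
    if J: "finite J" "\<And>p. p \<in> J \<Longrightarrow> snd p \<subseteq> {..<fst p} \<and> snd p \<noteq> {}" and a: "\<And>p. p \<in> J \<Longrightarrow> 0 < a p"
    for J and a :: "nat \<times> nat set \<Rightarrow> real"
  proof -
    define i where "i p = idx (fst p) (snd p)" for p
    have inj: "inj_on i J"
    proof (rule inj_onI)
      fix p p' assume pp: "p \<in> J" "p' \<in> J" "i p = i p'"
      have "finite (snd p)" "finite (snd p')" using J(2)[OF pp(1)] J(2)[OF pp(2)] finite_subset by blast+
      then show "p = p'" using pp(3) unfolding i_def idx_def by (auto simp: prod_eq_iff dest: arg_cong[of _ _ set_decode] simp: set_encode_inverse)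
    qed
    define g where "g j x = (1 - x) powr a (inv_into J i j)" for j x
    have ai: "0 < a (inv_into J i j)" if "j \<in> i ` J" for j using that a by (auto simp: inv_into_f_f[OF inj])
    have "(\<lambda>n. \<integral>y. (\<Prod>j\<in>i ` J. g j (V j y)) \<partial>P (r n)) \<longlonglongrightarrow> (\<integral>c. (\<Prod>j\<in>i ` J. g j (v j c)) \<partial>Q)"
    proof (rule vlim[rule_format], use J in simp, intro ballI conjI)
      show "continuous_on {0..1} (g j)" if "j \<in> i ` J" for j
        unfolding g_def using ai[OF that] by (intro continuous_on_powr' continuous_intros) auto
      show "g j x \<in> {0..1}" if "j \<in> i ` J" "x \<in> {0..1}" for j x
        using ai[OF that(1)] that(2) by (auto simp: g_def powr_le1)
    qed
    moreover have Vi: "V (i p) \<phi> = 1 - exp (- measure \<phi> (cyl (fst p) (snd p)))" if "p \<in> J" for p \<phi>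
      using J(2)[OF that] by (simp add: V_def i_def idx)
    moreover have "(\<Prod>j\<in>i ` J. g j (V j \<phi>)) = (\<Prod>p\<in>J. exp (- measure \<phi> (cyl (fst p) (snd p))) powr a p)" for \<phi>
      unfolding prod.reindex[OF inj] comp_def
      by (rule prod.cong) (auto simp: g_def inv_into_f_f[OF inj] Vi)
    moreover have gi: "g (i p) x = (1 - x) powr a p" if "p \<in> J" for p x using that by (simp add: g_def inv_into_f_f[OF inj])
    moreover have wi: "w (fst p) (snd p) c = 1 - v (i p) c" for p c by (simp add: w_def i_def)
    moreover have "(\<Prod>j\<in>i ` J. g j (v j c)) = (\<Prod>p\<in>J. w (fst p) (snd p) c powr a p)" for c
      unfolding prod.reindex[OF inj] comp_def
      by (rule prod.cong) (simp_all add: gi wi)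
    ultimately show ?thesis by simp
  qed
  have radonP: "\<phi> \<in> radon_measures" if "\<phi> \<in> space (P n)" for \<phi> n
    using that sets_eq_imp_space_eq[OF sP] by (auto simp: space_radon_algebra)
  \<comment> \<open>Prefixes with exponent 0 are left out: as \<open>0 powr 0 = 0\<close>, they
    would spoil the product where \<open>w\<close> vanishes.\<close>
  have E1: "(\<integral>c. (\<Prod>S\<in>{S\<in>Pow {..<n} - {{}}. a S \<noteq> 0}. w n S c powr a S) \<partial>Q) = L (\<lambda>x. a (code x \<inter> {..<n}))"
    if a: "a {} = 0" "\<And>S. 0 \<le> a S" for n a
  proof -
    let ?I = "{S\<in>Pow {..<n} - {{}}. a S \<noteq> 0}" and ?J = "Pair n ` {S\<in>Pow {..<n} - {{}}. a S \<noteq> 0}"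
    have T: "(\<lambda>x. a (code x \<inter> {..<n})) \<in> tests" using a by (auto simp: tests_def)
    have re: "(\<Prod>p\<in>?J. h (fst p) (snd p)) = (\<Prod>S\<in>?I. h n S)" for h :: "nat \<Rightarrow> nat set \<Rightarrow> real"
      by (subst prod.reindex) (auto simp: inj_on_def)
    have "(\<lambda>m. \<integral>\<phi>. (\<Prod>p\<in>?J. exp (- measure \<phi> (cyl (fst p) (snd p))) powr a (snd p)) \<partial>P (r m))
      \<longlonglongrightarrow> (\<integral>c. (\<Prod>p\<in>?J. w (fst p) (snd p) c powr a (snd p)) \<partial>Q)"
      by (rule wlim) (use a in \<open>auto simp: less_le\<close>)
    then have 1: "(\<lambda>m. \<integral>\<phi>. (\<Prod>S\<in>?I. exp (- measure \<phi> (cyl n S)) powr a S) \<partial>P (r m))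
      \<longlonglongrightarrow> (\<integral>c. (\<Prod>S\<in>?I. w n S c powr a S) \<partial>Q)"
      using re[of "\<lambda>n S. exp (- measure _ (cyl n S)) powr a S"] re[of "\<lambda>n S. w n S _ powr a S"] by simp
    have "(\<integral>\<phi>. (\<Prod>S\<in>?I. exp (- measure \<phi> (cyl n S)) powr a S) \<partial>P m) = (\<integral>\<phi>. laplace (\<lambda>x. a (code x \<inter> {..<n})) \<phi> \<partial>P m)" for m
    proof (rule Bochner_Integration.integral_cong[OF refl])
      fix \<phi> assume "\<phi> \<in> space (P m)"
      then have \<phi>: "\<phi> \<in> radon_measures" by (rule radonP)
      have "(\<Sum>S\<in>Pow {..<n} - {{}}. a S * measure \<phi> (cyl n S)) = (\<Sum>S\<in>?I. a S * measure \<phi> (cyl n S))"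
        by (rule sum.mono_neutral_right) auto
      then show "(\<Prod>S\<in>?I. exp (- measure \<phi> (cyl n S)) powr a S) = laplace (\<lambda>x. a (code x \<inter> {..<n})) \<phi>"
        by (simp add: laplace_def integral_test(2)[where a=a and n=n, OF \<phi> a(1)] exp_sum sum_negf[symmetric] powr_def)
    qed
    with 1 have "(\<lambda>m. \<integral>\<phi>. laplace (\<lambda>x. a (code x \<inter> {..<n})) \<phi> \<partial>P (r m)) \<longlonglongrightarrow> (\<integral>c. (\<Prod>S\<in>?I. w n S c powr a S) \<partial>Q)" by simp
    moreover have "(\<lambda>m. \<integral>\<phi>. laplace (\<lambda>x. a (code x \<inter> {..<n})) \<phi> \<partial>P (r m)) \<longlonglongrightarrow> L (\<lambda>x. a (code x \<inter> {..<n}))"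
      using LIMSEQ_subseq_LIMSEQ[OF L[OF T] r(1)] by (simp add: comp_def)
    ultimately show ?thesis by (rule LIMSEQ_unique)
  qed
  have bounded: "integrable Q h" if "h \<in> borel_measurable Q" "\<And>c. 0 \<le> h c" "\<And>c. h c \<le> 1" for h :: "nat set \<Rightarrow> real"
    using that by (intro Q.integrable_const_bound[where B=1] AE_I2) auto
  \<comment> \<open>Powers of \<open>w\<close> with exponent \<open>1 / real (Suc m)\<close> tend to
    the indicator of positivity, while \<open>L\<close> of the corresponding tests tends to 1; so
    \<open>w\<close> is positive almost surely.\<close>
  have pos: "AE c in Q. w n S c > 0" if S: "S \<subseteq> {..<n}" "S \<noteq> {}" for n S
  proof -
    have l1: "(\<lambda>m. 1 / real (Suc m)) \<longlonglongrightarrow> 0"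
      using LIMSEQ_inverse_real_of_nat by (simp add: inverse_eq_divide)
    define a where "a m R = (if R = S then 1 / real (Suc m) else 0)" for m R
    have I: "{R\<in>Pow {..<n} - {{}}. a m R \<noteq> 0} = {S}" for m using S by (auto simp: a_def)
    have "(\<integral>c. w n S c powr (1 / real (Suc m)) \<partial>Q) = L (\<lambda>x. a m (code x \<inter> {..<n}))" for m
      using E1[of "a m" n] S(2) unfolding I by (simp add: a_def)
    moreover have "(\<lambda>m. L (\<lambda>x. a m (code x \<inter> {..<n}))) \<longlonglongrightarrow> 1"
    proof (rule L_zero[where g="indicator (cyl n S)"])
      show "(\<lambda>x. a m (code x \<inter> {..<n})) \<in> tests" for m using S(2) by (auto simp: tests_def a_def intro!: exI[of _ n] exI[of _ "a m"])
      show "indicator (cyl n S) \<in> tests" by (rule tests_indicator_cyl[OF S(2)])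
      show "a m (code x \<inter> {..<n}) \<le> indicator (cyl n S) x" for m x by (auto simp: a_def cyl_def field_simps)
      show "(\<lambda>m. a m (code x \<inter> {..<n})) \<longlonglongrightarrow> 0" for x
        using l1 by (cases "code x \<inter> {..<n} = S") (simp_all add: a_def del: of_nat_Suc)
    qed
    ultimately have "(\<lambda>m. \<integral>c. w n S c powr (1 / real (Suc m)) \<partial>Q) \<longlonglongrightarrow> 1" by simp
    moreover have "(\<lambda>m. \<integral>c. w n S c powr (1 / real (Suc m)) \<partial>Q) \<longlonglongrightarrow> (\<integral>c. indicator {c\<in>space Q. w n S c > 0} c \<partial>Q)"
    proof (rule integral_dominated_convergence[where w="\<lambda>_. 1"])
      show "AE c in Q. (\<lambda>m. w n S c powr (1 / real (Suc m))) \<longlonglongrightarrow> indicator {c\<in>space Q. w n S c > 0} c"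
      proof (rule AE_I2)
        fix c assume c: "c \<in> space Q"
        have "(\<lambda>m. w n S c powr (1 / real (Suc m))) \<longlonglongrightarrow> w n S c powr 0" if "w n S c \<noteq> 0"
          using that l1 by (intro tendsto_powr tendsto_const)
        then show "(\<lambda>m. w n S c powr (1 / real (Suc m))) \<longlonglongrightarrow> indicator {c\<in>space Q. w n S c > 0} c"
          using w01(1)[of n S c] c by (cases "w n S c = 0") auto
      qed
      show "AE c in Q. norm (w n S c powr (1 / real (Suc m))) \<le> 1" for m
        using w01 by (intro AE_I2) (simp add: powr_le1)
    qed auto
    ultimately have "(\<integral>c. indicator {c\<in>space Q. w n S c > 0} c \<partial>Q) = (1::real)" using LIMSEQ_unique by blast
    then have "Q.prob {c\<in>space Q. w n S c > 0} = 1" by simp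
    then show ?thesis by (subst (asm) Q.prob_Collect_eq_1) auto
  qed
  \<comment> \<open>Let \<open>a\<close> be the left-hand and \<open>b\<close> the right-hand side.
    Before the limit both are the same random variable, so the means of \<open>a * a\<close>,
    \<open>a * b\<close> and \<open>b * b\<close> are limits of the same integrals, and the mean
    square of \<open>a - b\<close> is 0.\<close>
  have additive: "AE c in Q. w n S c = w (Suc n) S c * w (Suc n) (insert n S) c" if S: "S \<subseteq> {..<n}" "S \<noteq> {}" for n S
  proof -
    let ?p0 = "(n, S)" and ?p1 = "(Suc n, S)" and ?p2 = "(Suc n, insert n S)"
    have S': "S \<subseteq> {..<Suc n}" "insert n S \<subseteq> {..<Suc n}" and nS: "n \<notin> S" using S by auto
    have prod_eq: "measure \<phi> (cyl n S) = measure \<phi> (cyl (Suc n) S) + measure \<phi> (cyl (Suc n) (insert n S))" if "\<phi> \<in> radon_measures" for \<phi>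
    proof -
      have "cyl n S = cyl (Suc n) S \<union> cyl (Suc n) (insert n S)" using nS S by (auto simp: cyl_def lessThan_Suc)
      moreover have "cyl (Suc n) S \<inter> cyl (Suc n) (insert n S) = {}" using nS by (auto simp: cyl_def)
      ultimately show ?thesis
        using radon_finite[OF that cyl_borel relatively_compact_cyl] S(2)
        by (simp only:) (rule measure_Union, auto simp: radon_sets[OF that] less_top[symmetric])
    qed
    have powr2: "x powr 2 = x\<^sup>2" if "0 \<le> x" for x :: real using that by (cases "x = 0") (auto simp: powr_numeral)
    have neq: "S \<noteq> insert n S" using nS by blast
    have ep: "exp (- m) powr 2 = exp (- 2 * m)" for m :: real by (simp add: powr_def)
    let ?X = "\<lambda>\<phi>. exp (- 2 * measure \<phi> (cyl n S))"
    have c0: "(\<lambda>m. \<integral>\<phi>. ?X \<phi> \<partial>P (r m)) \<longlonglongrightarrow> (\<integral>c. (w n S c)\<^sup>2 \<partial>Q)"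
      using wlim[of "{?p0}" "\<lambda>_. 2"] S by (simp add: powr2[OF w01(1)] ep)
    have "(\<lambda>m. \<integral>\<phi>. (\<Prod>p\<in>{?p0, ?p1, ?p2}. exp (- measure \<phi> (cyl (fst p) (snd p))) powr 1) \<partial>P (r m))
      \<longlonglongrightarrow> (\<integral>c. (\<Prod>p\<in>{?p0, ?p1, ?p2}. w (fst p) (snd p) c powr 1) \<partial>Q)"
      using S S' by (intro wlim) auto
    moreover have "(\<Prod>p\<in>{?p0, ?p1, ?p2}. w (fst p) (snd p) c powr 1) = w n S c * (w (Suc n) S c * w (Suc n) (insert n S) c)" for c
      using neq w01 by simp
    moreover have "(\<integral>\<phi>. (\<Prod>p\<in>{?p0, ?p1, ?p2}. exp (- measure \<phi> (cyl (fst p) (snd p))) powr 1) \<partial>P m) = (\<integral>\<phi>. ?X \<phi> \<partial>P m)" for m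
      using neq by (intro Bochner_Integration.integral_cong) (auto simp: prod_eq[OF radonP] exp_add[symmetric])
    ultimately have c1: "(\<lambda>m. \<integral>\<phi>. ?X \<phi> \<partial>P (r m)) \<longlonglongrightarrow> (\<integral>c. w n S c * (w (Suc n) S c * w (Suc n) (insert n S) c) \<partial>Q)" by simp
    have "(\<lambda>m. \<integral>\<phi>. (\<Prod>p\<in>{?p1, ?p2}. exp (- measure \<phi> (cyl (fst p) (snd p))) powr 2) \<partial>P (r m))
      \<longlonglongrightarrow> (\<integral>c. (\<Prod>p\<in>{?p1, ?p2}. w (fst p) (snd p) c powr 2) \<partial>Q)"
      using S S' by (intro wlim) auto
    moreover have "(\<Prod>p\<in>{?p1, ?p2}. w (fst p) (snd p) c powr 2) = (w (Suc n) S c * w (Suc n) (insert n S) c)\<^sup>2" for c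
      using neq w01 by (simp add: powr2 power_mult_distrib)
    moreover have "(\<integral>\<phi>. (\<Prod>p\<in>{?p1, ?p2}. exp (- measure \<phi> (cyl (fst p) (snd p))) powr 2) \<partial>P m) = (\<integral>\<phi>. ?X \<phi> \<partial>P m)" for m
      using neq by (intro Bochner_Integration.integral_cong) (auto simp: prod_eq[OF radonP] exp_add[symmetric] ep algebra_simps)
    ultimately have c2: "(\<lambda>m. \<integral>\<phi>. ?X \<phi> \<partial>P (r m)) \<longlonglongrightarrow> (\<integral>c. (w (Suc n) S c * w (Suc n) (insert n S) c)\<^sup>2 \<partial>Q)" by simp
    let ?a = "\<lambda>c. w n S c" and ?b = "\<lambda>c. w (Suc n) S c * w (Suc n) (insert n S) c"
    have b01: "0 \<le> ?b c" "?b c \<le> 1" for c using w01 by (auto intro: mult_le_one)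
    have i: "integrable Q (\<lambda>c. (?a c)\<^sup>2)" "integrable Q (\<lambda>c. ?a c * ?b c)" "integrable Q (\<lambda>c. (?b c)\<^sup>2)"
      using w01 b01 by (auto intro!: bounded mult_le_one power_le_one)
    have "(\<integral>c. (?a c - ?b c)\<^sup>2 \<partial>Q) = (\<integral>c. (?a c)\<^sup>2 - 2 * (?a c * ?b c) + (?b c)\<^sup>2 \<partial>Q)"
      by (simp add: power2_diff algebra_simps)
    also have "\<dots> = (\<integral>c. (?a c)\<^sup>2 \<partial>Q) - 2 * (\<integral>c. ?a c * ?b c \<partial>Q) + (\<integral>c. (?b c)\<^sup>2 \<partial>Q)" using i by simp
    also have "\<dots> = 0" using LIMSEQ_unique[OF c0 c1] LIMSEQ_unique[OF c0 c2] by simp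
    finally have z: "(\<integral>c. (?a c - ?b c)\<^sup>2 \<partial>Q) = 0" .
    have "\<bar>?a c - ?b c\<bar> \<le> 1" for c using w01[of n S c] b01[of c] by auto
    then have "(?a c - ?b c)\<^sup>2 \<le> 1" for c by (simp add: abs_square_le_1)
    then have "integrable Q (\<lambda>c. (?a c - ?b c)\<^sup>2)" by (intro bounded) auto
    from integral_nonneg_eq_0_iff_AE[OF this] z have "AE c in Q. (?a c - ?b c)\<^sup>2 = 0" by auto
    then show ?thesis by eventually_elim simp
  qed
  \<comment> \<open>In terms of the weights this is 1 minus the exponential of minus their sum over
    the violating prefixes, a bounded substitute for the sum itself.\<close>
  define h where "h b i j k m c = 1 - (\<Prod>S\<in>cond_prefixes b i j k m. w m S c)" for b i j k m c
  have null: "AE c in Q. \<forall>e>0. \<exists>m. m > k \<and> m \<ge> cond_level i j \<and> h b i j k m c < e" for b i j k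
  proof -
    \<comment> \<open>At least \<open>m\<close>, greater than \<open>k\<close>, and long enough to
      decide the premise of the condition.\<close>
    define n where "n m = max (max (cond_level i j) (Suc k)) m" for m
    define a where "a m S = (if S \<in> cond_prefixes b i j k (n m) then 1 else 0 :: real)" for m S
    have C0: "{} \<notin> cond_prefixes b i j k m" for m by (simp add: cond_prefixes_def)
    have h01: "0 \<le> h b i j k m c" "h b i j k m c \<le> 1" for m c
      using w01 by (auto simp: h_def intro!: prod_nonneg prod_le_1)
    have hm [measurable]: "h b i j k m \<in> borel_measurable Q" for m unfolding h_def[abs_def] by measurable
    have "(\<integral>c. (\<Prod>S\<in>cond_prefixes b i j k (n m). w (n m) S c) \<partial>Q) = L (\<lambda>x. a m (code x \<inter> {..<n m}))" for m
    proof -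
      have "{S\<in>Pow {..<n m} - {{}}. a m S \<noteq> 0} = cond_prefixes b i j k (n m)"
        using C0[of "n m"] by (auto simp: a_def cond_prefixes_def)
      with E1[of "a m" "n m"] C0[of "n m"] have "(\<integral>c. (\<Prod>S\<in>cond_prefixes b i j k (n m). w (n m) S c powr a m S) \<partial>Q) = L (\<lambda>x. a m (code x \<inter> {..<n m}))"
        by (auto simp: a_def)
      moreover have "(\<Prod>S\<in>cond_prefixes b i j k (n m). w (n m) S c powr a m S) = (\<Prod>S\<in>cond_prefixes b i j k (n m). w (n m) S c)" for c
        by (rule prod.cong) (auto simp: a_def w01)
      ultimately show ?thesis by simp
    qed
    moreover have "integrable Q (\<lambda>c. \<Prod>S\<in>cond_prefixes b i j k (n m). w (n m) S c)" for m
      using w01 by (intro bounded) (auto intro!: prod_nonneg prod_le_1)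
    ultimately have hL: "(\<integral>c. h b i j k (n m) c \<partial>Q) = 1 - L (\<lambda>x. a m (code x \<inter> {..<n m}))" for m
      unfolding h_def using Q.prob_space by simp
    have "(\<lambda>m. L (\<lambda>x. a m (code x \<inter> {..<n m}))) \<longlonglongrightarrow> 1"
    proof (rule L_zero[where g="indicator {x. k \<in> code x \<inter> {..<Suc k}}"])
      show "(\<lambda>x. a m (code x \<inter> {..<n m})) \<in> tests" for m
        using C0[of "n m"] by (auto simp: tests_def a_def intro!: exI[of _ "n m"] exI[of _ "a m"])
      show "indicator {x. k \<in> code x \<inter> {..<Suc k}} \<in> tests" by (rule tests_indicator) simp
      show "a m (code x \<inter> {..<n m}) \<le> indicator {x. k \<in> code x \<inter> {..<Suc k}} x" for m x
        by (auto simp: a_def cond_prefixes_def indicator_def)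
      fix x
      \<comment> \<open>The code of an actual point meets every condition: a witness
        \<open>l\<close> shows up as soon as the length exceeds \<open>l\<close>, and a false
        premise never yields a violating prefix. This is the pointwise convergence required by
        \<open>L_zero\<close>.\<close>
      have "eventually (\<lambda>m. a m (code x \<inter> {..<n m}) = 0) sequentially"
      proof (cases "cond_pre b i j (code x \<inter> {..<cond_level i j})")
        case True
        from cond_code[OF this] obtain l where l: "l \<in> cond_post b i j" "l \<in> code x" by blast
        have "a m (code x \<inter> {..<n m}) = 0" if "m > l" for m
        proof -
          have "l \<in> code x \<inter> {..<n m}" using that l(2) by (simp add: n_def)
          then have "code x \<inter> {..<n m} \<inter> cond_post b i j \<noteq> {}" using l(1) by blast
          then have "code x \<inter> {..<n m} \<notin> cond_prefixes b i j k (n m)" unfolding cond_prefixes_def by blast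
          then show ?thesis unfolding a_def by (rule if_not_P)
        qed
        then show ?thesis by (intro eventually_sequentiallyI[of "Suc l"]) simp
      next
        case False
        have "a m (code x \<inter> {..<n m}) = 0" for m
        proof -
          have "code x \<inter> {..<n m} \<inter> {..<cond_level i j} = code x \<inter> {..<cond_level i j}" by (auto simp: n_def)
          then have "code x \<inter> {..<n m} \<notin> cond_prefixes b i j k (n m)" using False unfolding cond_prefixes_def by simp
          then show ?thesis unfolding a_def by (rule if_not_P)
        qed
        then show ?thesis by simp
      qed
      then show "(\<lambda>m. a m (code x \<inter> {..<n m})) \<longlonglongrightarrow> 0" by (rule tendsto_eventually)
    qed
    \<comment> \<open>Means tending to 0 do not force almost sure convergence, but the mean of the
      infimum lies below each of them, so the infimum is 0 almost surely. One suitable level for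
      each \<open>e\<close> is all that \<open>measure_from_weights\<close> demands.\<close>
    from tendsto_diff[OF tendsto_const[of 1] this]
    have lim0: "(\<lambda>m. \<integral>c. h b i j k (n m) c \<partial>Q) \<longlonglongrightarrow> 0" unfolding hL by simp
    have "(\<integral>\<^sup>+c. (INF m. ennreal (h b i j k (n m) c)) \<partial>Q) = 0"
    proof -
      have "(\<integral>\<^sup>+c. (INF m. ennreal (h b i j k (n m) c)) \<partial>Q) \<le> ennreal (\<integral>c. h b i j k (n m) c \<partial>Q)" for m
      proof -
        have "(\<integral>\<^sup>+c. (INF m. ennreal (h b i j k (n m) c)) \<partial>Q) \<le> (\<integral>\<^sup>+c. ennreal (h b i j k (n m) c) \<partial>Q)"
          by (intro nn_integral_mono INF_lower) simp
        also have "\<dots> = ennreal (\<integral>c. h b i j k (n m) c \<partial>Q)"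
          using h01 by (intro nn_integral_eq_integral bounded) auto
        finally show ?thesis .
      qed
      then have "(\<integral>\<^sup>+c. (INF m. ennreal (h b i j k (n m) c)) \<partial>Q) \<le> ennreal 0"
        by (intro LIMSEQ_le_const[OF tendsto_ennrealI[OF lim0]]) auto
      then show ?thesis by simp
    qed
    then have "AE c in Q. (INF m. ennreal (h b i j k (n m) c)) = 0"
      by (subst (asm) nn_integral_0_iff_AE) auto
    then show ?thesis
    proof eventually_elim
      fix c assume z: "(INF m. ennreal (h b i j k (n m) c)) = 0"
      show "\<forall>e>0. \<exists>m. m > k \<and> m \<ge> cond_level i j \<and> h b i j k m c < e"
      proof (intro allI impI)
        fix e :: real assume "0 < e"
        then have "(INF m. ennreal (h b i j k (n m) c)) < ennreal e" using z by simp
        then obtain m where "ennreal (h b i j k (n m) c) < ennreal e" by (auto simp: INF_less_iff)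
        then have "h b i j k (n m) c < e" using h01 by (simp add: ennreal_less_iff)
        then show "\<exists>m. m > k \<and> m \<ge> cond_level i j \<and> h b i j k m c < e"
          by (intro exI[of _ "n m"]) (auto simp: n_def)
      qed
    qed
  qed
  define good where "good c \<longleftrightarrow> (\<exists>\<zeta>\<in>radon_measures. \<forall>n S. S \<subseteq> {..<n} \<longrightarrow> S \<noteq> {} \<longrightarrow> w n S c > 0 \<and> emeasure \<zeta> (cyl n S) = ennreal (- ln (w n S c)))" for c
  have "AE c in Q. good c"
  proof -
    \<comment> \<open>Numbering finite prefixes by \<open>set_decode\<close> leaves countably many
      almost sure statements to be combined.\<close>
    have "AE c in Q. \<forall>n m. set_decode m \<subseteq> {..<n} \<longrightarrow> set_decode m \<noteq> {} \<longrightarrow> w n (set_decode m) c > 0"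
      unfolding AE_all_countable using pos by (auto simp: AE_conj_iff intro!: AE_impI)
    moreover have "AE c in Q. \<forall>n m. set_decode m \<subseteq> {..<n} \<longrightarrow> set_decode m \<noteq> {} \<longrightarrow>
        w n (set_decode m) c = w (Suc n) (set_decode m) c * w (Suc n) (insert n (set_decode m)) c"
      unfolding AE_all_countable using additive by (auto simp: AE_conj_iff intro!: AE_impI)
    moreover have "AE c in Q. \<forall>b i j k. \<forall>e>0. \<exists>m. m > k \<and> m \<ge> cond_level i j \<and> h b i j k m c < e"
      unfolding AE_all_countable[where 'i=bool] AE_all_countable[where 'i=nat] using null by blast
    ultimately show ?thesis
    proof eventually_elim
      case (elim c)
      have pos: "w n S c > 0" and add: "w n S c = w (Suc n) S c * w (Suc n) (insert n S) c"
        if "S \<subseteq> {..<n}" "S \<noteq> {}" for n S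
        using elim(1,2)[rule_format, of "set_encode S" n] set_encode_inverse[OF finite_subset[OF that(1)]] that by auto
      define z where "z n S = (if S \<subseteq> {..<n} \<and> S \<noteq> {} then - ln (w n S c) else 0)" for n S
      have "\<exists>\<zeta>\<in>radon_measures. \<forall>n S. S \<subseteq> {..<n} \<longrightarrow> S \<noteq> {} \<longrightarrow> emeasure \<zeta> (cyl n S) = ennreal (z n S)"
      proof (rule measure_from_weights)
        show "0 \<le> z n S" for n S using pos[of S n] w01(2)[of n S c] by (auto simp: z_def)
        show "z n S = z (Suc n) S + z (Suc n) (insert n S)" if S: "S \<subseteq> {..<n}" "S \<noteq> {}" for n S
        proof -
          have S': "S \<subseteq> {..<Suc n}" "insert n S \<subseteq> {..<Suc n}" using S by auto
          show ?thesis using S S' pos[OF S'(1) S(2)] pos[OF S'(2)] add[OF S] by (simp add: z_def ln_mult)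
        qed
        fix b i j k and e :: real assume e: "0 < e"
        \<comment> \<open>\<open>h\<close> below \<open>1 - exp (- e)\<close> says that the product
          of the \<open>w\<close> exceeds \<open>exp (- e)\<close>, that is, the weights add up to
          less than \<open>e\<close>.\<close>
        then have "0 < 1 - exp (- e)" by simp
        then obtain m where m: "m > k" "m \<ge> cond_level i j" "h b i j k m c < 1 - exp (- e)"
          using elim(3)[rule_format] by blast
        have mem: "S \<subseteq> {..<m} \<and> S \<noteq> {}" if "S \<in> cond_prefixes b i j k m" for S using that by (auto simp: cond_prefixes_def)
        have fin: "finite (cond_prefixes b i j k m)" by (simp add: cond_prefixes_def)
        have "exp (- e) < (\<Prod>S\<in>cond_prefixes b i j k m. w m S c)" using m(3) by (simp add: h_def)
        also have "\<dots> = (\<Prod>S\<in>cond_prefixes b i j k m. exp (- z m S))"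
          by (rule prod.cong) (use mem pos in \<open>auto simp: z_def\<close>)
        also have "\<dots> = exp (- (\<Sum>S\<in>cond_prefixes b i j k m. z m S))" by (simp add: exp_sum[OF fin] sum_negf[symmetric])
        finally have "(\<Sum>S\<in>cond_prefixes b i j k m. z m S) < e" by simp
        then show "\<exists>n>k. n \<ge> cond_level i j \<and> (\<Sum>S\<in>cond_prefixes b i j k n. z n S) < e" using m by blast
      qed
      then show "good c" unfolding good_def using pos by (auto simp: z_def)
    qed
  qed
  then obtain G where G: "G \<in> sets Q" "emeasure Q (space Q - G) = 0" "\<And>c. c \<in> G \<Longrightarrow> good c"
  proof -
    assume *: "\<And>G. G \<in> sets Q \<Longrightarrow> emeasure Q (space Q - G) = 0 \<Longrightarrow> (\<And>c. c \<in> G \<Longrightarrow> good c) \<Longrightarrow> thesis"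
    from \<open>AE c in Q. good c\<close> obtain N where N: "{c\<in>space Q. \<not> good c} \<subseteq> N" "N \<in> sets Q" "emeasure Q N = 0"
      by (rule AE_E)
    show thesis
    proof (rule *[of "space Q - N"])
      have "space Q - (space Q - N) = N" using sets.sets_into_space[OF N(2)] by blast
      then show "emeasure Q (space Q - (space Q - N)) = 0" using N(3) by simp
    qed (use N in auto)
  qed
  \<comment> \<open>The choice by \<open>SOME\<close> does no harm to measurability, since the
    cylinder masses are given by \<open>w\<close> and are all that \<open>measurable_radonI\<close>
    inspects. Off the set \<open>G\<close> of full measure the zero measure is taken.\<close>
  define \<zeta> where "\<zeta> c = (if c \<in> G then (SOME \<zeta>. \<zeta> \<in> radon_measures \<and> (\<forall>n S. S \<subseteq> {..<n} \<longrightarrow> S \<noteq> {} \<longrightarrow>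
    w n S c > 0 \<and> emeasure \<zeta> (cyl n S) = ennreal (- ln (w n S c)))) else null_measure borel)" for c
  have \<zeta>G: "\<zeta> c \<in> radon_measures \<and> (\<forall>n S. S \<subseteq> {..<n} \<longrightarrow> S \<noteq> {} \<longrightarrow>
    w n S c > 0 \<and> emeasure (\<zeta> c) (cyl n S) = ennreal (- ln (w n S c)))" if "c \<in> G" for c
  proof -
    have "\<exists>\<zeta>. \<zeta> \<in> radon_measures \<and> (\<forall>n S. S \<subseteq> {..<n} \<longrightarrow> S \<noteq> {} \<longrightarrow> w n S c > 0 \<and> emeasure \<zeta> (cyl n S) = ennreal (- ln (w n S c)))"
      using G(3)[OF that] unfolding good_def by blast
    from someI_ex[OF this] show ?thesis unfolding \<zeta>_def if_P[OF that] .
  qed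
  have \<zeta>0: "\<zeta> c = null_measure borel" if "c \<notin> G" for c using that by (simp add: \<zeta>_def)
  have \<zeta>r: "\<zeta> c \<in> radon_measures" for c
  proof (cases "c \<in> G")
    case False
    then show ?thesis by (simp add: \<zeta>0 radon_measures_def)
  qed (use \<zeta>G in blast)
  have \<zeta>m: "\<zeta> \<in> Q \<rightarrow>\<^sub>M radon_algebra"
  proof (rule measurable_radonI[OF \<zeta>r])
    fix n and S :: "nat set" assume S: "S \<subseteq> {..<n}" "S \<noteq> {}"
    note [measurable] = G(1)
    have "(\<lambda>c. if c \<in> G then ennreal (- ln (w n S c)) else 0) \<in> borel_measurable Q" by measurable
    also have "(\<lambda>c. if c \<in> G then ennreal (- ln (w n S c)) else 0) = (\<lambda>c. emeasure (\<zeta> c) (cyl n S))"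
    proof
      show "(if c \<in> G then ennreal (- ln (w n S c)) else 0) = emeasure (\<zeta> c) (cyl n S)" for c
        using \<zeta>G[of c] \<zeta>0[of c] S by (cases "c \<in> G") simp_all
    qed
    finally show "(\<lambda>c. emeasure (\<zeta> c) (cyl n S)) \<in> borel_measurable Q" .
  qed
  show ?thesis
  proof (rule that[of "distr Q radon_algebra \<zeta>"])
    show "prob_space (distr Q radon_algebra \<zeta>)" by (rule Q.prob_space_distr[OF \<zeta>m])
    fix f assume f: "f \<in> tests"
    then obtain n a where a: "a {} = 0" "\<And>S. 0 \<le> a S" "f = (\<lambda>x. a (code x \<inter> {..<n}))" by (auto simp: tests_def)
    let ?I = "{S\<in>Pow {..<n} - {{}}. a S \<noteq> 0}"
    have "(\<integral>\<phi>. laplace f \<phi> \<partial>distr Q radon_algebra \<zeta>) = (\<integral>c. laplace f (\<zeta> c) \<partial>Q)"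
      by (rule integral_distr[OF \<zeta>m laplace_measurable[OF f]])
    also have "\<dots> = (\<integral>c. (\<Prod>S\<in>?I. w n S c powr a S) \<partial>Q)"
    proof (rule integral_cong_AE)
      show "(\<lambda>c. laplace f (\<zeta> c)) \<in> borel_measurable Q" by (rule measurable_compose[OF \<zeta>m laplace_measurable[OF f]])
      have "AE c in Q. c \<notin> space Q - G" using G by (intro AE_not_in) (auto simp: null_sets_def)
      then show "AE c in Q. laplace f (\<zeta> c) = (\<Prod>S\<in>?I. w n S c powr a S)"
      proof (rule AE_mp, intro AE_I2 impI)
        fix c assume "c \<in> space Q" "c \<notin> space Q - G"
        then have c: "c \<in> G" by simp
        have m: "w n S c > 0" "measure (\<zeta> c) (cyl n S) = - ln (w n S c)" if "S \<in> Pow {..<n} - {{}}" for S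
        proof -
          show "w n S c > 0" using \<zeta>G[OF c] that by auto
          then show "measure (\<zeta> c) (cyl n S) = - ln (w n S c)"
            using \<zeta>G[OF c] that w01(2)[of n S c] by (auto simp: measure_def)
        qed
        have "(\<Sum>S\<in>Pow {..<n} - {{}}. a S * measure (\<zeta> c) (cyl n S)) = (\<Sum>S\<in>?I. a S * measure (\<zeta> c) (cyl n S))"
          by (rule sum.mono_neutral_right) auto
        then have "laplace f (\<zeta> c) = (\<Prod>S\<in>?I. exp (- (a S * measure (\<zeta> c) (cyl n S))))"
          by (simp add: laplace_def a(3) integral_test(2)[where a=a and n=n, OF \<zeta>r a(1)] exp_sum sum_negf[symmetric])
        also have "\<dots> = (\<Prod>S\<in>?I. w n S c powr a S)"
        proof (rule prod.cong[OF refl])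
          fix S assume "S \<in> ?I"
          then have "S \<in> Pow {..<n} - {{}}" by simp
          from m[OF this] show "exp (- (a S * measure (\<zeta> c) (cyl n S))) = w n S c powr a S" by (simp add: powr_def)
        qed
        finally show "laplace f (\<zeta> c) = (\<Prod>S\<in>?I. w n S c powr a S)" .
      qed
    qed measurable
    also have "\<dots> = L f" unfolding a(3) by (rule E1[of a n, OF a(1,2)])
    finally show "(\<integral>\<phi>. laplace f \<phi> \<partial>distr Q radon_algebra \<zeta>) = L f" .
  qed simp
qed

end

section \<open>Cox processes and the theorem\<close>

context relatively_compact_base
begin

section \<open>Laplace functional and existence of Cox processes\<close>

text \<open>With \<open>C\<close> the whole space, the disintegration says that the law of
  \<open>\<Psi>\<close> is the law of \<open>\<zeta>\<close> followed by \<open>K\<close>; the inner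
  integral is given by \<open>laplace_poisson\<close>.\<close>

lemma cox_laplace:
  assumes cox: "cox_process M \<zeta> \<Psi>" and f: "f \<in> tests"
  shows "(\<integral>\<omega>. laplace f (\<Psi> \<omega>) \<partial>M) = (\<integral>\<omega>. laplace (\<lambda>x. 1 - exp (- f x)) (\<zeta> \<omega>) \<partial>M)"
proof -
  have M: "prob_space M" and \<zeta>: "\<zeta> \<in> M \<rightarrow>\<^sub>M radon_algebra" and \<Psi>: "\<Psi> \<in> M \<rightarrow>\<^sub>M counting_algebra"
    using cox by (auto simp: cox_process_def point_process_def random_measure_def counting_algebra_def
        intro!: measurable_restrict_space2)
  interpret prob_space M by fact
  from cox obtain K where K: "K \<in> radon_algebra \<rightarrow>\<^sub>M prob_algebra counting_algebra"
    and KP: "\<And>\<mu>. \<mu> \<in> radon_measures \<Longrightarrow> poisson_process \<mu> (K \<mu>) (\<lambda>\<phi>. \<phi>)"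
    and KC: "\<And>C A. C \<in> sets radon_algebra \<Longrightarrow> A \<in> sets counting_algebra \<Longrightarrow>
      emeasure M {\<omega>\<in>space M. \<zeta> \<omega> \<in> C \<and> \<Psi> \<omega> \<in> A} = (\<integral>\<^sup>+\<omega>. indicator C (\<zeta> \<omega>) * emeasure (K (\<zeta> \<omega>)) A \<partial>M)"
    unfolding cox_process_def by blast
  let ?Z = "distr M radon_algebra \<zeta>"
  have Z: "prob_space ?Z" by (rule prob_space_distr[OF \<zeta>])
  have KZ: "K \<in> ?Z \<rightarrow>\<^sub>M prob_algebra counting_algebra" using K by simp
  have ne: "space ?Z \<noteq> {}" using prob_space.not_empty[OF Z] .
  have Ks: "prob_space (K \<mu>)" "sets (K \<mu>) = sets counting_algebra" if "\<mu> \<in> radon_measures" for \<mu>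
    using measurable_space[OF K, of \<mu>] that by (auto simp: space_prob_algebra space_radon_algebra)
  have eq: "distr M counting_algebra \<Psi> = ?Z \<bind> K"
  proof (rule measure_eqI)
    show "sets (distr M counting_algebra \<Psi>) = sets (?Z \<bind> K)"
      using Ks ne by (subst sets_bind[of ?Z K counting_algebra]) (auto simp: space_radon_algebra)
    fix A assume "A \<in> sets (distr M counting_algebra \<Psi>)"
    then have A: "A \<in> sets counting_algebra" by simp
    have "emeasure (distr M counting_algebra \<Psi>) A = emeasure M {\<omega>\<in>space M. \<zeta> \<omega> \<in> space radon_algebra \<and> \<Psi> \<omega> \<in> A}"
      using measurable_space[OF \<zeta>] by (subst emeasure_distr[OF \<Psi> A]) (auto intro!: arg_cong[where f="emeasure M"])
    also have "\<dots> = (\<integral>\<^sup>+\<omega>. indicator (space radon_algebra) (\<zeta> \<omega>) * emeasure (K (\<zeta> \<omega>)) A \<partial>M)"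
      by (rule KC[OF sets.top A])
    also have "\<dots> = (\<integral>\<^sup>+\<omega>. emeasure (K (\<zeta> \<omega>)) A \<partial>M)"
      using measurable_space[OF \<zeta>] by (intro nn_integral_cong) simp
    also have "\<dots> = (\<integral>\<^sup>+\<mu>. emeasure (K \<mu>) A \<partial>?Z)"
      by (rule nn_integral_distr[symmetric, OF \<zeta> measurable_emeasure_kernel[OF measurable_prob_algebraD[OF KZ] A]])
    also have "\<dots> = emeasure (?Z \<bind> K) A"
      by (rule emeasure_bind[symmetric, OF ne measurable_prob_algebraD[OF KZ] A])
    finally show "emeasure (distr M counting_algebra \<Psi>) A = emeasure (?Z \<bind> K) A" .
  qed
  have l01: "laplace f x \<in> {0..1}" for x using laplace_01[of f x] tests_nonneg[OF f] by auto
  have "(\<integral>\<omega>. laplace f (\<Psi> \<omega>) \<partial>M) = (\<integral>\<phi>. laplace f \<phi> \<partial>(?Z \<bind> K))"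
    unfolding eq[symmetric] by (rule integral_distr[symmetric, OF \<Psi> laplace_restrict_counting[OF f]])
  also have "\<dots> = (\<integral>\<mu>. (\<integral>\<phi>. laplace f \<phi> \<partial>K \<mu>) \<partial>?Z)"
    by (rule integral_bind_bounded(1)[OF Z KZ laplace_restrict_counting[OF f] l01])
  also have "\<dots> = (\<integral>\<mu>. laplace (\<lambda>x. 1 - exp (- f x)) \<mu> \<partial>?Z)"
    using laplace_poisson[OF Ks KP _ f]
    by (intro Bochner_Integration.integral_cong) (auto simp: space_radon_algebra)
  also have "\<dots> = (\<integral>\<omega>. laplace (\<lambda>x. 1 - exp (- f x)) (\<zeta> \<omega>) \<partial>M)"
    by (rule integral_distr[OF \<zeta> laplace_measurable[OF tests_one_minus_exp[OF f]]])
  finally show ?thesis .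
qed

text \<open>Draw \<open>\<mu>\<close> from \<open>Z\<close>, keep it as the first coordinate, and
  draw the second from \<open>poisson_law \<mu>\<close>. Intensity and process are then the
  projections on a space of pairs.\<close>

lemma cox_process_exists:
  assumes Z: "prob_space Z" "sets Z = sets (radon_algebra :: 'a measure measure)"
  obtains N :: "('a measure \<times> 'a measure) measure" where "cox_process N fst snd" "distr N radon_algebra fst = Z"
proof -
  interpret Z: prob_space Z by fact
  let ?K = "poisson_law" and ?R = "radon_algebra :: 'a measure measure" and ?C = "counting_algebra :: 'a measure measure"
  have spZ: "space Z = radon_measures" using sets_eq_imp_space_eq[OF Z(2)] by (simp add: space_radon_algebra)
  define k where "k \<mu> = return ?R \<mu> \<Otimes>\<^sub>M poisson_law \<mu>" for \<mu>
  have K: "poisson_law \<in> Z \<rightarrow>\<^sub>M prob_algebra ?C"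
    using poisson_law_kernel measurable_cong_sets[OF Z(2) refl] by blast
  have k: "k \<in> Z \<rightarrow>\<^sub>M subprob_algebra (?R \<Otimes>\<^sub>M ?C)"
    unfolding k_def[abs_def]
  proof (rule measurable_pair_measure)
    show "return ?R \<in> Z \<rightarrow>\<^sub>M subprob_algebra ?R"
      using return_measurable[of ?R] measurable_cong_sets[OF Z(2) refl] by blast
  qed (rule measurable_prob_algebraD[OF K])
  define N where "N = Z \<bind> k"
  have N: "prob_space N" unfolding N_def
  proof (rule Z.prob_space_bind[OF AE_I2 k])
    fix \<mu> assume "\<mu> \<in> space Z"
    then show "prob_space (k \<mu>)" unfolding k_def
      by (intro prob_space_pair prob_space_return poisson_law_props(2)) (auto simp: spZ space_radon_algebra)
  qed
  interpret N: prob_space N by fact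
  have sN: "sets N = sets (?R \<Otimes>\<^sub>M ?C)"
    unfolding N_def using sets_kernel[OF k] Z.not_empty by (intro sets_bind) auto
  have spN: "space N = radon_measures \<times> counting_measures"
    using sets_eq_imp_space_eq[OF sN] by (simp add: space_pair_measure space_radon_algebra space_counting_algebra)
  have emN: "emeasure N (C \<times> A) = (\<integral>\<^sup>+\<mu>. indicator C \<mu> * emeasure (poisson_law \<mu>) A \<partial>Z)"
    if C: "C \<in> sets ?R" and A: "A \<in> sets ?C" for C A
  proof -
    have "emeasure N (C \<times> A) = (\<integral>\<^sup>+\<mu>. emeasure (k \<mu>) (C \<times> A) \<partial>Z)"
      unfolding N_def using Z.not_empty C A by (intro emeasure_bind[OF _ k]) auto
    also have "\<dots> = (\<integral>\<^sup>+\<mu>. indicator C \<mu> * emeasure (poisson_law \<mu>) A \<partial>Z)"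
    proof (rule nn_integral_cong)
      fix \<mu> assume "\<mu> \<in> space Z"
      then have \<mu>: "\<mu> \<in> radon_measures" by (simp add: spZ)
      interpret L: prob_space "poisson_law \<mu>" by (rule poisson_law_props(2)[OF \<mu>])
      show "emeasure (k \<mu>) (C \<times> A) = indicator C \<mu> * emeasure (poisson_law \<mu>) A"
        unfolding k_def using C A poisson_law_props(3)[OF \<mu>]
        by (subst L.emeasure_pair_measure_Times) auto
    qed
    finally show ?thesis .
  qed
  have m1: "fst \<in> N \<rightarrow>\<^sub>M ?R" and m2: "snd \<in> N \<rightarrow>\<^sub>M ?C"
    unfolding measurable_cong_sets[OF sN refl] by simp_all
  have m2': "snd \<in> N \<rightarrow>\<^sub>M ?R"
    using m2 unfolding counting_algebra_def by (simp add: measurable_restrict_space2_iff)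
  have dZ: "distr N ?R fst = Z"
  proof (rule measure_eqI)
    fix C assume "C \<in> sets (distr N ?R fst)"
    then have C: "C \<in> sets ?R" by simp
    have "fst -` C \<inter> space N = C \<times> space ?C"
      using sets.sets_into_space[OF C] by (auto simp: spN space_radon_algebra space_counting_algebra)
    then have "emeasure (distr N ?R fst) C = emeasure N (C \<times> space ?C)" by (simp add: emeasure_distr[OF m1 C])
    also have "\<dots> = (\<integral>\<^sup>+\<mu>. indicator C \<mu> * emeasure (poisson_law \<mu>) (space ?C) \<partial>Z)" by (rule emN[OF C sets.top])
    also have "\<dots> = (\<integral>\<^sup>+\<mu>. indicator C \<mu> \<partial>Z)"
    proof (rule nn_integral_cong)
      fix \<mu> assume "\<mu> \<in> space Z"
      then have \<mu>: "\<mu> \<in> radon_measures" by (simp add: spZ)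
      show "indicator C \<mu> * emeasure (poisson_law \<mu>) (space ?C) = indicator C \<mu>"
        using prob_space.emeasure_space_1[OF poisson_law_props(2)[OF \<mu>]] sets_eq_imp_space_eq[OF poisson_law_props(3)[OF \<mu>]]
        by simp
    qed
    also have "\<dots> = emeasure Z C" using C Z(2) by simp
    finally show "emeasure (distr N ?R fst) C = emeasure Z C" .
  qed (simp add: Z(2))
  have "cox_process N fst snd"
    unfolding cox_process_def
  proof (intro conjI bexI[OF _ poisson_law_kernel] ballI)
    show "random_measure N fst" using N m1 by (simp add: random_measure_def)
    show "point_process N snd" using N m2' by (auto simp: point_process_def random_measure_def spN)
    show "poisson_process \<mu> (poisson_law \<mu>) (\<lambda>\<phi>. \<phi>)" if "\<mu> \<in> radon_measures" for \<mu> using that by (rule poisson_law_process)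
    fix C A assume C: "C \<in> sets ?R" and A: "A \<in> sets ?C"
    have "{\<omega>\<in>space N. fst \<omega> \<in> C \<and> snd \<omega> \<in> A} = C \<times> A"
      using sets.sets_into_space[OF C] sets.sets_into_space[OF A] by (auto simp: spN space_radon_algebra space_counting_algebra)
    then have "emeasure N {\<omega>\<in>space N. fst \<omega> \<in> C \<and> snd \<omega> \<in> A} = (\<integral>\<^sup>+\<mu>. indicator C \<mu> * emeasure (poisson_law \<mu>) A \<partial>Z)"
      by (simp add: emN[OF C A])
    also have "\<dots> = (\<integral>\<^sup>+\<omega>. indicator C (fst \<omega>) * emeasure (poisson_law (fst \<omega>)) A \<partial>N)"
      unfolding dZ[symmetric]
    proof (rule nn_integral_distr[OF m1])
      show "(\<lambda>\<mu>. indicator C \<mu> * emeasure (poisson_law \<mu>) A) \<in> borel_measurable (distr N ?R fst)"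
        unfolding measurable_distr_eq1
        by (intro borel_measurable_times_ennreal borel_measurable_indicator C
            measurable_emeasure_kernel[OF measurable_prob_algebraD[OF poisson_law_kernel] A])
    qed
    finally show "emeasure N {\<omega>\<in>space N. fst \<omega> \<in> C \<and> snd \<omega> \<in> A} = (\<integral>\<^sup>+\<omega>. indicator C (fst \<omega>) * emeasure (poisson_law (fst \<omega>)) A \<partial>N)" .
  qed
  then show ?thesis using dZ that by blast
qed

section \<open>Rescaled sums of independent copies\<close>

text \<open>\<open>Q\<close> is the law of the sum of \<open>n\<close> independent copies, built up
  by convolution from the zero measure.\<close>

lemma laplace_convolution_power:
  assumes P: "prob_space P" "sets P = sets (radon_algebra :: 'a measure measure)"
  shows "\<exists>Q. prob_space Q \<and> sets Q = sets (radon_algebra :: 'a measure measure) \<and>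
    (\<forall>f\<in>tests. (\<integral>\<phi>. laplace f \<phi> \<partial>Q) = (\<integral>\<phi>. laplace f \<phi> \<partial>P) ^ n)"
proof (induction n)
  case 0
  let ?R = "radon_algebra :: 'a measure measure"
  have z: "null_measure borel \<in> space ?R" by (simp add: space_radon_algebra radon_measures_def)
  show ?case
  proof (intro exI[of _ "return ?R (null_measure borel)"] conjI ballI)
    show "prob_space (return ?R (null_measure borel))" by (rule prob_space_return[OF z])
    fix f assume f: "f \<in> tests"
    have "(\<integral>\<phi>. laplace f \<phi> \<partial>return ?R (null_measure borel)) = laplace f (null_measure borel)"
      by (rule integral_return[OF z laplace_measurable[OF f]])
    also have "\<dots> = 1" by (simp add: laplace_def)
    finally show "(\<integral>\<phi>. laplace f \<phi> \<partial>return ?R (null_measure borel)) = (\<integral>\<phi>. laplace f \<phi> \<partial>P) ^ 0" by simp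
  qed simp
next
  case (Suc n)
  let ?R = "radon_algebra :: 'a measure measure"
  from Suc.IH obtain Q where Q: "prob_space Q" "sets Q = sets ?R"
    "\<And>f. f \<in> tests \<Longrightarrow> (\<integral>\<phi>. laplace f \<phi> \<partial>Q) = (\<integral>\<phi>. laplace f \<phi> \<partial>P) ^ n" by blast
  interpret P: prob_space P by fact
  interpret Q: prob_space Q by fact
  interpret PQ: pair_prob_space P Q ..
  have add: "(\<lambda>(\<mu>, \<nu>). add_measure \<mu> \<nu>) \<in> P \<Otimes>\<^sub>M Q \<rightarrow>\<^sub>M ?R"
    using measurable_stable_combination[of 1 1, where 'a='a]
    unfolding measurable_cong_sets[OF sets_pair_measure_cong[OF P(2) Q(2)] refl] by simp
  show ?case
  proof (intro exI[of _ "distr (P \<Otimes>\<^sub>M Q) ?R (\<lambda>(\<mu>, \<nu>). add_measure \<mu> \<nu>)"] conjI ballI)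
    show "prob_space (distr (P \<Otimes>\<^sub>M Q) ?R (\<lambda>(\<mu>, \<nu>). add_measure \<mu> \<nu>))" by (rule PQ.P.prob_space_distr[OF add])
    fix f assume f: "f \<in> tests"
    have "(\<integral>\<phi>. laplace f \<phi> \<partial>distr (P \<Otimes>\<^sub>M Q) ?R (\<lambda>(\<mu>, \<nu>). add_measure \<mu> \<nu>))
        = (\<integral>z. laplace f (case z of (\<mu>, \<nu>) \<Rightarrow> add_measure \<mu> \<nu>) \<partial>(P \<Otimes>\<^sub>M Q))"
      by (rule integral_distr[OF add laplace_measurable[OF f]])
    also have "\<dots> = (\<integral>(\<mu>, \<nu>). laplace f \<mu> * laplace f \<nu> \<partial>(P \<Otimes>\<^sub>M Q))"
    proof (rule Bochner_Integration.integral_cong[OF refl])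
      fix z assume "z \<in> space (P \<Otimes>\<^sub>M Q)"
      then obtain \<mu> \<nu> where z: "z = (\<mu>, \<nu>)" "\<mu> \<in> radon_measures" "\<nu> \<in> radon_measures"
        using sets_eq_imp_space_eq[OF P(2)] sets_eq_imp_space_eq[OF Q(2)]
        by (auto simp: space_pair_measure space_radon_algebra)
      show "laplace f (case z of (\<mu>, \<nu>) \<Rightarrow> add_measure \<mu> \<nu>) = (case z of (\<mu>, \<nu>) \<Rightarrow> laplace f \<mu> * laplace f \<nu>)"
        using z(2,3) f by (simp add: z(1) laplace_add_measure radon_sets tests_integrable tests_nonneg)
    qed
    also have "\<dots> = (\<integral>\<mu>. laplace f \<mu> \<partial>P) * (\<integral>\<nu>. laplace f \<nu> \<partial>Q)"
      using laplace_measurable[OF f] measurable_cong_sets[OF P(2) refl] measurable_cong_sets[OF Q(2) refl]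
      by (intro integral_pair_mult P.prob_space_axioms Q.prob_space_axioms laplace_le_1 f) blast+
    finally show "(\<integral>\<phi>. laplace f \<phi> \<partial>distr (P \<Otimes>\<^sub>M Q) ?R (\<lambda>(\<mu>, \<nu>). add_measure \<mu> \<nu>)) = (\<integral>\<phi>. laplace f \<phi> \<partial>P) ^ Suc n"
      by (simp add: Q(3)[OF f])
  qed simp
qed

lemma laplace_rescaling:
  assumes P: "prob_space P" "sets P = sets (radon_algebra :: 'a measure measure)" and c: "0 \<le> c"
  shows "\<exists>Q. prob_space Q \<and> sets Q = sets (radon_algebra :: 'a measure measure) \<and>
    (\<forall>f\<in>tests. (\<integral>\<phi>. laplace f \<phi> \<partial>Q) = (\<integral>\<phi>. laplace (\<lambda>x. c * f x) \<phi> \<partial>P))"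
proof -
  let ?R = "radon_algebra :: 'a measure measure"
  have sp: "space P = radon_measures" using sets_eq_imp_space_eq[OF P(2)] by (simp add: space_radon_algebra)
  have m: "scale_measure (ennreal c) \<in> P \<rightarrow>\<^sub>M ?R"
  proof (rule measurable_radonI)
    show "scale_measure (ennreal c) \<phi> \<in> radon_measures" if "\<phi> \<in> space P" for \<phi>
      using that c by (auto simp: sp radon_measures_def ennreal_mult_less_top less_top)
    fix n and S :: "nat set"
    have [measurable]: "(\<lambda>\<phi>. emeasure \<phi> (cyl n S)) \<in> borel_measurable P"
      using measurable_emeasure_radon[OF cyl_borel] measurable_cong_sets[OF P(2) refl] by blast
    show "(\<lambda>\<phi>. emeasure (scale_measure (ennreal c) \<phi>) (cyl n S)) \<in> borel_measurable P" by simp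
  qed
  show ?thesis
  proof (intro exI[of _ "distr P ?R (scale_measure (ennreal c))"] conjI ballI)
    show "prob_space (distr P ?R (scale_measure (ennreal c)))" by (rule prob_space.prob_space_distr[OF P(1) m])
    fix f assume f: "f \<in> tests"
    have "(\<integral>\<phi>. laplace f \<phi> \<partial>distr P ?R (scale_measure (ennreal c))) = (\<integral>\<phi>. laplace f (scale_measure (ennreal c) \<phi>) \<partial>P)"
      by (rule integral_distr[OF m laplace_measurable[OF f]])
    also have "\<dots> = (\<integral>\<phi>. laplace (\<lambda>x. c * f x) \<phi> \<partial>P)"
      using c f by (intro Bochner_Integration.integral_cong) (auto simp: sp laplace_scale_measure tests_integrable)
    finally show "(\<integral>\<phi>. laplace f \<phi> \<partial>distr P ?R (scale_measure (ennreal c))) = (\<integral>\<phi>. laplace (\<lambda>x. c * f x) \<phi> \<partial>P)" .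
  qed simp
qed


section \<open>The two implications\<close>

lemma discrete_stable_imp_cox:
  fixes \<Phi> :: "'w \<Rightarrow> 'a measure"
  assumes \<alpha>: "0 < \<alpha>" and \<Phi>: "point_process M \<Phi>" and stable: "discrete_stable \<alpha> M \<Phi>"
  shows "\<exists>(N :: ('a measure \<times> 'a measure) measure) \<zeta> \<Psi>. strictly_stable \<alpha> N \<zeta> \<and> cox_process N \<zeta> \<Psi> \<and>
    distr M counting_algebra \<Phi> = distr N counting_algebra \<Psi>"
proof -
  have M: "prob_space M" and mR: "\<Phi> \<in> M \<rightarrow>\<^sub>M radon_algebra" and mC: "\<Phi> \<in> M \<rightarrow>\<^sub>M counting_algebra"
    using \<Phi> by (auto simp: point_process_def random_measure_def counting_algebra_def intro!: measurable_restrict_space2)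
  have \<Phi>r: "\<Phi> \<omega> \<in> radon_measures" if "\<omega> \<in> space M" for \<omega>
    using measurable_space[OF mR that] by (simp add: space_radon_algebra)
  interpret prob_space M by fact
  \<comment> \<open>Below 1, \<open>- ln (1 - h x)\<close> is again a test, which turns the product
    over points in \<open>G\<close> into a Laplace functional.\<close>
  define T where "T = {h\<in>tests. \<forall>x. h x < 1}"
  define G where "G h = (\<integral>\<omega>. laplace (\<lambda>x. - ln (1 - h x)) (\<Phi> \<omega>) \<partial>M)" for h
  have ln_tests: "(\<lambda>x. - ln (1 - h x)) \<in> tests" if "h \<in> T" for h
    by (rule tests_comp[where u="\<lambda>y. - ln (1 - y)"]) (use that tests_nonneg[of h] in \<open>auto simp: T_def\<close>)
  have T_cmult: "(\<lambda>x. c * h x) \<in> T" if "h \<in> T" "c \<in> {0..1}" for h c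
  proof -
    have "c * h x < 1" for x
      using that tests_nonneg[of h x] mult_left_le_one_le[of "h x" c] by (auto simp: T_def intro: le_less_trans)
    then show ?thesis using that tests_cmult by (auto simp: T_def)
  qed
  have G_stable: "G (\<lambda>x. t powr (1 / \<alpha>) * h x) * G (\<lambda>x. (1 - t) powr (1 / \<alpha>) * h x) = G h"
    if h: "h \<in> T" and t: "t \<in> {0..1}" for h t
  proof -
    have th: "thin p (\<lambda>x. - ln (1 - h x)) = (\<lambda>x. - ln (1 - p * h x))" for p
      using h by (auto simp: thin_def T_def algebra_simps)
    show ?thesis
      using discrete_stable_iff[OF \<Phi> \<alpha>] stable t ln_tests[OF h] unfolding G_def th[symmetric] by blast
  qed
  \<comment> \<open>Dominated convergence is applied twice: \<open>- ln (1 - g x)\<close> dominates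
    the integrals against each realisation, and the constant 1 dominates the Laplace functionals
    under the expectation.\<close>
  have G_cont: "(\<lambda>m. G (h m)) \<longlonglongrightarrow> G k"
    if h: "\<And>m :: nat. h m \<in> T" and k: "k \<in> T" and g: "g \<in> T" and le: "\<And>m x. h m x \<le> g x"
      and lim: "\<And>x. (\<lambda>m. h m x) \<longlonglongrightarrow> k x" for h k g
    unfolding G_def
  proof (rule integral_dominated_convergence[where w="\<lambda>_. 1"])
    have meas: "(\<lambda>\<omega>. laplace (\<lambda>x. - ln (1 - h x)) (\<Phi> \<omega>)) \<in> borel_measurable M" if "h \<in> T" for h
      by (rule measurable_compose[OF mR laplace_measurable[OF ln_tests[OF that]]])
    show "(\<lambda>\<omega>. laplace (\<lambda>x. - ln (1 - k x)) (\<Phi> \<omega>)) \<in> borel_measurable M" by (rule meas[OF k])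
    show "(\<lambda>\<omega>. laplace (\<lambda>x. - ln (1 - h m x)) (\<Phi> \<omega>)) \<in> borel_measurable M" for m by (rule meas[OF h])
    show "AE \<omega> in M. norm (laplace (\<lambda>x. - ln (1 - h m x)) (\<Phi> \<omega>)) \<le> 1" for m
      using laplace_le_1[OF ln_tests[OF h]] by (intro AE_I2) simp
    show "AE \<omega> in M. (\<lambda>m. laplace (\<lambda>x. - ln (1 - h m x)) (\<Phi> \<omega>)) \<longlonglongrightarrow> laplace (\<lambda>x. - ln (1 - k x)) (\<Phi> \<omega>)"
    proof (rule AE_I2)
      fix \<omega> assume \<omega>: "\<omega> \<in> space M"
      have int: "integrable (\<Phi> \<omega>) (\<lambda>x. - ln (1 - h x))" if "h \<in> T" for h
        by (rule tests_integrable[OF \<Phi>r[OF \<omega>] ln_tests[OF that]])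
      have "(\<lambda>m. \<integral>x. - ln (1 - h m x) \<partial>\<Phi> \<omega>) \<longlonglongrightarrow> (\<integral>x. - ln (1 - k x) \<partial>\<Phi> \<omega>)"
      proof (rule integral_dominated_convergence[where w="\<lambda>x. - ln (1 - g x)"])
        show "AE x in \<Phi> \<omega>. (\<lambda>m. - ln (1 - h m x)) \<longlonglongrightarrow> - ln (1 - k x)"
        proof (rule AE_I2)
          fix x
          have "1 - k x \<noteq> 0" using k by (auto simp: T_def dest: spec[of _ x])
          then show "(\<lambda>m. - ln (1 - h m x)) \<longlonglongrightarrow> - ln (1 - k x)" by (intro tendsto_intros lim)
        qed
        show "AE x in \<Phi> \<omega>. norm (- ln (1 - h m x)) \<le> - ln (1 - g x)" for m
        proof (rule AE_I2)
          fix x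
          have "0 \<le> - ln (1 - h m x)" by (rule tests_nonneg[OF ln_tests[OF h]])
          moreover have "g x < 1" using g by (simp add: T_def)
          then have "ln (1 - g x) \<le> ln (1 - h m x)" using le[of m x] by (intro ln_mono) auto
          ultimately show "norm (- ln (1 - h m x)) \<le> - ln (1 - g x)" by simp
        qed
      qed (use int h k g in \<open>auto intro: borel_measurable_integrable\<close>)
      then show "(\<lambda>m. laplace (\<lambda>x. - ln (1 - h m x)) (\<Phi> \<omega>)) \<longlonglongrightarrow> laplace (\<lambda>x. - ln (1 - k x)) (\<Phi> \<omega>)"
        unfolding laplace_def by (intro tendsto_exp tendsto_minus)
    qed
  qed simp
  define s where "s n = real n powr (- 1 / \<alpha>)" for n
  have s_pos: "0 < s n" "s n \<le> 1" if "1 \<le> n" for n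
    using that \<alpha> powr_mono[of "- 1 / \<alpha>" 0 "real n"] by (auto simp: s_def)
  have s1: "s 1 = 1" by (simp add: s_def)
  have G_pow: "G h = G (\<lambda>x. s n * h x) ^ n" if "1 \<le> n" "h \<in> T" for n h
    using that
  proof (induction n arbitrary: h rule: nat_induct_at_least)
    case base
    then show ?case using s1 by simp
  next
    case (Suc n)
    \<comment> \<open>For this \<open>t\<close> the second coefficient is \<open>s (Suc n)\<close>,
      and splitting the first factor into \<open>n\<close> copies multiplies its coefficient by
      \<open>s n\<close>, which gives \<open>s (Suc n)\<close> as well.\<close>
    let ?t = "real n / real (Suc n)"
    have t: "?t \<in> {0..1}" by simp
    have "1 - ?t = 1 / real (Suc n)" by (simp add: field_simps)
    then have t2: "(1 - ?t) powr (1 / \<alpha>) = s (Suc n)"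
      using \<alpha> unfolding s_def by (simp add: powr_divide powr_minus_divide del: of_nat_Suc)
    have t1: "s n * ?t powr (1 / \<alpha>) = s (Suc n)"
      using Suc.hyps unfolding s_def by (simp add: powr_divide powr_minus_divide del: of_nat_Suc)
    have "?t powr (1 / \<alpha>) \<in> {0..1}" using t \<alpha> by (auto intro!: powr_le1)
    then have tT: "(\<lambda>x. ?t powr (1 / \<alpha>) * h x) \<in> T" by (rule T_cmult[OF Suc.prems])
    have "G h = G (\<lambda>x. ?t powr (1 / \<alpha>) * h x) * G (\<lambda>x. s (Suc n) * h x)"
      using G_stable[OF Suc.prems t] unfolding t2 by simp
    also have "G (\<lambda>x. ?t powr (1 / \<alpha>) * h x) = G (\<lambda>x. s (Suc n) * h x) ^ n"
      using Suc.IH[OF tT] unfolding mult.assoc[symmetric] t1 .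
    finally show ?case by simp
  qed
  define ok where "ok n f \<longleftrightarrow> 1 \<le> n \<and> (\<lambda>x. s n * f x) \<in> T" for n and f :: "'a \<Rightarrow> real"
  have ok_ex: "\<exists>n. ok n f" if f: "f \<in> tests" for f
  proof -
    obtain C where C: "\<And>x. f x \<le> C" using tests_bounded[OF f] by blast
    have C0: "0 \<le> C" using C tests_nonneg[OF f] order_trans by blast
    \<comment> \<open>Then \<open>real n powr (1 / \<alpha>)\<close> exceeds the bound
      \<open>C\<close>, so scaling by \<open>s n\<close> brings the test below 1.\<close>
    obtain n :: nat where n: "(C + 1) powr \<alpha> < real n" using reals_Archimedean2 by blast
    have n0: "0 < real n" using n powr_ge_zero[of "C + 1" \<alpha>] by linarith
    have "C + 1 = ((C + 1) powr \<alpha>) powr (1 / \<alpha>)" using C0 \<alpha> by (simp add: powr_powr)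
    also have "\<dots> \<le> real n powr (1 / \<alpha>)" using n \<alpha> by (intro powr_mono2) auto
    finally have "f x < real n powr (1 / \<alpha>)" for x using C[of x] by linarith
    then have "s n * f x < 1" for x using n0 by (simp add: s_def powr_minus_divide divide_less_eq)
    then show ?thesis using n0 f s_pos[of n] unfolding ok_def T_def
      by (intro exI[of _ n]) (auto intro!: tests_cmult less_imp_le)
  qed
  have ok_le: "ok n f" if "ok n g" "f \<in> tests" "\<And>x. f x \<le> g x" for n f g
  proof -
    have "s n * f x < 1" for x
    proof -
      have "1 \<le> n" "s n * g x < 1" using that(1) by (auto simp: ok_def T_def)
      moreover from this have "s n * f x \<le> s n * g x" using s_pos[of n] by (intro mult_left_mono that(3)) simp
      ultimately show ?thesis by linarith
    qed
    then show ?thesis using that s_pos[of n] by (auto simp: ok_def T_def intro!: tests_cmult)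
  qed
  define L where "L f = (let n = SOME n. ok n f in G (\<lambda>x. s n * f x) ^ n)" for f
  \<comment> \<open>Two admissible numbers \<open>m\<close> and \<open>n\<close> are compared
    through their product: both values are the power with exponent \<open>m * n\<close> of
    \<open>G\<close> at \<open>s m * s n\<close> times \<open>f\<close>.\<close>
  have L: "L f = G (\<lambda>x. s n * f x) ^ n" if n: "ok n f" for n f
  proof -
    define m where "m = (SOME n. ok n f)"
    have m: "ok m f" unfolding m_def using n by (rule someI)
    have "G (\<lambda>x. s m * f x) = G (\<lambda>x. s n * (s m * f x)) ^ n"
      by (rule G_pow) (use m n in \<open>auto simp: ok_def\<close>)
    moreover have "G (\<lambda>x. s n * f x) = G (\<lambda>x. s m * (s n * f x)) ^ m"
      by (rule G_pow) (use m n in \<open>auto simp: ok_def\<close>)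
    ultimately show ?thesis
      unfolding L_def m_def[symmetric] Let_def by (simp add: power_mult[symmetric] mult.commute mult.left_commute)
  qed
  have L_zero: "(\<lambda>m. L (f m)) \<longlonglongrightarrow> 1"
    if f: "\<And>m :: nat. f m \<in> tests" and g: "g \<in> tests" and le: "\<And>m x. f m x \<le> g x" and lim: "\<And>x. (\<lambda>m. f m x) \<longlonglongrightarrow> 0" for f g
  proof -
    obtain n where n: "ok n g" using ok_ex[OF g] by blast
    have okf: "ok n (f m)" for m by (rule ok_le[OF n f le])
    have T0: "(\<lambda>_. 0) \<in> T" by (simp add: T_def tests_zero)
    have "(\<lambda>m. G (\<lambda>x. s n * f m x)) \<longlonglongrightarrow> G (\<lambda>_. 0)"
    proof (rule G_cont[of "\<lambda>m x. s n * f m x" "\<lambda>_. 0" "\<lambda>x. s n * g x"])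
      show "s n * f m x \<le> s n * g x" for m x using n s_pos[of n] by (intro mult_left_mono le) (auto simp: ok_def)
      show "(\<lambda>m. s n * f m x) \<longlonglongrightarrow> 0" for x using tendsto_mult[OF tendsto_const[of "s n"] lim[of x]] by simp
    qed (use okf n T0 in \<open>auto simp: ok_def\<close>)
    moreover have "G (\<lambda>_. 0) = 1" by (simp add: G_def laplace_def prob_space)
    ultimately have "(\<lambda>m. G (\<lambda>x. s n * f m x) ^ n) \<longlonglongrightarrow> 1 ^ n" by (intro tendsto_power) simp
    then show ?thesis unfolding L[OF okf] by simp
  qed
  let ?P = "distr M radon_algebra \<Phi>"
  have P: "prob_space ?P" by (rule prob_space_distr[OF mR])
  \<comment> \<open>Laws of sums of \<open>Suc n\<close> independent copies of
    \<open>\<Phi>\<close>, scaled by \<open>s (Suc n)\<close>; the shift keeps the argument of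
    \<open>s\<close> positive.\<close>
  have "\<exists>Q. prob_space Q \<and> sets Q = sets (radon_algebra :: 'a measure measure) \<and>
    (\<forall>f\<in>tests. (\<integral>\<phi>. laplace f \<phi> \<partial>Q) = G (\<lambda>x. 1 - exp (- (s (Suc n) * f x))) ^ Suc n)" for n
  proof -
    have s0: "0 \<le> s (Suc n)" using s_pos[of "Suc n"] by simp
    obtain P' where P': "prob_space P'" "sets P' = sets (radon_algebra :: 'a measure measure)"
      "\<And>f. f \<in> tests \<Longrightarrow> (\<integral>\<phi>. laplace f \<phi> \<partial>P') = (\<integral>\<phi>. laplace (\<lambda>x. s (Suc n) * f x) \<phi> \<partial>?P)"
      using laplace_rescaling[OF P sets_distr s0] by blast
    obtain Q where Q: "prob_space Q" "sets Q = sets (radon_algebra :: 'a measure measure)"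
      "\<And>f. f \<in> tests \<Longrightarrow> (\<integral>\<phi>. laplace f \<phi> \<partial>Q) = (\<integral>\<phi>. laplace f \<phi> \<partial>P') ^ Suc n"
      using laplace_convolution_power[OF P'(1,2), of "Suc n"] by blast
    have "(\<integral>\<phi>. laplace (\<lambda>x. s (Suc n) * f x) \<phi> \<partial>?P) = G (\<lambda>x. 1 - exp (- (s (Suc n) * f x)))" if "f \<in> tests" for f
      unfolding G_def using integral_distr[OF mR laplace_measurable[OF tests_cmult[OF that s0]]] by simp
    then show ?thesis using Q P'(3) by auto
  qed
  then obtain PP where PP: "\<And>n. prob_space (PP n)" "\<And>n. sets (PP n) = sets (radon_algebra :: 'a measure measure)"
    "\<And>n f. f \<in> tests \<Longrightarrow> (\<integral>\<phi>. laplace f \<phi> \<partial>PP n) = G (\<lambda>x. 1 - exp (- (s (Suc n) * f x))) ^ Suc n" by metis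
  have s_lim: "(\<lambda>n. s (Suc n)) \<longlonglongrightarrow> 0"
  proof -
    have "((\<lambda>x. x powr (- 1 / \<alpha>)) \<longlongrightarrow> 0) at_top" using \<alpha> by (intro tendsto_neg_powr filterlim_ident) auto
    then have "(\<lambda>n. real n powr (- 1 / \<alpha>)) \<longlonglongrightarrow> 0" by (rule filterlim_compose[OF _ filterlim_real_sequentially])
    then show ?thesis unfolding s_def by (rule LIMSEQ_Suc)
  qed
  have lim: "(\<lambda>n. \<integral>\<phi>. laplace f \<phi> \<partial>PP n) \<longlonglongrightarrow> L f" if f: "f \<in> tests" for f
  proof -
    obtain m where m: "ok m f" using ok_ex[OF f] by blast
    \<comment> \<open>Chosen so that \<open>s (Suc n) * k n x\<close> is
      \<open>1 - exp (- (s (Suc n) * f x))\<close>, which makes the Laplace functional of the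
      rescaled sum equal to \<open>L (k n)\<close>. As a difference quotient of the exponential,
      \<open>k n\<close> stays below \<open>f\<close> and tends to it.\<close>
    define k where "k n x = (1 - exp (- (s (Suc n) * f x))) / s (Suc n)" for n x
    have sp: "0 < s (Suc n)" for n using s_pos[of "Suc n"] by simp
    have k_tests: "k n \<in> tests" for n
      unfolding k_def
      by (rule tests_comp[OF f, where u="\<lambda>y. (1 - exp (- (s (Suc n) * y))) / s (Suc n)"])
        (use sp[of n] tests_nonneg[OF f] in auto)
    have k_le: "k n x \<le> f x" for n x
      unfolding k_def using exp_ge_add_one_self[of "- (s (Suc n) * f x)"] sp[of n] by (simp add: divide_le_eq mult.commute)
    have sk: "s (Suc n) * k n x = 1 - exp (- (s (Suc n) * f x))" for n x using sp[of n] by (simp add: k_def)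
    have "ok (Suc n) (k n)" for n
      unfolding ok_def T_def using tests_cmult[OF k_tests[of n] less_imp_le[OF sp[of n]]] by (simp add: sk)
    then have "(\<integral>\<phi>. laplace f \<phi> \<partial>PP n) = L (k n)" for n using L[of "Suc n" "k n"] by (simp add: PP(3)[OF f] sk)
    also have "L (k n) = G (\<lambda>x. s m * k n x) ^ m" for n by (rule L[OF ok_le[OF m k_tests k_le]])
    finally have eq: "(\<integral>\<phi>. laplace f \<phi> \<partial>PP n) = G (\<lambda>x. s m * k n x) ^ m" for n .
    have k_lim: "(\<lambda>n. k n x) \<longlonglongrightarrow> f x" for x
    proof -
      have "((\<lambda>u. 1 - exp (- (u * f x))) has_real_derivative f x) (at 0)"
        by (auto intro!: derivative_eq_intros)
      then have "((\<lambda>u. (1 - exp (- (u * f x))) / u) \<longlongrightarrow> f x) (at 0)" by (simp add: has_field_derivative_iff)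
      moreover have "filterlim (\<lambda>n. s (Suc n)) (at 0) sequentially"
        using s_lim sp by (intro filterlim_atI) (auto intro!: always_eventually simp: less_imp_neq[symmetric])
      ultimately show ?thesis unfolding k_def by (rule filterlim_compose)
    qed
    have "(\<lambda>n. G (\<lambda>x. s m * k n x)) \<longlonglongrightarrow> G (\<lambda>x. s m * f x)"
    proof (rule G_cont[of "\<lambda>n x. s m * k n x" "\<lambda>x. s m * f x" "\<lambda>x. s m * f x"])
      show "s m * k n x \<le> s m * f x" for n x using m s_pos[of m] by (intro mult_left_mono k_le) (auto simp: ok_def)
      show "(\<lambda>n. s m * k n x) \<longlonglongrightarrow> s m * f x" for x by (intro tendsto_mult tendsto_const k_lim)
    qed (use m ok_le[OF m k_tests k_le] in \<open>auto simp: ok_def\<close>)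
    then show ?thesis unfolding eq L[OF m] by (rule tendsto_power)
  qed
  obtain Z where Z: "prob_space Z" "sets Z = sets (radon_algebra :: 'a measure measure)"
    "\<And>f. f \<in> tests \<Longrightarrow> (\<integral>\<phi>. laplace f \<phi> \<partial>Z) = L f"
    by (rule random_measure_exists[of PP L, OF PP(1,2) lim L_zero], assumption+, rule that)
  obtain N :: "('a measure \<times> 'a measure) measure" where N: "cox_process N fst snd" "distr N radon_algebra fst = Z"
    by (rule cox_process_exists[OF Z(1,2)], rule that)
  have Np: "prob_space N" and N1: "fst \<in> N \<rightarrow>\<^sub>M radon_algebra" and N2: "snd \<in> N \<rightarrow>\<^sub>M counting_algebra"
    using N(1) by (auto simp: cox_process_def point_process_def random_measure_def counting_algebra_def
        intro!: measurable_restrict_space2)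
  have LN: "(\<integral>\<omega>. laplace f (fst \<omega>) \<partial>N) = L f" if "f \<in> tests" for f
    using integral_distr[OF N1 laplace_measurable[OF that]] Z(3)[OF that] N(2) by simp
  have "strictly_stable \<alpha> N fst"
    unfolding strictly_stable_iff[OF Np N1]
  proof (intro ballI)
    fix t :: real and f assume t: "t \<in> {0..1}" and f: "f \<in> tests"
    let ?a = "t powr (1 / \<alpha>)" and ?b = "(1 - t) powr (1 / \<alpha>)"
    have ab: "?a \<in> {0..1}" "?b \<in> {0..1}" using t \<alpha> by (auto intro!: powr_le1)
    obtain n where n: "ok n f" using ok_ex[OF f] by blast
    have okc: "ok n (\<lambda>x. c * f x)" if "c \<in> {0..1}" for c
      by (rule ok_le[OF n tests_cmult[OF f]]) (use that tests_nonneg[OF f] in \<open>auto intro: mult_left_le_one_le\<close>)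
    have "L (\<lambda>x. ?a * f x) * L (\<lambda>x. ?b * f x) = (G (\<lambda>x. ?a * (s n * f x)) * G (\<lambda>x. ?b * (s n * f x))) ^ n"
      unfolding L[OF okc[OF ab(1)]] L[OF okc[OF ab(2)]] power_mult_distrib by (simp add: mult.left_commute)
    also have "\<dots> = L f" using G_stable[of "\<lambda>x. s n * f x" t] n t unfolding L[OF n] by (simp add: ok_def)
    finally show "(\<integral>\<omega>. laplace (\<lambda>x. ?a * f x) (fst \<omega>) \<partial>N) * (\<integral>\<omega>. laplace (\<lambda>x. ?b * f x) (fst \<omega>) \<partial>N) = (\<integral>\<omega>. laplace f (fst \<omega>) \<partial>N)"
      using ab f by (simp add: LN tests_cmult)
  qed
  moreover have "distr M counting_algebra \<Phi> = distr N counting_algebra snd"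
  proof (rule laplace_eqI[OF counting_subset])
    show "prob_space (distr M counting_algebra \<Phi>)" by (rule prob_space_distr[OF mC])
    show "prob_space (distr N counting_algebra snd)" by (rule prob_space.prob_space_distr[OF Np N2])
    fix f assume f: "f \<in> tests"
    let ?h = "\<lambda>x. 1 - exp (- f x)"
    have h: "?h \<in> tests" by (rule tests_one_minus_exp[OF f])
    have "ok 1 ?h" using h unfolding ok_def T_def s1 by simp
    from L[OF this] have "L ?h = (\<integral>\<omega>. laplace f (\<Phi> \<omega>) \<partial>M)" unfolding s1 by (simp add: G_def)
    moreover have "L ?h = (\<integral>\<omega>. laplace f (snd \<omega>) \<partial>N)" using cox_laplace[OF N(1) f] LN[OF h] by simp
    ultimately show "(\<integral>\<phi>. laplace f \<phi> \<partial>distr M counting_algebra \<Phi>) = (\<integral>\<phi>. laplace f \<phi> \<partial>distr N counting_algebra snd)"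
      using integral_distr[OF mC laplace_restrict_counting[OF f]] integral_distr[OF N2 laplace_restrict_counting[OF f]] by simp
  qed (simp_all add: restrict_counting)
  ultimately show ?thesis using N(1) by blast
qed

text \<open>\<open>1 - exp (- thin p f x)\<close> equals \<open>p * (1 - exp (- f x))\<close>, so
  the equation for \<open>\<Phi>\<close> at \<open>f\<close> is the equation for
  \<open>\<zeta>\<close> at \<open>1 - exp (- f x)\<close>.\<close>

lemma cox_imp_discrete_stable:
  fixes \<Phi> :: "'w \<Rightarrow> 'a measure" and N :: "'v measure"
  assumes \<alpha>: "0 < \<alpha>" and \<Phi>: "point_process M \<Phi>" and stable: "strictly_stable \<alpha> N \<zeta>" and cox: "cox_process N \<zeta> \<Psi>"
    and eq: "distr M counting_algebra \<Phi> = distr N counting_algebra \<Psi>"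
  shows "discrete_stable \<alpha> M \<Phi>"
  unfolding discrete_stable_iff[OF \<Phi> \<alpha>]
proof (intro ballI)
  fix t :: real and f assume t: "t \<in> {0..1}" and f: "f \<in> tests"
  have mC: "\<Phi> \<in> M \<rightarrow>\<^sub>M counting_algebra" and N2: "\<Psi> \<in> N \<rightarrow>\<^sub>M counting_algebra"
    using \<Phi> cox by (auto simp: cox_process_def point_process_def random_measure_def counting_algebra_def
        intro!: measurable_restrict_space2)
  have N: "prob_space N" and N1: "\<zeta> \<in> N \<rightarrow>\<^sub>M radon_algebra"
    using cox by (auto simp: cox_process_def random_measure_def)
  have E: "(\<integral>\<omega>. laplace f (\<Phi> \<omega>) \<partial>M) = (\<integral>\<omega>. laplace (\<lambda>x. 1 - exp (- f x)) (\<zeta> \<omega>) \<partial>N)" if "f \<in> tests" for f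
    using integral_distr[OF mC laplace_restrict_counting[OF that]] integral_distr[OF N2 laplace_restrict_counting[OF that]]
      eq cox_laplace[OF cox that] by simp
  have th: "(\<integral>\<omega>. laplace (thin p f) (\<Phi> \<omega>) \<partial>M) = (\<integral>\<omega>. laplace (\<lambda>x. p * (1 - exp (- f x))) (\<zeta> \<omega>) \<partial>N)"
    if p: "p \<in> {0..1}" for p
  proof -
    have "(\<lambda>x. 1 - exp (- thin p f x)) = (\<lambda>x. p * (1 - exp (- f x)))"
      using thin_pos[OF p] by (simp add: thin_def algebra_simps)
    then show ?thesis using E[OF tests_thin[OF f p]] by simp
  qed
  have "t powr (1 / \<alpha>) \<in> {0..1}" "(1 - t) powr (1 / \<alpha>) \<in> {0..1}" using t \<alpha> by (auto intro!: powr_le1)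
  then show "(\<integral>\<omega>. laplace (thin (t powr (1 / \<alpha>)) f) (\<Phi> \<omega>) \<partial>M) * (\<integral>\<omega>. laplace (thin ((1 - t) powr (1 / \<alpha>)) f) (\<Phi> \<omega>) \<partial>M)
      = (\<integral>\<omega>. laplace f (\<Phi> \<omega>) \<partial>M)"
    using strictly_stable_iff[OF N N1, of \<alpha>] stable t tests_one_minus_exp[OF f] by (simp add: th E[OF f])
qed

end

section \<open>Existence of the base\<close>

text \<open>Locally compact Hausdorff spaces have neighbourhood bases of compact closed sets, so the
  nonempty members with compact closure of a countable basis suffice. \<open>from_nat_into\<close>
  lists them, with repetitions if they are finitely many.\<close>

lemma relatively_compact_base_exists:
  assumes "locally_compact_space (euclidean :: 'a::{second_countable_topology, t2_space} topology)"
  obtains U :: "nat \<Rightarrow> 'a::{second_countable_topology, t2_space} set" where "relatively_compact_base U"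
proof -
  have haus: "Hausdorff_space (euclidean :: 'a topology)"
    unfolding Hausdorff_space_def by (auto simp: disjnt_def) (metis hausdorff)
  have nb: "neighbourhood_base_of (\<lambda>C. compactin euclidean C \<and> closedin euclidean C) (euclidean :: 'a topology)"
    using locally_compact_space_neighbourhood_base_closedin haus assms by blast
  obtain B :: "'a set set" where B: "countable B" "topological_basis B" using ex_countable_basis by blast
  define A where "A = {b\<in>B. b \<noteq> {} \<and> compact (closure b)}"
  have base: "\<exists>b\<in>A. x \<in> b \<and> closure b \<subseteq> V" if V: "open V" "x \<in> V" for V and x :: 'a
  proof -
    obtain W C where W: "open W" "x \<in> W" "W \<subseteq> C" "C \<subseteq> V" "compact C" "closed C"
    proof -
      have "openin euclidean V \<and> x \<in> V" using V by simp
      then have "\<exists>W C. openin euclidean W \<and> (compactin euclidean C \<and> closedin euclidean C) \<and> x \<in> W \<and> W \<subseteq> C \<and> C \<subseteq> V"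
        using nb unfolding neighbourhood_base_of by blast
      then show ?thesis using that by auto
    qed
    obtain b where b: "b \<in> B" "x \<in> b" "b \<subseteq> W" using topological_basisE[OF B(2) W(1,2)] .
    have cb: "closure b \<subseteq> C" using b W by (intro closure_minimal) auto
    have "compact (C \<inter> closure b)" using W(5) by (intro compact_Int_closed) auto
    then have "compact (closure b)" using cb by (simp add: inf.absorb2)
    then show ?thesis using b cb W(4) by (auto simp: A_def)
  qed
  have ne: "A \<noteq> {}" using base[of UNIV undefined] by auto
  have cA: "countable A" using B(1) by (simp add: A_def)
  have "relatively_compact_base (from_nat_into A)"
  proof
    fix i
    have "from_nat_into A i \<in> A" by (rule from_nat_into[OF ne])
    then show "open (from_nat_into A i)" "from_nat_into A i \<noteq> {}" "compact (closure (from_nat_into A i))"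
      using B(2) by (auto simp: A_def topological_basis_open)
  next
    fix V and x :: 'a assume "open V" "x \<in> V"
    from base[OF this] obtain b where b: "b \<in> A" "x \<in> b" "closure b \<subseteq> V" by blast
    obtain i where "from_nat_into A i = b" using from_nat_into_surj[OF cA b(1)] by blast
    then show "\<exists>i. x \<in> from_nat_into A i \<and> closure (from_nat_into A i) \<subseteq> V" using b by blast
  qed
  then show ?thesis by (rule that)
qed

text \<open>The pairs in the sample space hold the intensity and the process, as produced by
  \<open>cox_process_exists\<close>; the converse implication is available over any sample
  space.\<close>

theorem theorem15:
  fixes M :: "'w measure"
    and \<Phi> :: "'w \<Rightarrow> 'a::{second_countable_topology, t2_space} measure"
    and \<alpha> :: real
  assumes "locally_compact_space (euclidean :: 'a topology)"
    and "0 < \<alpha>" and "\<alpha> \<le> 1"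
    and "point_process M \<Phi>"
  shows "discrete_stable \<alpha> M \<Phi> \<longleftrightarrow>
    (\<exists>(N :: ('a measure \<times> 'a measure) measure) \<zeta> \<Psi>.
       strictly_stable \<alpha> N \<zeta> \<and> cox_process N \<zeta> \<Psi> \<and>
       distr M counting_algebra \<Phi> = distr N counting_algebra \<Psi>)"
proof -
  obtain U :: "nat \<Rightarrow> 'a set" where "relatively_compact_base U"
    by (rule relatively_compact_base_exists[OF assms(1)])
  then interpret relatively_compact_base U .
  show ?thesis
    using discrete_stable_imp_cox[OF assms(2,4)] cox_imp_discrete_stable[OF assms(2,4)] by blast
qed

end
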